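(* Let $W$ be a bounded $\omega$-Stone space. Then $(\mathscr{T}(W),\prec)$ and $(\mathscr{P}(W),\prec)$ are isomorphic to each other as quasi-ordered systems, and have maximal elements $[\mathscr{X}(W)]$ and $[(\mathscr{S}(W),L_{W},f_{W})]$ respectively.
   Context: Maps are written on the right. A PO system is a set $P$ with an antisymmetric transitive relation $<$ (possibly $p<p$ for some $p$); $p\leqslant q$ means $p<q$ or $p=q$; $P^{d}=\{p\in P: p\nless p\}$; $p_{\uparrow}=\{q\in P: q\geqslant p\}$; for $S\subseteq P$, $S_\downarrow=\{p: p\leqslant s\text{ for some }s\in S\}$, $S_\uparrow=\{p:p\geqslant s\text{ for some }s\in S\}$; $S$ is a lower subset if $S=S_\downarrow$; $S_{\min}$ is the set of minimal elements of $(S,\leqslant)$ and $S_{\min}^d=S_{\min}\cap P^d$. $F$ is a finite foundation of $S$ if $F$ is a finite subset of $S_\downarrow$ with $S_\downarrow\subseteq F_\uparrow$; $P_\Delta=\{p\in P:\{p\}\text{ has a finite foundation}\}$. A morphism $\alpha\colon Q\to P$ is a map such that for each $q\in Q$, $\{r\in Q: r>q\}\alpha=\{p\in P: p>q\alpha\}$. A Stone space $W$ is a locally compact Hausdorff space with a base of compact open sets (the Stone space of a Boolean ring, possibly without $1$); it is an $\omega$-Stone space if $R=\mathrm{Co}(W)$, the Boolean ring of compact open subsets, is countable. For $A\in R$ let $(A)=\{C\in R: C\subseteq A\}$, with isomorphism class $[A]$; $A\neq\emptyset$ is pseudo-indecomposable (PI) if for all $B\in R$ with $B\subseteq A$, $(B)\cong(A)$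 or $(A-B)\cong(A)$. $W$ is primitive if every element of $R$ is the disjoint union of finitely many PI elements. $\{X_p\mid p\in P\}^{*}$ denotes a family of pairwise disjoint non-empty subsets $X_p$ of $W$ together with the remaining set $W-X$ (possibly empty), where $X=\bigcup_p X_p$. With $S'$ the set of limit points of $S$, it is a $P$-partition if $X_p'\cap X=\bigcup_{q<p}X_q$ for all $p\in P$. For $Y\subseteq W$, $T_{\mathscr{X}}(Y)=\{p: Y\cap X_p\neq\emptyset\}$. A compact open $A$ is $p$-trim if $T_{\mathscr{X}}(A)=p_{\uparrow}$ and, if $p\in P^d$, also $|A\cap X_p|=1$; $\mathrm{Trim}_p(\mathscr{X})$ is the set of $p$-trim sets; a set is trim if it is $p$-trim for some $p$; $\widehat{P}$ is the set of $p$ for which there is a $p$-trim set. A trim $P$-partition is a $P$-partition such that: (T1) every element of $W$ has a neighbourhood base of trim sets; (T2) for each $p\in\widehat P$, every element of $W$ with a neighbourhood base of $p$-trim sets lies in $X_p$; (T3) every point of each $X_p$ has a $p$-trim neighbourhood. An extended PO system is a triple $(P,L,f)$ where $P$ is a PO system, $L$ is a lower subset of $P$ with $L\subseteq P_\Delta$, and $f\colon L_{\min}^d\to\mathbb{N}_+$. $(P,L,f)\cong(Q,M,g)$ if there is an isomorphism $\alpha\colon P\to Q$ with $L\alpha=M$ and $g(p\alpha)=f(p)$ for $p\in L_{\min}^d$. A trim $P$-partition $\{Z_p\mid p\in P\}^*$ of a primitive Stone space is a bounded trim $(P,L,f)$-partition if $\overline{Z_p}$ is compact precisely when $p\in L$,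 $|Z_p|=f(p)$ for $p\in L_{\min}^d$, and the closure of $\bigcup_{p\in L}Z_p$ is compact; a bounded trim partition is a bounded trim $(P,L,f)$-partition for some $(P,L,f)$. For primitive $W$: $\mathscr{S}(W)=\{[A]\mid A\in R\text{ is PI}\}$ is the PO system with $[A]<[B]$ iff $(A)\times(B)\cong(A)$; $\mathscr{X}(W)=\{X_p\mid p\in\mathscr{S}(W)\}^*$, where $X_p$ is the set of points with a neighbourhood base of compact open sets $A$ with $[A]=p$ (this is a trim $\mathscr{S}(W)$-partition); $L_W=\{p\in\mathscr{S}(W)\mid\overline{X_p}\text{ is compact}\}$; $f_W(p)=|X_p|$ for $p\in(L_W)_{\min}^d$. $W$ is bounded if it is primitive and $\mathscr{X}(W)$ is a bounded trim $(\mathscr{S}(W),L_W,f_W)$-partition. For a $P$-partition $\mathscr{Z}=\{Z_p\}^*$ and $Q$-partition $\mathscr{Y}=\{Y_q\}^*$ satisfying T1, $\mathscr{Y}$ regularly refines $\mathscr{Z}$ via $\alpha\colon Q\to P$ if $Y_q\subseteq Z_{q\alpha}$ for all $q$, and $p\in T_{\mathscr{Y}}(A)\alpha$ for all $p\in\widehat P$ and $A\in\mathrm{Trim}_p(\mathscr{Z})$; it regularly refines $\mathscr{Z}$ if it does so via some $\alpha$. $\mathscr{T}(W)$ is the set of equivalence classes of bounded trim partitions of $W$, two being equivalent if they are the same up to homeomorphism of $W$ and relabelling (along an isomorphism of the index PO systems). $[\mathscr{Y}]\prec[\mathscr{Z}]$ in $\mathscr{T}(W)$ if some (equivalently any) element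 of $[\mathscr{Y}]$ regularly refines some element of $[\mathscr{Z}]$. $\mathscr{P}(W)$ is the set of isomorphism classes of extended PO systems $(P,L,f)$ for which there is a bounded trim $(P,L,f)$-partition of $W$. $[(Q,M,g)]\prec[(P,L,f)]$ in $\mathscr{P}(W)$ if there is a surjective morphism $\alpha\colon Q\to P$ such that $L=\{p\in P\mid Q(p)\subseteq M\}$ and $f(p)=\sum_{q\in Q(p)}g(q)$ for $p\in L_{\min}^d$, where $Q(p)=\{p\}\alpha^{-1}$. *)

theory Defs
  imports "HOL-Analysis.Analysis" "HOL-Algebra.Chinese_Remainder"
begin

section \<open>PO systems\<close>

text \<open>A PO system is a carrier \<open>P\<close> with a relation \<open>r\<close>, where \<open>(p, q) \<in> r\<close> stands for \<open>p < q\<close>;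
  in contrast to a strict order, \<open>(p, p) \<in> r\<close> is allowed.\<close>

definition po_system :: "'i set \<Rightarrow> 'i rel \<Rightarrow> bool" where
  "po_system P r \<longleftrightarrow> r \<subseteq> P \<times> P \<and> antisym r \<and> trans r"

definition po_le :: "'i rel \<Rightarrow> 'i \<Rightarrow> 'i \<Rightarrow> bool" where
  "po_le r p q \<longleftrightarrow> (p, q) \<in> r \<or> p = q"

definition po_d :: "'i set \<Rightarrow> 'i rel \<Rightarrow> 'i set" where
  "po_d P r = {p \<in> P. (p, p) \<notin> r}"

definition po_down :: "'i set \<Rightarrow> 'i rel \<Rightarrow> 'i set \<Rightarrow> 'i set" where
  "po_down P r S = {p \<in> P. \<exists>s\<in>S. po_le r p s}"

definition po_up :: "'i set \<Rightarrow> 'i rel \<Rightarrow> 'i set \<Rightarrow> 'i set" where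
  "po_up P r S = {p \<in> P. \<exists>s\<in>S. po_le r s p}"

definition lower_subset :: "'i set \<Rightarrow> 'i rel \<Rightarrow> 'i set \<Rightarrow> bool" where
  "lower_subset P r S \<longleftrightarrow> S \<subseteq> P \<and> S = po_down P r S"

definition po_min :: "'i rel \<Rightarrow> 'i set \<Rightarrow> 'i set" where
  "po_min r S = {p \<in> S. \<forall>q\<in>S. po_le r q p \<longrightarrow> q = p}"

definition po_min_d :: "'i set \<Rightarrow> 'i rel \<Rightarrow> 'i set \<Rightarrow> 'i set" where
  "po_min_d P r S = po_min r S \<inter> po_d P r"

definition finite_foundation :: "'i set \<Rightarrow> 'i rel \<Rightarrow> 'i set \<Rightarrow> 'i set \<Rightarrow> bool" where
  "finite_foundation P r S F \<longleftrightarrow>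
     finite F \<and> F \<subseteq> po_down P r S \<and> po_down P r S \<subseteq> po_up P r F"

definition po_Delta :: "'i set \<Rightarrow> 'i rel \<Rightarrow> 'i set" where
  "po_Delta P r = {p \<in> P. \<exists>F. finite_foundation P r {p} F}"

definition po_morphism :: "'i set \<Rightarrow> 'i rel \<Rightarrow> 'j set \<Rightarrow> 'j rel \<Rightarrow> ('i \<Rightarrow> 'j) \<Rightarrow> bool" where
  "po_morphism Q s P r \<alpha> \<longleftrightarrow> \<alpha> ` Q \<subseteq> P \<and>
     (\<forall>q\<in>Q. \<alpha> ` {t \<in> Q. (q, t) \<in> s} = {p \<in> P. (\<alpha> q, p) \<in> r})"

definition po_iso :: "'i set \<Rightarrow> 'i rel \<Rightarrow> 'j set \<Rightarrow> 'j rel \<Rightarrow> ('i \<Rightarrow> 'j) \<Rightarrow> bool" where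
  "po_iso P r Q s \<alpha> \<longleftrightarrow> bij_betw \<alpha> P Q \<and>
     (\<forall>p\<in>P. \<forall>q\<in>P. (p, q) \<in> r \<longleftrightarrow> (\<alpha> p, \<alpha> q) \<in> s)"

text \<open>Order isomorphisms are the isomorphisms for the above notion of morphism.\<close>

lemma po_iso_iff_morphism:
  "po_iso P r Q s \<alpha> \<longleftrightarrow> bij_betw \<alpha> P Q \<and> po_morphism P r Q s \<alpha>"
proof
  assume L: "po_iso P r Q s \<alpha>"
  then have im: "\<alpha> ` P = Q" and bij: "bij_betw \<alpha> P Q"
    and rel: "\<And>p q. p \<in> P \<Longrightarrow> q \<in> P \<Longrightarrow> (p, q) \<in> r \<longleftrightarrow> (\<alpha> p, \<alpha> q) \<in> s"
    by (auto simp: po_iso_def bij_betw_def)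
  have "\<alpha> ` {t \<in> P. (q, t) \<in> r} = {p \<in> Q. (\<alpha> q, p) \<in> s}" if "q \<in> P" for q
    using rel that by (auto simp flip: im)
  then show "bij_betw \<alpha> P Q \<and> po_morphism P r Q s \<alpha>"
    using bij im by (auto simp: po_morphism_def)
next
  assume R: "bij_betw \<alpha> P Q \<and> po_morphism P r Q s \<alpha>"
  then have inj: "inj_on \<alpha> P" and im: "\<alpha> ` P = Q"
    and mor: "\<And>q. q \<in> P \<Longrightarrow> \<alpha> ` {t \<in> P. (q, t) \<in> r} = {p \<in> Q. (\<alpha> q, p) \<in> s}"
    by (auto simp: bij_betw_def po_morphism_def)
  have "(p, q) \<in> r \<longleftrightarrow> (\<alpha> p, \<alpha> q) \<in> s" if "p \<in> P" "q \<in> P" for p q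
  proof -
    have "\<alpha> q \<in> \<alpha> ` {t \<in> P. (p, t) \<in> r} \<longleftrightarrow> (p, q) \<in> r"
      using inj that by (auto simp: inj_on_def)
    then show ?thesis
      using mor[OF \<open>p \<in> P\<close>] im that by auto
  qed
  then show "po_iso P r Q s \<alpha>"
    using R by (simp add: po_iso_def)
qed

text \<open>Extended PO systems \<open>(P, L, f)\<close>; only the values of \<open>f\<close> on \<open>L\<^sub>m\<^sub>i\<^sub>n\<^sup>d\<close> matter.\<close>

definition extended_po :: "'i set \<Rightarrow> 'i rel \<Rightarrow> 'i set \<Rightarrow> ('i \<Rightarrow> nat) \<Rightarrow> bool" where
  "extended_po P r L f \<longleftrightarrow> po_system P r \<and> lower_subset P r L \<and> L \<subseteq> po_Delta P r \<and>
     (\<forall>p\<in>po_min_d P r L. f p > 0)"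

type_synonym 'i ext_po = "'i set \<times> 'i rel \<times> 'i set \<times> ('i \<Rightarrow> nat)"

definition ext_po_isos :: "('i ext_po) rel" where
  "ext_po_isos = {((P, r, L, f), (Q, s, M, g)).
     extended_po P r L f \<and> extended_po Q s M g \<and>
     (\<exists>\<alpha>. po_iso P r Q s \<alpha> \<and> \<alpha> ` L = M \<and> (\<forall>p\<in>po_min_d P r L. g (\<alpha> p) = f p))}"

text \<open>The relation inducing \<open>\<prec>\<close> on isomorphism classes of extended PO systems. Finiteness of the
  fibres is spelled out since an infinite sum of positive numbers cannot equal \<open>f p\<close>.\<close>

definition ext_po_below :: "'i ext_po \<Rightarrow> 'i ext_po \<Rightarrow> bool" where
  "ext_po_below = (\<lambda>(Q, s, M, g) (P, r, L, f). \<exists>\<alpha>.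
     po_morphism Q s P r \<alpha> \<and> \<alpha> ` Q = P \<and>
     L = {p \<in> P. {q \<in> Q. \<alpha> q = p} \<subseteq> M} \<and>
     (\<forall>p\<in>po_min_d P r L. finite {q \<in> Q. \<alpha> q = p} \<and> f p = (\<Sum>q\<in>{q \<in> Q. \<alpha> q = p}. g q)))"


section \<open>Stone spaces\<close>

definition compact_opens :: "'w topology \<Rightarrow> 'w set set" where
  "compact_opens W = {A. compactin W A \<and> openin W A}"

definition stone_space :: "'w topology \<Rightarrow> bool" where
  "stone_space W \<longleftrightarrow> locally_compact_space W \<and> Hausdorff_space W \<and>
     openin W = arbitrary union_of (\<lambda>U. U \<in> compact_opens W)"

definition omega_stone_space :: "'w topology \<Rightarrow> bool" where
  "omega_stone_space W \<longleftrightarrow> stone_space W \<and> countable (compact_opens W)"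

text \<open>The Boolean ring \<open>(A)\<close> of compact open subsets of \<open>A\<close>, which has unit \<open>A\<close>.\<close>

definition below_ring :: "'w topology \<Rightarrow> 'w set \<Rightarrow> 'w set ring" where
  "below_ring W A = \<lparr>carrier = {C \<in> compact_opens W. C \<subseteq> A},
     mult = (\<lambda>C D. C \<inter> D), one = A, ring.zero = {}, add = (\<lambda>C D. sym_diff C D)\<rparr>"

text \<open>\<open>[A]\<close>, represented as the set of all members \<open>B\<close> of the ring of compact open sets
  with \<open>(B) \<cong> (A)\<close>.\<close>

definition co_class :: "'w topology \<Rightarrow> 'w set \<Rightarrow> 'w set set" where
  "co_class W A = {B \<in> compact_opens W. below_ring W B \<simeq> below_ring W A}"

definition pseudo_indecomposable :: "'w topology \<Rightarrow> 'w set \<Rightarrow> bool" where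
  "pseudo_indecomposable W A \<longleftrightarrow> A \<in> compact_opens W \<and> A \<noteq> {} \<and>
     (\<forall>B\<in>compact_opens W. B \<subseteq> A \<longrightarrow>
        below_ring W B \<simeq> below_ring W A \<or> below_ring W (A - B) \<simeq> below_ring W A)"

definition primitive_stone_space :: "'w topology \<Rightarrow> bool" where
  "primitive_stone_space W \<longleftrightarrow> stone_space W \<and>
     (\<forall>A\<in>compact_opens W. \<exists>\<D>. finite \<D> \<and> pairwise disjnt \<D> \<and>
        (\<forall>D\<in>\<D>. pseudo_indecomposable W D) \<and> \<Union>\<D> = A)"


section \<open>Trim partitions\<close>

text \<open>A partition \<open>{X\<^sub>p | p \<in> P}\<^sup>*\<close> is given by the PO system \<open>(P, r)\<close> and the function \<open>X\<close>, whose
  values outside \<open>P\<close> are irrelevant.\<close>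

definition po_partition :: "'w topology \<Rightarrow> 'i set \<Rightarrow> 'i rel \<Rightarrow> ('i \<Rightarrow> 'w set) \<Rightarrow> bool" where
  "po_partition W P r X \<longleftrightarrow> po_system P r \<and>
     (\<forall>p\<in>P. X p \<noteq> {} \<and> X p \<subseteq> topspace W) \<and> disjoint_family_on X P \<and>
     (\<forall>p\<in>P. (W derived_set_of X p) \<inter> (\<Union>q\<in>P. X q) = (\<Union>q\<in>{q \<in> P. (q, p) \<in> r}. X q))"

definition type_set :: "'i set \<Rightarrow> ('i \<Rightarrow> 'w set) \<Rightarrow> 'w set \<Rightarrow> 'i set" where
  "type_set P X Y = {p \<in> P. Y \<inter> X p \<noteq> {}}"

definition trim_at ::
  "'w topology \<Rightarrow> 'i set \<Rightarrow> 'i rel \<Rightarrow> ('i \<Rightarrow> 'w set) \<Rightarrow> 'i \<Rightarrow> 'w set set" where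
  "trim_at W P r X p = {A \<in> compact_opens W. type_set P X A = po_up P r {p} \<and>
     (p \<in> po_d P r \<longrightarrow> card (A \<inter> X p) = 1)}"

definition trim_set ::
  "'w topology \<Rightarrow> 'i set \<Rightarrow> 'i rel \<Rightarrow> ('i \<Rightarrow> 'w set) \<Rightarrow> 'w set \<Rightarrow> bool" where
  "trim_set W P r X A \<longleftrightarrow> (\<exists>p\<in>P. A \<in> trim_at W P r X p)"

definition trim_indices ::
  "'w topology \<Rightarrow> 'i set \<Rightarrow> 'i rel \<Rightarrow> ('i \<Rightarrow> 'w set) \<Rightarrow> 'i set" where
  "trim_indices W P r X = {p \<in> P. trim_at W P r X p \<noteq> {}}"

definition trim_partition ::
  "'w topology \<Rightarrow> 'i set \<Rightarrow> 'i rel \<Rightarrow> ('i \<Rightarrow> 'w set) \<Rightarrow> bool" where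
  "trim_partition W P r X \<longleftrightarrow> po_partition W P r X \<and>
     (\<forall>w\<in>topspace W. neighbourhood_base_at w (trim_set W P r X) W) \<and>
     (\<forall>p\<in>trim_indices W P r X. \<forall>w\<in>topspace W.
        neighbourhood_base_at w (\<lambda>A. A \<in> trim_at W P r X p) W \<longrightarrow> w \<in> X p) \<and>
     (\<forall>p\<in>P. \<forall>w\<in>X p. \<exists>A\<in>trim_at W P r X p. w \<in> A)"

text \<open>Positivity of \<open>f\<close> makes \<open>card (X p) = f p\<close> include finiteness of \<open>X p\<close>.\<close>

definition bounded_trim_partition_for ::
  "'w topology \<Rightarrow> 'i set \<Rightarrow> 'i rel \<Rightarrow> 'i set \<Rightarrow> ('i \<Rightarrow> nat) \<Rightarrow> ('i \<Rightarrow> 'w set) \<Rightarrow> bool" where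
  "bounded_trim_partition_for W P r L f X \<longleftrightarrow>
     primitive_stone_space W \<and> extended_po P r L f \<and> trim_partition W P r X \<and>
     (\<forall>p\<in>P. compactin W (W closure_of X p) \<longleftrightarrow> p \<in> L) \<and>
     (\<forall>p\<in>po_min_d P r L. card (X p) = f p) \<and>
     compactin W (W closure_of (\<Union>p\<in>L. X p))"

definition bounded_trim_partition ::
  "'w topology \<Rightarrow> 'i set \<Rightarrow> 'i rel \<Rightarrow> ('i \<Rightarrow> 'w set) \<Rightarrow> bool" where
  "bounded_trim_partition W P r X \<longleftrightarrow> (\<exists>L f. bounded_trim_partition_for W P r L f X)"

definition regularly_refines_via ::
  "'w topology \<Rightarrow> 'j set \<Rightarrow> ('j \<Rightarrow> 'w set) \<Rightarrow> 'i set \<Rightarrow> 'i rel \<Rightarrow> ('i \<Rightarrow> 'w set) \<Rightarrow>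
     ('j \<Rightarrow> 'i) \<Rightarrow> bool" where
  "regularly_refines_via W Q Y P r Z \<alpha> \<longleftrightarrow> \<alpha> ` Q \<subseteq> P \<and> (\<forall>q\<in>Q. Y q \<subseteq> Z (\<alpha> q)) \<and>
     (\<forall>p\<in>trim_indices W P r Z. \<forall>A\<in>trim_at W P r Z p. p \<in> \<alpha> ` type_set Q Y A)"


section \<open>The canonical partition of a primitive space\<close>

definition canon_index :: "'w topology \<Rightarrow> 'w set set set" where
  "canon_index W = {co_class W A | A. pseudo_indecomposable W A}"

definition canon_rel :: "'w topology \<Rightarrow> ('w set set) rel" where
  "canon_rel W = {(co_class W A, co_class W B) | A B.
     pseudo_indecomposable W A \<and> pseudo_indecomposable W B \<and>
     RDirProd (below_ring W A) (below_ring W B) \<simeq> below_ring W A}"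

definition canon_part :: "'w topology \<Rightarrow> 'w set set \<Rightarrow> 'w set" where
  "canon_part W p = {w \<in> topspace W.
     neighbourhood_base_at w (\<lambda>A. A \<in> compact_opens W \<and> co_class W A = p) W}"

definition canon_L :: "'w topology \<Rightarrow> 'w set set set" where
  "canon_L W = {p \<in> canon_index W. compactin W (W closure_of canon_part W p)}"

definition canon_f :: "'w topology \<Rightarrow> 'w set set \<Rightarrow> nat" where
  "canon_f W p = card (canon_part W p)"

definition bounded_stone_space :: "'w topology \<Rightarrow> bool" where
  "bounded_stone_space W \<longleftrightarrow> primitive_stone_space W \<and>
     bounded_trim_partition_for W (canon_index W) (canon_rel W) (canon_L W) (canon_f W)
       (canon_part W)"


section \<open>The quasi-ordered systems of partitions and of extended PO systems\<close>

text \<open>Index sets are taken in the type \<^typ>\<open>'w set set\<close>, which contains the index set of the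
  canonical partition. Up to relabelling this is no restriction: the index set of any partition
  of \<open>W\<close>, over whatever type, embeds into it by the following lemma.\<close>

lemma po_partition_index_embeds:
  assumes "po_partition W P r X"
  shows "inj_on (\<lambda>p. {X p}) P"
proof (rule inj_onI)
  fix p q assume "p \<in> P" "q \<in> P" "{X p} = {X q}"
  with assms show "p = q"
    unfolding po_partition_def disjoint_family_on_def by (metis inf.idem singleton_inject)
qed

type_synonym 'w indexed_partition =
  "'w set set set \<times> ('w set set) rel \<times> ('w set set \<Rightarrow> 'w set)"

definition bounded_trim_partitions :: "'w topology \<Rightarrow> 'w indexed_partition set" where
  "bounded_trim_partitions W = {(P, r, X). bounded_trim_partition W P r X}"

definition partition_equiv :: "'w topology \<Rightarrow> ('w indexed_partition) rel" where
  "partition_equiv W = {((Q, s, Y), (P, r, Z)).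
     bounded_trim_partition W Q s Y \<and> bounded_trim_partition W P r Z \<and>
     (\<exists>h \<alpha>. homeomorphic_map W W h \<and> po_iso Q s P r \<alpha> \<and> (\<forall>q\<in>Q. h ` Y q = Z (\<alpha> q)))}"

definition T_sys :: "'w topology \<Rightarrow> 'w indexed_partition set set" where
  "T_sys W = bounded_trim_partitions W // partition_equiv W"

definition T_prec :: "'w topology \<Rightarrow> ('w indexed_partition set) rel" where
  "T_prec W = {(\<Y>, \<Z>). \<Y> \<in> T_sys W \<and> \<Z> \<in> T_sys W \<and>
     (\<exists>(Q, s, Y)\<in>\<Y>. \<exists>(P, r, Z)\<in>\<Z>. \<exists>\<alpha>. regularly_refines_via W Q Y P r Z \<alpha>)}"

definition P_sys :: "'w topology \<Rightarrow> ('w set set) ext_po set set" where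
  "P_sys W = {(P, r, L, f). \<exists>X. bounded_trim_partition_for W P r L f X} // ext_po_isos"

definition P_prec :: "'w topology \<Rightarrow> (('w set set) ext_po set) rel" where
  "P_prec W = {(E, F). E \<in> P_sys W \<and> F \<in> P_sys W \<and> (\<exists>e\<in>E. \<exists>e'\<in>F. ext_po_below e e')}"

definition T_canon :: "'w topology \<Rightarrow> 'w indexed_partition set" where
  "T_canon W = partition_equiv W `` {(canon_index W, canon_rel W, canon_part W)}"

definition P_canon :: "'w topology \<Rightarrow> ('w set set) ext_po set" where
  "P_canon W = ext_po_isos `` {(canon_index W, canon_rel W, canon_L W, canon_f W)}"

definition qo_isomorphic :: "'a set \<Rightarrow> 'a rel \<Rightarrow> 'b set \<Rightarrow> 'b rel \<Rightarrow> bool" where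
  "qo_isomorphic A r B s \<longleftrightarrow> (\<exists>\<phi>. bij_betw \<phi> A B \<and>
     (\<forall>x\<in>A. \<forall>y\<in>A. (x, y) \<in> r \<longleftrightarrow> (\<phi> x, \<phi> y) \<in> s))"

text \<open>Maximality with respect to a quasi-order, which need not be antisymmetric.\<close>

definition qo_maximal :: "'a set \<Rightarrow> 'a rel \<Rightarrow> 'a \<Rightarrow> bool" where
  "qo_maximal A r m \<longleftrightarrow> m \<in> A \<and> (\<forall>x\<in>A. (m, x) \<in> r \<longrightarrow> (x, m) \<in> r)"

end

theory Submission
  imports Defs
begin

text \<open>Everything rests on a uniqueness theorem (\<open>bounded_trim_partition_unique\<close>): if two
  \<open>\<omega>\<close>-Stone spaces carry bounded trim \<open>(P, L, f)\<close>-partitions for the same extended PO system,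
  then some homeomorphism carries each part to the part with the same index.
  It is proved by a back-and-forth argument over the countable rings of compact open sets
  (\<open>back_and_forth\<close>). Two compact open sets count as alike if they meet the same parts and contain
  equally many points of each part whose index \<open>p\<close> is minimal among the indices they meet and satisfies \<open>(p, p) \<notin> r\<close>;
  every other part that meets a compact open set has infinitely many points in it. The step of the argument
  (\<open>compact_split\<close>) works because a compact open set falls into trim sets, one
  around each point of a finite set, its \<^emph>\<open>spine\<close>: every other point of a part has an index above that
  of a spine point, so what is left after choosing trim neighbourhoods of the spine can be
  absorbed by these neighbourhoods (\<open>spine_decomposition\<close>). A spine can be copied into any alike
  set, since a part that has to supply more points than counted is infinite there
  (\<open>spine_transfer\<close>). If the space is not compact, \<open>L\<close> tells the parts that lie in some compact
  set from those that do not, and outside a large compact set there are trim sets of every index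
  not in \<open>L\<close> (\<open>cocompact_match\<close>).

  By uniqueness, sending a bounded trim partition to its extended PO system is injective on
  equivalence classes, and it is onto by the definition of \<open>P_sys\<close>. It also respects the orders in both
  directions. A regular refinement is a surjective morphism with the required behaviour on \<open>L\<close> and \<open>f\<close>
  (\<open>covering_morphism_if_refines\<close>), by the description of derived sets in a partition. Conversely, such a
  morphism merges the parts of the finer partition into a bounded trim partition for the
  coarser system (\<open>coarsening_bounded\<close>), and by uniqueness this is equivalent to any given one.
  The second system is a quasi-order because morphisms compose, and the first inherits this.

  For maximality, all trim sets of one index are homeomorphic, again by back and forth. Hence they
  are pseudo-indecomposable of one isomorphism class, so every part of every trim partition lies
  in a single part of the canonical one (\<open>part_subset_canon_part\<close>). If the canonical partition
  regularly refines \<open>\<Z>\<close>, then each of the two partitions has its parts inside parts of the other, and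
  \<open>\<Z>\<close> regularly refines the canonical partition in turn.\<close>

section \<open>Compact open sets\<close>

lemma
  assumes "stone_space W"
  shows stone_Hausdorff: "Hausdorff_space W"
    and stone_base: "\<And>U x. openin W U \<Longrightarrow> x \<in> U \<Longrightarrow> \<exists>A\<in>compact_opens W. x \<in> A \<and> A \<subseteq> U"
  using assms unfolding stone_space_def openin_topology_base_unique by blast+

lemma compact_opens_iff: "A \<in> compact_opens W \<longleftrightarrow> openin W A \<and> compactin W A"
  by (auto simp: compact_opens_def)

lemma compact_opens_subset_topspace: "A \<in> compact_opens W \<Longrightarrow> A \<subseteq> topspace W"
  by (auto simp: compact_opens_def compactin_def)

lemma compact_opens_closedin:
  "Hausdorff_space W \<Longrightarrow> A \<in> compact_opens W \<Longrightarrow> closedin W A"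
  by (simp add: compact_opens_def compactin_imp_closedin)

lemma empty_in_compact_opens [simp]: "{} \<in> compact_opens W"
  by (simp add: compact_opens_def)

lemma compact_opens_Un:
  "A \<in> compact_opens W \<Longrightarrow> B \<in> compact_opens W \<Longrightarrow> A \<union> B \<in> compact_opens W"
  by (simp add: compact_opens_def compactin_Un openin_Un)

lemma compact_opens_Union:
  "finite \<A> \<Longrightarrow> \<A> \<subseteq> compact_opens W \<Longrightarrow> \<Union>\<A> \<in> compact_opens W"
  by (induction rule: finite_induct) (auto intro: compact_opens_Un)

lemma clopen_Int_compact_open:
  assumes "openin W A" "closedin W A" "B \<in> compact_opens W"
  shows "A \<inter> B \<in> compact_opens W"
  using assms by (auto simp: compact_opens_def intro: closed_Int_compactin)

lemma compact_opens_Int: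
  assumes "Hausdorff_space W" "A \<in> compact_opens W" "B \<in> compact_opens W"
  shows "A \<inter> B \<in> compact_opens W"
  using assms clopen_Int_compact_open compact_opens_closedin compact_opens_iff by metis

lemma compact_open_Diff_clopen:
  assumes "openin W B" "closedin W B" "A \<in> compact_opens W"
  shows "A - B \<in> compact_opens W"
proof -
  have "A - B = (topspace W - B) \<inter> A"
    using compact_opens_subset_topspace[OF assms(3)] by auto
  then show ?thesis
    using clopen_Int_compact_open[OF _ _ assms(3), of "topspace W - B"] assms by auto
qed

lemma compact_opens_Diff:
  assumes "Hausdorff_space W" "A \<in> compact_opens W" "B \<in> compact_opens W"
  shows "A - B \<in> compact_opens W"
  using assms compact_open_Diff_clopen compact_opens_closedin compact_opens_iff by metis

text \<open>For a bounded partition this puts all parts with index in \<open>L\<close> into a single compact open set.\<close>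

lemma compact_subset_compact_open:
  assumes "stone_space W" "compactin W C"
  shows "\<exists>A\<in>compact_opens W. C \<subseteq> A"
proof -
  have C: "C \<subseteq> topspace W"
    and cover: "\<And>\<U>. (\<forall>U\<in>\<U>. openin W U) \<Longrightarrow> C \<subseteq> \<Union>\<U> \<Longrightarrow> \<exists>\<F>. finite \<F> \<and> \<F> \<subseteq> \<U> \<and> C \<subseteq> \<Union>\<F>"
    using assms(2) unfolding compactin_def by simp_all
  have "C \<subseteq> \<Union>(compact_opens W)"
    using C stone_base[OF assms(1) openin_topspace] by blast
  then obtain \<F> where "finite \<F>" "\<F> \<subseteq> compact_opens W" "C \<subseteq> \<Union>\<F>"
    using cover[of "compact_opens W"] by (auto simp: compact_opens_iff)
  then show ?thesis
    using compact_opens_Union by blast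
qed

lemma compactin_finite_subcover:
  assumes "compactin W A" "\<And>U. U \<in> \<U> \<Longrightarrow> openin W U" "A \<subseteq> \<Union>\<U>"
  obtains \<F> where "finite \<F>" "\<F> \<subseteq> \<U>" "A \<subseteq> \<Union>\<F>"
  using assms unfolding compactin_def by meson

lemma compact_opens_UN:
  "finite I \<Longrightarrow> (\<And>i. i \<in> I \<Longrightarrow> A i \<in> compact_opens W) \<Longrightarrow> (\<Union>i\<in>I. A i) \<in> compact_opens W"
  by (intro compact_opens_Union) auto

lemma neighbourhood_base_at_open:
  assumes "\<And>A. T A \<Longrightarrow> openin W A"
  shows "neighbourhood_base_at x T W \<longleftrightarrow> (\<forall>U. openin W U \<and> x \<in> U \<longrightarrow> (\<exists>A. T A \<and> x \<in> A \<and> A \<subseteq> U))"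
proof -
  have "(\<exists>U' V. openin W U' \<and> T V \<and> x \<in> U' \<and> U' \<subseteq> V \<and> V \<subseteq> U) \<longleftrightarrow> (\<exists>A. T A \<and> x \<in> A \<and> A \<subseteq> U)" for U
    using assms by (meson order_refl subsetD)
  then show ?thesis
    unfolding neighbourhood_base_at_def by simp
qed

lemma homeomorphic_map_compact_opens:
  assumes "homeomorphic_map W V h" "A \<in> compact_opens W"
  shows "h ` A \<in> compact_opens V"
  using assms homeomorphic_map_openness_eq[OF assms(1)] homeomorphic_map_compactness_eq[OF assms(1)]
  by (auto simp: compact_opens_def)

lemma homeomorphic_map_inverseE:
  assumes "homeomorphic_map X Y h"
  obtains k where "homeomorphic_map Y X k" "\<And>x. x \<in> topspace X \<Longrightarrow> k (h x) = x"
    "\<And>y. y \<in> topspace Y \<Longrightarrow> h (k y) = y"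
proof -
  obtain k where "homeomorphic_maps X Y h k"
    using assms homeomorphic_map_maps by blast
  then show thesis
    unfolding homeomorphic_maps_map using that by blast
qed

lemma compact_closure_mono:
  assumes "compactin W (W closure_of B)" "A \<subseteq> W closure_of B"
  shows "compactin W (W closure_of A)"
  using closed_compactin[OF assms(1)] closure_of_minimal[OF assms(2) closedin_closure_of] closedin_closure_of by blast

section \<open>Back and forth between Stone spaces\<close>

text \<open>A finite approximation to a homeomorphism between \<open>U\<close> and \<open>V\<close>: corresponding pieces of two partitions.
  Empty pieces may occur, which saves a case distinction when pieces are split.\<close>

definition matching ::
  "('v set \<Rightarrow> 'w set \<Rightarrow> bool) \<Rightarrow> 'v set \<Rightarrow> 'w set \<Rightarrow> ('v set \<times> 'w set) set \<Rightarrow> bool" where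
  "matching E U V R \<longleftrightarrow> finite R \<and> (\<forall>(A, B)\<in>R. E A B) \<and> \<Union>(fst ` R) = U \<and> \<Union>(snd ` R) = V \<and>
     (\<forall>a\<in>R. \<forall>b\<in>R. a \<noteq> b \<longrightarrow> fst a \<inter> fst b = {} \<and> snd a \<inter> snd b = {})"

lemma matchingD:
  assumes "matching E U V R"
  shows "finite R" "\<And>a. a \<in> R \<Longrightarrow> E (fst a) (snd a)"
    and "\<Union>(fst ` R) = U" "\<Union>(snd ` R) = V"
    and "\<And>a b. a \<in> R \<Longrightarrow> b \<in> R \<Longrightarrow> a \<noteq> b \<Longrightarrow> fst a \<inter> fst b = {}"
    and "\<And>a b. a \<in> R \<Longrightarrow> b \<in> R \<Longrightarrow> a \<noteq> b \<Longrightarrow> snd a \<inter> snd b = {}"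
  using assms unfolding matching_def by (simp_all add: case_prod_beta)

definition finer :: "('v set \<times> 'w set) set \<Rightarrow> ('v set \<times> 'w set) set \<Rightarrow> bool" where
  "finer R' R \<longleftrightarrow> (\<forall>b\<in>R'. \<exists>a\<in>R. fst b \<subseteq> fst a \<and> snd b \<subseteq> snd a)"

lemma finer_trans: "finer R'' R' \<Longrightarrow> finer R' R \<Longrightarrow> finer R'' R"
  unfolding finer_def by (meson subset_trans)

lemma matching_converse: "matching E U V R \<Longrightarrow> matching (\<lambda>B A. E A B) V U (R\<inverse>)"
proof -
  have "fst ` (R\<inverse>) = snd ` R" "snd ` (R\<inverse>) = fst ` R"
    by force+
  moreover have "fst a = snd (prod.swap a)" "snd a = fst (prod.swap a)" "prod.swap a \<in> R" if "a \<in> R\<inverse>" for a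
    using that by auto
  ultimately show "matching E U V R \<Longrightarrow> matching (\<lambda>B A. E A B) V U (R\<inverse>)"
    unfolding matching_def by (smt (verit, best) case_prod_beta finite_converse swap_swap)
qed

lemma finer_converse: "finer R' R \<Longrightarrow> finer (R'\<inverse>) (R\<inverse>)"
  unfolding finer_def by force

lemma split_matching:
  assumes R: "matching E U V R"
    and split: "\<And>A B. E A B \<Longrightarrow> \<exists>D\<subseteq>B. E (A \<inter> C) D \<and> E (A - C) (B - D)"
  shows "\<exists>R'. matching E U V R' \<and> finer R' R \<and> (\<forall>b\<in>R'. fst b \<subseteq> C \<or> fst b \<inter> C = {})"
proof -
  have "\<forall>a\<in>R. \<exists>D\<subseteq>snd a. E (fst a \<inter> C) D \<and> E (fst a - C) (snd a - D)"
    using matchingD(2)[OF R] split by blast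
  then obtain D where D: "\<And>a. a \<in> R \<Longrightarrow> D a \<subseteq> snd a \<and> E (fst a \<inter> C) (D a) \<and> E (fst a - C) (snd a - D a)"
    by metis
  then have D_sub: "\<And>a. a \<in> R \<Longrightarrow> D a \<subseteq> snd a"
    by blast
  define R' where "R' = (\<Union>a\<in>R. {(fst a \<inter> C, D a), (fst a - C, snd a - D a)})"
  have "finite R'"
    using R by (auto simp: R'_def matching_def)
  moreover have "\<forall>(A, B)\<in>R'. E A B"
    using D by (auto simp: R'_def)
  moreover have "\<Union>(fst ` R') = \<Union>(fst ` R)"
    unfolding R'_def by auto
  moreover have "\<Union>(snd ` R') = (\<Union>a\<in>R. D a \<union> (snd a - D a))"
    unfolding R'_def by auto
  then have "\<Union>(snd ` R') = \<Union>(snd ` R)"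
    using D by blast
  moreover have "fst b \<inter> fst b' = {} \<and> snd b \<inter> snd b' = {}" if b: "b \<in> R'" "b' \<in> R'" "b \<noteq> b'" for b b'
  proof -
    obtain a a' where a: "a \<in> R" "b = (fst a \<inter> C, D a) \<or> b = (fst a - C, snd a - D a)"
      and a': "a' \<in> R" "b' = (fst a' \<inter> C, D a') \<or> b' = (fst a' - C, snd a' - D a')"
      using b unfolding R'_def by blast
    show ?thesis
    proof (cases "a = a'")
      case True
      then show ?thesis using a a' b(3) by auto
    next
      case False
      then have "fst a \<inter> fst a' = {}" "snd a \<inter> snd a' = {}"
        using R a a' unfolding matching_def by blast+
      moreover have "fst b \<subseteq> fst a" "fst b' \<subseteq> fst a'" "snd b \<subseteq> snd a" "snd b' \<subseteq> snd a'"
        using a a' D_sub[of a] D_sub[of a'] by auto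
      ultimately show ?thesis by blast
    qed
  qed
  ultimately have "matching E U V R'"
    using R unfolding matching_def by presburger
  moreover have "finer R' R"
  proof (unfold finer_def, intro ballI)
    fix b assume "b \<in> R'"
    then obtain a where "a \<in> R" "b = (fst a \<inter> C, D a) \<or> b = (fst a - C, snd a - D a)"
      unfolding R'_def by blast
    then show "\<exists>a\<in>R. fst b \<subseteq> fst a \<and> snd b \<subseteq> snd a"
      using D_sub[of a] by (intro bexI[of _ a]) auto
  qed
  moreover have "\<forall>b\<in>R'. fst b \<subseteq> C \<or> fst b \<inter> C = {}"
    unfolding R'_def by auto
  ultimately show ?thesis by blast
qed

text \<open>The pieces that contain \<open>x\<close> correspond to a decreasing sequence of pieces of \<open>Y\<close>. As \<open>x\<close> has a compact
  neighbourhood, these are compact from some stage on, hence have a common point, and only one because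
  the pieces separate the points of \<open>Y\<close>. The lemma is applied to the converse
  matchings as well, which gives the inverse of the limit map.\<close>

lemma limit_point_unique:
  fixes R :: "nat \<Rightarrow> ('v set \<times> 'w set) set"
  assumes stone: "stone_space X" "stone_space Y"
    and E: "\<And>A B. E A B \<Longrightarrow> openin X A \<and> closedin X A \<and> closedin Y B \<and> (A \<noteq> {} \<longrightarrow> B \<noteq> {}) \<and>
         (compactin X A \<longrightarrow> compactin Y B)"
    and R: "\<And>n. matching E U V (R n)" and dec: "\<And>n. finer (R (Suc n)) (R n)"
    and split1: "\<And>C. C \<in> compact_opens X \<Longrightarrow> \<exists>n. \<forall>a\<in>R n. fst a \<subseteq> C \<or> fst a \<inter> C = {}"
    and split2: "\<And>D. D \<in> compact_opens Y \<Longrightarrow> \<exists>n. \<forall>a\<in>R n. snd a \<subseteq> D \<or> snd a \<inter> D = {}"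
    and x: "x \<in> U"
  shows "\<exists>!y. \<forall>n. \<exists>a\<in>R n. x \<in> fst a \<and> y \<in> snd a"
proof -
  have "\<forall>n. \<exists>a\<in>R n. x \<in> fst a"
    using matchingD(3)[OF R] x by auto
  then obtain a where a: "\<And>n. a n \<in> R n" "\<And>n. x \<in> fst (a n)"
    by metis
  have uniq: "b = a n" if "b \<in> R n" "x \<in> fst b" for b n
  proof (rule ccontr)
    assume "b \<noteq> a n"
    then have "fst b \<inter> fst (a n) = {}"
      using matchingD(5)[OF R] a(1) that by blast
    then show False
      using a(2)[of n] that by blast
  qed
  have Ea: "E (fst (a n)) (snd (a n))" for n
    using matchingD(2)[OF R a(1)] .
  have "snd (a (Suc n)) \<subseteq> snd (a n)" for n
  proof -
    obtain b where "b \<in> R n" "fst (a (Suc n)) \<subseteq> fst b" "snd (a (Suc n)) \<subseteq> snd b"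
      using dec[of n] a(1)[of "Suc n"] unfolding finer_def by blast
    then show ?thesis
      using uniq[of b n] a(2)[of "Suc n"] by (metis subsetD)
  qed
  then have decB: "decseq (\<lambda>n. snd (a n))"
    by (rule decseq_SucI)
  have "x \<in> topspace X"
    using E[OF Ea[of 0]] a(2)[of 0] openin_subset by blast
  then obtain C where C: "C \<in> compact_opens X" "x \<in> C"
    using stone_base[OF stone(1) openin_topspace] by blast
  then obtain m where "\<forall>b\<in>R m. fst b \<subseteq> C \<or> fst b \<inter> C = {}"
    using split1 by blast
  then have "fst (a m) \<subseteq> C"
    using a[of m] C by blast
  then have "compactin X (fst (a m))"
    using C E[OF Ea[of m]] closed_compactin by (auto simp: compact_opens_def)
  then have m: "compactin Y (snd (a m))"
    using E[OF Ea[of m]] by blast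
  \<comment> \<open>from stage \<open>m\<close> on, the pieces are compact\<close>
  have "(\<Inter>n. snd (a (n + m))) \<noteq> {}"
  proof (rule compact_space_imp_nest)
    show "compact_space (subtopology Y (snd (a m)))"
      using m by (rule compact_space_subtopology)
    show "closedin (subtopology Y (snd (a m))) (snd (a (n + m)))" for n
      by (rule closedin_subset_topspace) (use E[OF Ea[of "n + m"]] decseqD[OF decB, of m "n + m"] in auto)
    show "snd (a (n + m)) \<noteq> {}" for n
      using E[OF Ea[of "n + m"]] a(2)[of "n + m"] by blast
    show "decseq (\<lambda>n. snd (a (n + m)))"
      using decB by (simp add: decseq_def)
  qed
  then obtain y where y: "\<And>n. y \<in> snd (a (n + m))"
    by blast
  have yB: "y \<in> snd (a n)" for n
    using y[of n] decseqD[OF decB, of n "n + m"] by auto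
  have ex: "\<forall>n. \<exists>a\<in>R n. x \<in> fst a \<and> y \<in> snd a"
  proof
    show "\<exists>a\<in>R n. x \<in> fst a \<and> y \<in> snd a" for n
      using a(1)[of n] a(2)[of n] yB[of n] by blast
  qed
  have "y' = y" if y': "\<forall>n. \<exists>a\<in>R n. x \<in> fst a \<and> y' \<in> snd a" for y'
  proof (rule ccontr)
    assume ne: "y' \<noteq> y"
    have y'B: "y' \<in> snd (a n)" for n
    proof -
      obtain b where "b \<in> R n" "x \<in> fst b" "y' \<in> snd b"
        using y'[rule_format, of n] by blast
      then show ?thesis using uniq[of b n] by simp
    qed
    have "y \<in> topspace Y" "y' \<in> topspace Y"
      using E[OF Ea[of 0]] yB[of 0] y'B[of 0] closedin_subset by blast+
    then obtain O1 O2 where O: "openin Y O1" "openin Y O2" "y \<in> O1" "y' \<in> O2" "disjnt O1 O2"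
      using stone_Hausdorff[OF stone(2)] ne unfolding Hausdorff_space_def by metis
    then obtain D where D: "D \<in> compact_opens Y" "y \<in> D" "D \<subseteq> O1"
      using stone_base[OF stone(2)] by metis
    then obtain n where "\<forall>b\<in>R n. snd b \<subseteq> D \<or> snd b \<inter> D = {}"
      using split2 by blast
    then have "snd (a n) \<subseteq> D"
      using a(1)[of n] yB[of n] D by blast
    then show False
      using y'B[of n] D O unfolding disjnt_def by blast
  qed
  with ex show ?thesis
    by (rule ex1I)
qed

lemma exists_matching_sequence:
  assumes count: "countable (compact_opens X)" "countable (compact_opens Y)"
    and fwd: "\<And>A B C. E A B \<Longrightarrow> C \<in> compact_opens X \<Longrightarrow> \<exists>D\<subseteq>B. E (A \<inter> C) D \<and> E (A - C) (B - D)"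
    and bwd: "\<And>A B D. E A B \<Longrightarrow> D \<in> compact_opens Y \<Longrightarrow> \<exists>C\<subseteq>A. E C (B \<inter> D) \<and> E (A - C) (B - D)"
    and UV: "E U V"
  shows "\<exists>R :: nat \<Rightarrow> ('v set \<times> 'w set) set. (\<forall>n. matching E U V (R n)) \<and> (\<forall>n. finer (R (Suc n)) (R n)) \<and>
    (\<forall>C\<in>compact_opens X. \<exists>n. \<forall>a\<in>R n. fst a \<subseteq> C \<or> fst a \<inter> C = {}) \<and>
    (\<forall>D\<in>compact_opens Y. \<exists>n. \<forall>a\<in>R n. snd a \<subseteq> D \<or> snd a \<inter> D = {})"
proof -
  define c where "c = from_nat_into (compact_opens X)"
  define d where "d = from_nat_into (compact_opens Y)"
  have ne: "compact_opens X \<noteq> {}" "compact_opens Y \<noteq> {}"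
    using empty_in_compact_opens by blast+
  have cd: "c n \<in> compact_opens X" "d n \<in> compact_opens Y" for n
    using ne by (simp_all add: c_def d_def from_nat_into)
  define Q where "Q = (\<lambda>n R R'. finer R' R \<and> (\<forall>a\<in>R'. fst a \<subseteq> c n \<or> fst a \<inter> c n = {}) \<and>
      (\<forall>a\<in>R'. snd a \<subseteq> d n \<or> snd a \<inter> d n = {}))"
  have "\<exists>R :: nat \<Rightarrow> ('v set \<times> 'w set) set. \<forall>n. matching E U V (R n) \<and> Q n (R n) (R (Suc n))"
  proof (rule dependent_nat_choice)
    have "matching E U V {(U, V)}"
      using UV by (simp add: matching_def)
    then show "\<exists>R. matching E U V R" ..
  next
    fix R n assume R: "matching E U V R"
    obtain R1 where R1: "matching E U V R1" "finer R1 R"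
      and c: "\<And>a. a \<in> R1 \<Longrightarrow> fst a \<subseteq> c n \<or> fst a \<inter> c n = {}"
      using split_matching[OF R, of "c n"] fwd[OF _ cd(1)] by metis
    \<comment> \<open>the second split takes place on the other side, hence on the converse matching\<close>
    obtain R2 where R2: "matching (\<lambda>B A. E A B) V U R2" "finer R2 (R1\<inverse>)"
      and d: "\<And>a. a \<in> R2 \<Longrightarrow> fst a \<subseteq> d n \<or> fst a \<inter> d n = {}"
      using split_matching[OF matching_converse[OF R1(1)], of "d n"] bwd[OF _ cd(2)] by metis
    have "matching E U V (R2\<inverse>)"
      using matching_converse[OF R2(1)] .
    moreover have R21: "finer (R2\<inverse>) R1"
      using finer_converse[OF R2(2)] by simp
    have "Q n R (R2\<inverse>)"
      unfolding Q_def
    proof (intro conjI ballI)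
      show "finer (R2\<inverse>) R"
        using finer_trans[OF R21 R1(2)] .
      fix a assume a: "a \<in> R2\<inverse>"
      then obtain b where "b \<in> R1" "fst a \<subseteq> fst b"
        using R21 unfolding finer_def by blast
      then show "fst a \<subseteq> c n \<or> fst a \<inter> c n = {}"
        using c[of b] by blast
      show "snd a \<subseteq> d n \<or> snd a \<inter> d n = {}"
        using d[of "prod.swap a"] a by (cases a) simp
    qed
    ultimately show "\<exists>R'. matching E U V R' \<and> Q n R R'"
      by blast
  qed
  then obtain R :: "nat \<Rightarrow> ('v set \<times> 'w set) set" where "\<And>n. matching E U V (R n)" "\<And>n. Q n (R n) (R (Suc n))"
    by metis
  moreover have "\<exists>n. c n = C" if "C \<in> compact_opens X" for C
    unfolding c_def using from_nat_into_surj[OF count(1) that] .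
  moreover have "\<exists>n. d n = D" if "D \<in> compact_opens Y" for D
    unfolding d_def using from_nat_into_surj[OF count(2) that] .
  ultimately show ?thesis
    unfolding Q_def by (intro exI[of _ R]) metis
qed

text \<open>Splitting the pieces alternately along all compact open sets of \<open>X\<close> and of \<open>Y\<close> yields matchings
  whose limit is a homeomorphism. A compact open set is a finite union of pieces of one of the matchings, so
  additivity of \<open>E\<close> on compact sets makes it correspond to its image.\<close>

theorem back_and_forth:
  fixes X :: "'v topology" and Y :: "'w topology"
  assumes stone: "stone_space X" "stone_space Y"
    and count: "countable (compact_opens X)" "countable (compact_opens Y)"
    and E: "\<And>A B. E A B \<Longrightarrow> openin X A \<and> closedin X A \<and> openin Y B \<and> closedin Y B \<and>
         (A = {} \<longleftrightarrow> B = {}) \<and> (compactin X A \<longleftrightarrow> compactin Y B)"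
    and fwd: "\<And>A B C. E A B \<Longrightarrow> C \<in> compact_opens X \<Longrightarrow> \<exists>D\<subseteq>B. E (A \<inter> C) D \<and> E (A - C) (B - D)"
    and bwd: "\<And>A B D. E A B \<Longrightarrow> D \<in> compact_opens Y \<Longrightarrow> \<exists>C\<subseteq>A. E C (B \<inter> D) \<and> E (A - C) (B - D)"
    and add: "\<And>A B A' B'. E A B \<Longrightarrow> E A' B' \<Longrightarrow> compactin X A \<Longrightarrow> compactin X A' \<Longrightarrow>
         A \<inter> A' = {} \<Longrightarrow> B \<inter> B' = {} \<Longrightarrow> E (A \<union> A') (B \<union> B')"
    and UV: "E U V"
  shows "\<exists>h. homeomorphic_map (subtopology X U) (subtopology Y V) h \<and>
           (\<forall>C\<in>compact_opens X. C \<subseteq> U \<longrightarrow> E C (h ` C))"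
proof -
  obtain R :: "nat \<Rightarrow> ('v set \<times> 'w set) set" where R: "\<And>n. matching E U V (R n)"
    and dec: "\<And>n. finer (R (Suc n)) (R n)"
    and split1: "\<And>C. C \<in> compact_opens X \<Longrightarrow> \<exists>n. \<forall>a\<in>R n. fst a \<subseteq> C \<or> fst a \<inter> C = {}"
    and split2: "\<And>D. D \<in> compact_opens Y \<Longrightarrow> \<exists>n. \<forall>a\<in>R n. snd a \<subseteq> D \<or> snd a \<inter> D = {}"
    using exists_matching_sequence[where E = E, OF count fwd bwd UV] by metis
  define rel where "rel = (\<lambda>x y. \<forall>n. \<exists>a\<in>R n. x \<in> fst a \<and> y \<in> snd a)"
  have ex1: "\<exists>!y. rel x y" if "x \<in> U" for x
    unfolding rel_def
    by (rule limit_point_unique[where E = E, OF stone _ R dec split1 split2 that]) (use E in blast)+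
  have ex2: "\<exists>!x. rel x y" if "y \<in> V" for y
  proof -
    have conv: "(\<exists>a\<in>(R n)\<inverse>. y \<in> fst a \<and> x \<in> snd a) \<longleftrightarrow> (\<exists>a\<in>R n. x \<in> fst a \<and> y \<in> snd a)" for n x
      by (auto intro: rev_bexI)
    have "\<exists>!x. \<forall>n. \<exists>a\<in>(R n)\<inverse>. y \<in> fst a \<and> x \<in> snd a"
    proof (rule limit_point_unique[where E = "\<lambda>B A. E A B" and R = "\<lambda>n. (R n)\<inverse>", OF stone(2) stone(1) _ _ _ _ _ that])
      show "matching (\<lambda>B A. E A B) V U ((R n)\<inverse>)" "finer ((R (Suc n))\<inverse>) ((R n)\<inverse>)" for n
        using matching_converse[OF R] finer_converse[OF dec] by blast+
      show "\<exists>n. \<forall>a\<in>(R n)\<inverse>. fst a \<subseteq> D \<or> fst a \<inter> D = {}" if "D \<in> compact_opens Y" for D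
        using split2[OF that] by fastforce
      show "\<exists>n. \<forall>a\<in>(R n)\<inverse>. snd a \<subseteq> C \<or> snd a \<inter> C = {}" if "C \<in> compact_opens X" for C
        using split1[OF that] by fastforce
    qed (use E in blast)
    then show ?thesis
      unfolding conv rel_def .
  qed
  define h where "h = (\<lambda>x. THE y. rel x y)"
  have h: "rel x (h x)" if "x \<in> U" for x
    unfolding h_def using theI'[OF ex1[OF that]] .
  have piece: "h x \<in> snd a \<longleftrightarrow> x \<in> fst a" if a: "a \<in> R n" and x: "x \<in> U" for a n x
  proof -
    obtain b where "b \<in> R n" "x \<in> fst b" "h x \<in> snd b"
      using h[OF x] unfolding rel_def by blast
    then show ?thesis
      using matchingD(5,6)[OF R a \<open>b \<in> R n\<close>] by (cases "a = b") auto
  qed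
  have UV_piece: "fst a \<subseteq> U" "snd a \<subseteq> V" if "a \<in> R n" for a n
    using matchingD(3,4)[OF R[of n]] that by blast+
  have hV: "h x \<in> V" if "x \<in> U" for x
    using h[OF that] UV_piece(2)[of _ 0] unfolding rel_def by blast
  have surj: "\<exists>x\<in>U. h x = y" if y: "y \<in> V" for y
  proof -
    obtain x where x: "rel x y"
      using ex2[OF y] by blast
    then have "x \<in> U"
      using UV_piece(1)[of _ 0] unfolding rel_def by blast
    then show ?thesis
      using x h ex1 by blast
  qed
  have inj: "inj_on h U"
    by (rule inj_onI) (metis h hV ex2)
  have UVtop: "openin X U" "openin Y V" "U \<subseteq> topspace X" "V \<subseteq> topspace Y"
    using E[OF UV] openin_subset by blast+
  have pieceE: "openin X (fst a)" "closedin X (fst a)" "openin Y (snd a)" if "a \<in> R n" for a n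
    using E[OF matchingD(2)[OF R that]] by blast+
  \<comment> \<open>splitting along the empty set\<close>
  have E0: "E {} {}"
    using fwd[OF UV empty_in_compact_opens] E by (metis Int_empty_right)
  have img: "E C (h ` C)" if C: "C \<in> compact_opens X" "C \<subseteq> U" for C
  proof -
    obtain n where n: "\<And>a. a \<in> R n \<Longrightarrow> fst a \<subseteq> C \<or> fst a \<inter> C = {}"
      using split1[OF C(1)] by blast
    define F where "F = {a \<in> R n. fst a \<subseteq> C}"
    have fin: "finite F"
      using matchingD(1)[OF R[of n]] by (simp add: F_def)
    have comp: "compactin X (fst a)" if "a \<in> F" for a
      using that C(1) pieceE(2)[of a n] closed_compactin by (auto simp: F_def compact_opens_def)
    have *: "compactin X (\<Union>(fst ` G)) \<and> E (\<Union>(fst ` G)) (\<Union>(snd ` G))" if "finite G" "G \<subseteq> F" for G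
      using that
    proof (induction rule: finite_induct)
      case (insert a G)
      have "fst a \<inter> \<Union>(fst ` G) = {}" "snd a \<inter> \<Union>(snd ` G) = {}"
        using insert.prems insert.hyps matchingD(5,6)[OF R[of n], of a] unfolding F_def by fast+
      moreover have "compactin X (fst a)" "E (fst a) (snd a)"
        using comp[of a] matchingD(2)[OF R[of n], of a] insert.prems by (simp_all add: F_def)
      ultimately show ?case
        using add[of "fst a" "snd a" "\<Union>(fst ` G)" "\<Union>(snd ` G)"] insert
        by (simp add: compactin_Un)
    qed (simp add: E0)
    have CU: "C = \<Union>(fst ` F)"
    proof
      show "C \<subseteq> \<Union>(fst ` F)"
      proof
        fix x assume "x \<in> C"
        then obtain a where a: "a \<in> R n" "x \<in> fst a"
          using matchingD(3)[OF R[of n]] C(2) by blast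
        then have "a \<in> F"
          using n[of a] \<open>x \<in> C\<close> unfolding F_def by blast
        then show "x \<in> \<Union>(fst ` F)" using a by blast
      qed
    qed (auto simp: F_def)
    have "h ` C = \<Union>(snd ` F)"
    proof
      show "h ` C \<subseteq> \<Union>(snd ` F)"
      proof
        fix y assume "y \<in> h ` C"
        then obtain x where x: "x \<in> C" "y = h x" by blast
        then obtain a where a: "a \<in> F" "x \<in> fst a"
          using CU by blast
        then have "h x \<in> snd a"
          using piece[of a n x] x C(2) unfolding F_def by blast
        then show "y \<in> \<Union>(snd ` F)" using a x by blast
      qed
      show "\<Union>(snd ` F) \<subseteq> h ` C"
      proof
        fix y assume "y \<in> \<Union>(snd ` F)"
        then obtain a where a: "a \<in> F" "y \<in> snd a" by blast
        then have aR: "a \<in> R n" by (simp add: F_def)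
        obtain x where "x \<in> U" "h x = y"
          using surj UV_piece(2)[OF aR] a by blast
        then have "x \<in> fst a"
          using piece[OF aR] a by blast
        then show "y \<in> h ` C"
          using a \<open>h x = y\<close> unfolding F_def by blast
      qed
    qed
    then show ?thesis
      using *[OF fin order_refl] CU by simp
  qed
  have top: "topspace (subtopology X U) = U" "topspace (subtopology Y V) = V"
    using UVtop by auto
  have "homeomorphic_map (subtopology X U) (subtopology Y V) h"
  proof (rule bijective_open_imp_homeomorphic_map)
    show "continuous_map (subtopology X U) (subtopology Y V) h"
      unfolding continuous_map_def top
    proof (intro conjI allI impI)
      show "h \<in> U \<rightarrow> V" using hV by blast
      fix O' assume "openin (subtopology Y V) O'"
      then have O': "openin Y O'" "O' \<subseteq> V"
        using UVtop openin_open_subtopology by blast+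
      have "openin X {x \<in> U. h x \<in> O'}"
        unfolding openin_subopen[of X "{x \<in> U. h x \<in> O'}"]
      proof
        fix x assume x: "x \<in> {x \<in> U. h x \<in> O'}"
        then obtain D where D: "D \<in> compact_opens Y" "h x \<in> D" "D \<subseteq> O'"
          using stone_base[OF stone(2) O'(1)] by blast
        then obtain n where n: "\<And>a. a \<in> R n \<Longrightarrow> snd a \<subseteq> D \<or> snd a \<inter> D = {}"
          using split2 by blast
        obtain a where a: "a \<in> R n" "x \<in> fst a"
          using matchingD(3)[OF R[of n]] x by blast
        then have "h x \<in> snd a"
          using piece[of a n x] x by blast
        then have "snd a \<subseteq> O'"
          using n[OF a(1)] D by blast
        then have "fst a \<subseteq> {x \<in> U. h x \<in> O'}"
          using piece[OF a(1)] UV_piece(1)[OF a(1)] by blast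
        then show "\<exists>T. openin X T \<and> x \<in> T \<and> T \<subseteq> {x \<in> U. h x \<in> O'}"
          using a pieceE(1)[OF a(1)] by blast
      qed
      then show "openin (subtopology X U) {x \<in> U. h x \<in> O'}"
        using UVtop by (auto simp: openin_open_subtopology)
    qed
    show "open_map (subtopology X U) (subtopology Y V) h"
      unfolding open_map_def
    proof (intro allI impI)
      fix O' assume "openin (subtopology X U) O'"
      then have O': "openin X O'" "O' \<subseteq> U"
        using UVtop openin_open_subtopology by blast+
      have "openin Y (h ` O')"
        unfolding openin_subopen[of Y "h ` O'"]
      proof
        fix y assume "y \<in> h ` O'"
        then obtain x where x: "x \<in> O'" "y = h x" by blast
        then obtain C where C: "C \<in> compact_opens X" "x \<in> C" "C \<subseteq> O'"
          using stone_base[OF stone(1) O'(1)] by blast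
        then have "openin Y (h ` C)"
          using E[OF img[of C]] O' by blast
        then show "\<exists>T. openin Y T \<and> y \<in> T \<and> T \<subseteq> h ` O'"
          using C x by blast
      qed
      then show "openin (subtopology Y V) (h ` O')"
        using UVtop O' hV by (auto simp: openin_open_subtopology)
    qed
    show "h ` topspace (subtopology X U) = topspace (subtopology Y V)"
      unfolding top using hV surj by blast
    show "inj_on h (topspace (subtopology X U))"
      unfolding top by (rule inj)
  qed
  then show ?thesis
    using img by blast
qed

section \<open>Trim sets and spines\<close>

definition index_of :: "'i set \<Rightarrow> ('i \<Rightarrow> 'w set) \<Rightarrow> 'w \<Rightarrow> 'i" where
  "index_of P X x = (THE p. p \<in> P \<and> x \<in> X p)"

text \<open>The points from which a compact open set can be rebuilt. A point outside the spine that has the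
  same index \<open>q\<close> as a spine point is allowed only if \<open>(q, q) \<in> r\<close> or a spine point of smaller index
  exists; so a trim set of index \<open>p\<close> has a spine with a single point.\<close>

definition spine :: "'i set \<Rightarrow> 'i rel \<Rightarrow> ('i \<Rightarrow> 'w set) \<Rightarrow> 'w set \<Rightarrow> 'w set \<Rightarrow> bool" where
  "spine P r X A E \<longleftrightarrow> finite E \<and> E \<subseteq> A \<inter> (\<Union>p\<in>P. X p) \<and>
     (\<forall>q\<in>P. \<forall>z\<in>A \<inter> X q - E. \<exists>x\<in>E. (index_of P X x, q) \<in> r)"

lemma po_up_singleton: "po_up P r {p} = {q \<in> P. p = q \<or> (p, q) \<in> r}"
  by (auto simp: po_up_def po_le_def)

lemma trim_at_iff:
  "A \<in> trim_at W P r X p \<longleftrightarrow> A \<in> compact_opens W \<and>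
     (\<forall>q\<in>P. A \<inter> X q \<noteq> {} \<longleftrightarrow> p = q \<or> (p, q) \<in> r) \<and> (p \<in> P \<longrightarrow> (p, p) \<notin> r \<longrightarrow> card (A \<inter> X p) = 1)"
  unfolding trim_at_def type_set_def po_up_singleton po_d_def by blast

lemma trim_atD:
  assumes "A \<in> trim_at W P r X p"
  shows "A \<in> compact_opens W" "\<And>q. q \<in> P \<Longrightarrow> A \<inter> X q \<noteq> {} \<longleftrightarrow> p = q \<or> (p, q) \<in> r"
    and "p \<in> P \<Longrightarrow> (p, p) \<notin> r \<Longrightarrow> card (A \<inter> X p) = 1"
  using assms by (simp_all add: trim_at_iff)

lemma trim_set_openin: "trim_set W P r X A \<Longrightarrow> openin W A"
  unfolding trim_set_def using trim_atD(1) by (metis compact_opens_iff)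

lemma trim_at_openin: "A \<in> trim_at W P r X p \<Longrightarrow> openin W A"
  by (simp add: trim_at_iff compact_opens_iff)

locale trim_partition_space =
  fixes W :: "'w topology" and P :: "'i set" and r :: "'i rel" and X :: "'i \<Rightarrow> 'w set"
  assumes stone: "stone_space W" and trim: "trim_partition W P r X"
begin

abbreviation "ty \<equiv> index_of P X"

lemma Hausdorff: "Hausdorff_space W"
  using stone stone_Hausdorff by blast

lemma partition: "po_partition W P r X"
  using trim by (simp add: trim_partition_def)

lemma po: "r \<subseteq> P \<times> P" "antisym r" "trans r"
  using partition by (simp_all add: po_partition_def po_system_def)

lemma r_trans: "(p, q) \<in> r \<Longrightarrow> (q, t) \<in> r \<Longrightarrow> (p, t) \<in> r"
  using po(3) by (rule transD)

lemma X_nonempty: "p \<in> P \<Longrightarrow> X p \<noteq> {}" and X_subset: "p \<in> P \<Longrightarrow> X p \<subseteq> topspace W"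
  using partition by (auto simp: po_partition_def)

lemma X_disjoint: "p \<in> P \<Longrightarrow> q \<in> P \<Longrightarrow> x \<in> X p \<Longrightarrow> x \<in> X q \<Longrightarrow> p = q"
  using partition unfolding po_partition_def disjoint_family_on_def by blast

lemma ty_eq: "p \<in> P \<Longrightarrow> x \<in> X p \<Longrightarrow> ty x = p"
  unfolding index_of_def using X_disjoint by blast

lemma ty_in: "x \<in> (\<Union>p\<in>P. X p) \<Longrightarrow> ty x \<in> P" and in_X_ty: "x \<in> (\<Union>p\<in>P. X p) \<Longrightarrow> x \<in> X (ty x)"
  using ty_eq by force+

lemma derived:
  assumes "p \<in> P" "q \<in> P" "x \<in> X q"
  shows "x \<in> W derived_set_of X p \<longleftrightarrow> (q, p) \<in> r"
proof -
  have "(W derived_set_of X p) \<inter> (\<Union>q\<in>P. X q) = (\<Union>q\<in>{q \<in> P. (q, p) \<in> r}. X q)"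
    using partition assms(1) by (simp add: po_partition_def)
  then have "x \<in> W derived_set_of X p \<longleftrightarrow> x \<in> (\<Union>q\<in>{q \<in> P. (q, p) \<in> r}. X q)"
    using assms by blast
  also have "\<dots> \<longleftrightarrow> (q, p) \<in> r"
    using X_disjoint assms by blast
  finally show ?thesis .
qed

lemma infinite_above:
  assumes "p \<in> P" "q \<in> P" "x \<in> X q" "(q, p) \<in> r" "openin W U" "x \<in> U"
  shows "infinite (U \<inter> X p)"
  using derived[OF assms(1-3)] assms derived_set_of_infinite_openin[OF Hausdorff, of "X p"]
  by (simp add: Int_commute)

lemma meets_above:
  assumes "p \<in> P" "q \<in> P" "openin W U" "U \<inter> X q \<noteq> {}" "(q, p) \<in> r"
  shows "U \<inter> X p \<noteq> {}"
  using assms infinite_above by (metis disjoint_iff finite.emptyI)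

lemma trim_base:
  assumes "x \<in> topspace W" "openin W U" "x \<in> U"
  shows "\<exists>p\<in>P. \<exists>A\<in>trim_at W P r X p. x \<in> A \<and> A \<subseteq> U"
proof -
  have "neighbourhood_base_at x (trim_set W P r X) W"
    using trim assms(1) by (simp add: trim_partition_def)
  then have "\<exists>A. trim_set W P r X A \<and> x \<in> A \<and> A \<subseteq> U"
    using assms(2,3) by (simp add: neighbourhood_base_at_open[of "trim_set W P r X", OF trim_set_openin])
  then show ?thesis
    unfolding trim_set_def by blast
qed

text \<open>A small trim neighbourhood of a point of \<open>X p\<close> has an index \<open>\<le> p\<close> because it meets \<open>X p\<close>, and an index
  \<open>\<ge> p\<close> because it lies in a \<open>p\<close>-trim set.\<close>

lemma trim_nbhd:
  assumes "p \<in> P" "x \<in> X p" "openin W U" "x \<in> U"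
  shows "\<exists>A\<in>trim_at W P r X p. x \<in> A \<and> A \<subseteq> U"
proof -
  obtain B where B: "B \<in> trim_at W P r X p" "x \<in> B"
    using trim assms unfolding trim_partition_def by blast
  have "openin W B"
    using trim_atD(1)[OF B(1)] by (simp add: compact_opens_def)
  then obtain q A where q: "q \<in> P" "A \<in> trim_at W P r X q" "x \<in> A" "A \<subseteq> U \<inter> B"
    using trim_base[of x "U \<inter> B"] assms B X_subset by blast
  have "q = p \<or> (q, p) \<in> r"
    using trim_atD(2)[OF q(2) assms(1)] q(3) assms(2) by blast
  moreover have "p = q \<or> (p, q) \<in> r"
    using trim_atD(2)[OF q(2) q(1)] trim_atD(2)[OF B(1) q(1)] q(4) by blast
  ultimately have "q = p"
    using po(2) by (auto dest: antisymD)
  then show ?thesis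
    using q by blast
qed

lemma trim_point: "p \<in> P \<Longrightarrow> A \<in> trim_at W P r X p \<Longrightarrow> \<exists>x\<in>A. x \<in> X p"
  using trim_atD(2)[of A W P r X p p] by blast

lemma trim_cover:
  assumes "A \<in> compact_opens W"
  shows "\<exists>\<D>. finite \<D> \<and> (\<forall>D\<in>\<D>. trim_set W P r X D) \<and> \<Union>\<D> = A"
proof -
  define \<U> where "\<U> = {D. trim_set W P r X D \<and> D \<subseteq> A}"
  have "\<forall>U\<in>\<U>. openin W U"
    unfolding \<U>_def using trim_set_openin by blast
  moreover have "A \<subseteq> \<Union>\<U>"
  proof
    fix x assume "x \<in> A"
    then obtain p D where "p \<in> P" "D \<in> trim_at W P r X p" "x \<in> D" "D \<subseteq> A"
      using trim_base[of x A] assms compact_opens_subset_topspace[OF assms]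
      by (auto simp: compact_opens_iff)
    then show "x \<in> \<Union>\<U>"
      unfolding \<U>_def trim_set_def by blast
  qed
  ultimately obtain \<D> where "finite \<D>" "\<D> \<subseteq> \<U>" "A \<subseteq> \<Union>\<D>"
    using compactin_finite_subcover[of W A \<U>] assms by (auto simp: compact_opens_iff)
  then show ?thesis
    unfolding \<U>_def by (intro exI[of _ \<D>]) auto
qed

text \<open>Cover the set by trim sets and take a point of the part of least index from each.\<close>

lemma spine_exists:
  assumes "A \<in> compact_opens W"
  shows "\<exists>E. spine P r X A E"
proof -
  obtain \<D> where \<D>: "finite \<D>" "\<And>D. D \<in> \<D> \<Longrightarrow> trim_set W P r X D" "\<Union>\<D> = A"
    using trim_cover[OF assms] by blast
  have "\<forall>D\<in>\<D>. \<exists>p. p \<in> P \<and> D \<in> trim_at W P r X p"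
    using \<D>(2) unfolding trim_set_def by blast
  then obtain p where p: "\<And>D. D \<in> \<D> \<Longrightarrow> p D \<in> P \<and> D \<in> trim_at W P r X (p D)"
    by metis
  then have "\<forall>D\<in>\<D>. \<exists>x. x \<in> D \<and> x \<in> X (p D)"
    using trim_point by blast
  then obtain x where x: "\<And>D. D \<in> \<D> \<Longrightarrow> x D \<in> D \<and> x D \<in> X (p D)"
    by metis
  have "spine P r X A (x ` \<D>)"
    unfolding spine_def
  proof (intro conjI ballI)
    show "x ` \<D> \<subseteq> A \<inter> (\<Union>p\<in>P. X p)"
      using x p \<D>(3) by blast
    fix q z assume q: "q \<in> P" and z: "z \<in> A \<inter> X q - x ` \<D>"
    then obtain D where D: "D \<in> \<D>" "z \<in> D"
      using \<D>(3) by blast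
    have t: "ty (x D) = p D"
      using ty_eq x[OF D(1)] p[OF D(1)] by blast
    have "p D = q \<or> (p D, q) \<in> r"
      using trim_atD(2)[of D W P r X "p D" q] p[OF D(1)] q z D by blast
    moreover have "(p D, q) \<in> r" if "p D = q"
    proof (rule ccontr)
      assume "(p D, q) \<notin> r"
      then have "card (D \<inter> X q) = 1"
        using trim_atD(3)[of D W P r X "p D"] p[OF D(1)] \<open>p D = q\<close> by auto
      then obtain a where a: "D \<inter> X q = {a}"
        by (meson card_1_singletonE)
      have "z \<in> D \<inter> X q" "x D \<in> D \<inter> X q"
        using z D x[OF D(1)] \<open>p D = q\<close> by auto
      then show False
        using a z D(1) by auto
    qed
    ultimately have "(ty (x D), q) \<in> r"
      using t by auto
    then show "\<exists>x\<in>x ` \<D>. (ty x, q) \<in> r"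
      using D(1) by blast
  qed (use \<D> in auto)
  then show ?thesis by blast
qed

text \<open>Only points of strictly larger index (in the sense of \<open>r\<close>) are added, so neither the type nor, for
  \<open>(p, p) \<notin> r\<close>, the unique point of \<open>X p\<close> changes.\<close>

lemma trim_absorb:
  assumes A: "p \<in> P" "A \<in> trim_at W P r X p" and K: "K \<in> compact_opens W"
    and above: "\<And>q. q \<in> P \<Longrightarrow> K \<inter> X q \<noteq> {} \<Longrightarrow> (p, q) \<in> r"
  shows "A \<union> K \<in> trim_at W P r X p"
  unfolding trim_at_iff
proof (intro conjI ballI impI)
  show "A \<union> K \<in> compact_opens W"
    using trim_atD(1)[OF A(2)] K by (rule compact_opens_Un)
  show "(A \<union> K) \<inter> X q \<noteq> {} \<longleftrightarrow> p = q \<or> (p, q) \<in> r" if "q \<in> P" for q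
    using trim_atD(2)[OF A(2) that] above[OF that] by blast
  assume pp: "(p, p) \<notin> r"
  then have "K \<inter> X p = {}"
    using above[OF A(1)] by blast
  then have "(A \<union> K) \<inter> X p = A \<inter> X p"
    by blast
  then show "card ((A \<union> K) \<inter> X p) = 1"
    using trim_atD(3)[OF A(2) A(1) pp] by simp
qed

lemma finite_closedin: "finite E \<Longrightarrow> E \<subseteq> topspace W \<Longrightarrow> closedin W E"
  using Hausdorff closedin_Hausdorff_finite by blast

text \<open>The neighbourhoods are chosen one after the other; for this each of them has to avoid the other points of \<open>E\<close>
  from the start, which is why the induction is over subsets of \<open>E\<close>.\<close>

lemma disjoint_trim_nbhds:
  assumes "finite E" and E: "E \<subseteq> B \<inter> (\<Union>p\<in>P. X p)" and B: "openin W B"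
  shows "\<exists>N. disjoint_family_on N E \<and> (\<forall>x\<in>E. x \<in> N x \<and> N x \<subseteq> B \<and> N x \<in> trim_at W P r X (ty x))"
proof -
  have "\<exists>N. disjoint_family_on N F \<and>
      (\<forall>x\<in>F. N x \<inter> E = {x} \<and> N x \<subseteq> B \<and> N x \<in> trim_at W P r X (ty x))" if "finite F" "F \<subseteq> E" for F
    using that
  proof (induction rule: finite_induct)
    case (insert x F)
    then obtain N where N: "disjoint_family_on N F"
      "\<And>y. y \<in> F \<Longrightarrow> N y \<inter> E = {y} \<and> N y \<subseteq> B \<and> N y \<in> trim_at W P r X (ty y)"
      by auto
    have "\<Union>(N ` F) \<in> compact_opens W"
      using N(2) insert.hyps by (intro compact_opens_UN) (simp_all add: trim_at_iff)
    then have "closedin W (\<Union>(N ` F))"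
      using compact_opens_closedin Hausdorff by blast
    \<comment> \<open>the new neighbourhood must avoid the points still to come\<close>
    moreover have "closedin W (E - {x})"
      using assms(1) E B openin_subset by (intro finite_closedin) blast+
    ultimately have "openin W (B - \<Union>(N ` F) - (E - {x}))"
      using B by (intro openin_diff)
    moreover have x: "x \<in> B - \<Union>(N ` F) - (E - {x})"
    proof -
      have "x \<notin> N y" if y: "y \<in> F" for y
      proof
        assume "x \<in> N y"
        then have "x \<in> {y}"
          using N(2)[OF y] insert.prems by blast
        then show False using y insert.hyps(2) by blast
      qed
      then show ?thesis
        using insert.prems E by auto
    qed
    moreover have "ty x \<in> P" "x \<in> X (ty x)"
      using insert.prems E ty_in in_X_ty by blast+
    ultimately obtain A where A: "A \<in> trim_at W P r X (ty x)" "x \<in> A" "A \<subseteq> B - \<Union>(N ` F) - (E - {x})"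
      using trim_nbhd by meson
    have disj: "disjoint_family_on (N(x := A)) (insert x F)"
      using N(1) A(3) insert.hyps unfolding disjoint_family_on_def by auto
    have "A \<inter> E = {x}"
      using A insert.prems by blast
    then have "\<forall>y\<in>insert x F. (N(x := A)) y \<inter> E = {y} \<and> (N(x := A)) y \<subseteq> B \<and>
        (N(x := A)) y \<in> trim_at W P r X (ty y)"
      using A N(2) insert.hyps by auto
    with disj show ?case
      by blast
  qed (simp add: disjoint_family_on_def)
  from this[OF assms(1) order_refl] obtain N where "disjoint_family_on N E"
    "\<forall>x\<in>E. N x \<inter> E = {x} \<and> N x \<subseteq> B \<and> N x \<in> trim_at W P r X (ty x)"
    by auto
  then show ?thesis
    by (intro exI[of _ N]) auto
qed

text \<open>After disjoint trim neighbourhoods of the spine have been removed, the rest is covered by finitely many trim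
  sets. The index of each of them is above the index of a spine point, whose neighbourhood can absorb it.\<close>

lemma spine_decomposition:
  assumes E: "spine P r X B E" and B: "B \<in> compact_opens W"
  shows "\<exists>N. disjoint_family_on N E \<and> (\<Union>x\<in>E. N x) = B \<and>
           (\<forall>x\<in>E. x \<in> N x \<and> N x \<in> trim_at W P r X (ty x))"
proof -
  have E': "finite E" "E \<subseteq> B \<inter> (\<Union>p\<in>P. X p)"
    and above: "\<And>q z. q \<in> P \<Longrightarrow> z \<in> B \<inter> X q - E \<Longrightarrow> \<exists>x\<in>E. (ty x, q) \<in> r"
    using E unfolding spine_def by auto
  have tyP: "ty x \<in> P" if "x \<in> E" for x
    using E'(2) ty_in that by blast
  obtain N where N: "disjoint_family_on N E"
    "\<And>x. x \<in> E \<Longrightarrow> x \<in> N x \<and> N x \<subseteq> B \<and> N x \<in> trim_at W P r X (ty x)"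
    using disjoint_trim_nbhds[OF E'] B by (auto simp: compact_opens_iff)
  define D where "D = B - (\<Union>x\<in>E. N x)"
  have NC: "(\<Union>x\<in>E. N x) \<in> compact_opens W"
    using N(2) E'(1) by (intro compact_opens_UN) (simp_all add: trim_at_iff)
  then have "D \<in> compact_opens W"
    unfolding D_def using B Hausdorff by (intro compact_opens_Diff)
  then obtain \<D> where \<D>: "finite \<D>" "\<And>K. K \<in> \<D> \<Longrightarrow> trim_set W P r X K" "\<Union>\<D> = D"
    using trim_cover by blast
  have "\<exists>M. disjoint_family_on M E \<and> (\<Union>x\<in>E. M x) = (\<Union>x\<in>E. N x) \<union> \<Union>\<F> \<and>
      (\<forall>x\<in>E. x \<in> M x \<and> M x \<in> trim_at W P r X (ty x))" if "finite \<F>" "\<F> \<subseteq> \<D>" for \<F>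
    using that
  proof (induction rule: finite_induct)
    case empty
    then show ?case using N by auto
  next
    case (insert K \<F>)
    then obtain M where M: "disjoint_family_on M E" "(\<Union>x\<in>E. M x) = (\<Union>x\<in>E. N x) \<union> \<Union>\<F>"
      "\<And>x. x \<in> E \<Longrightarrow> x \<in> M x \<and> M x \<in> trim_at W P r X (ty x)"
      by auto
    obtain p where p: "p \<in> P" "K \<in> trim_at W P r X p"
      using \<D>(2) insert.prems unfolding trim_set_def by blast
    obtain z where z: "z \<in> K" "z \<in> X p"
      using trim_point[OF p] by blast
    have "z \<in> B \<inter> X p - E"
      using z \<D>(3) insert.prems N(2) unfolding D_def by blast
    then obtain x where x: "x \<in> E" "(ty x, p) \<in> r"
      using above[OF p(1)] by blast
    \<comment> \<open>the part of \<open>K\<close> not yet covered goes to the neighbourhood of \<open>x\<close>\<close>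
    define K' where "K' = K - (\<Union>x\<in>E. M x)"
    have "(\<Union>x\<in>E. M x) \<in> compact_opens W"
      using M(3) E'(1) by (intro compact_opens_UN) (simp_all add: trim_at_iff)
    then have K': "K' \<in> compact_opens W"
      unfolding K'_def using trim_atD(1)[OF p(2)] Hausdorff by (intro compact_opens_Diff)
    have "M x \<union> K' \<in> trim_at W P r X (ty x)"
    proof (rule trim_absorb[OF tyP[OF x(1)] _ K'])
      show "(ty x, q) \<in> r" if "q \<in> P" "K' \<inter> X q \<noteq> {}" for q
        using trim_atD(2)[OF p(2) that(1)] that(2) x(2) r_trans unfolding K'_def by blast
    qed (use M(3) x in blast)
    then have all: "\<forall>y\<in>E. y \<in> (M(x := M x \<union> K')) y \<and> (M(x := M x \<union> K')) y \<in> trim_at W P r X (ty y)"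
      using M(3) by auto
    have disj: "disjoint_family_on (M(x := M x \<union> K')) E"
      using M(1) x(1) unfolding disjoint_family_on_def K'_def by auto
    have "(\<Union>y\<in>E. (M(x := M x \<union> K')) y) = (\<Union>y\<in>E. M y) \<union> K'"
      using x(1) by (auto split: if_splits)
    also have "\<dots> = (\<Union>y\<in>E. N y) \<union> \<Union>(insert K \<F>)"
      unfolding K'_def using M(2) by auto
    finally show ?case
      using all disj by blast
  qed
  from this[OF \<D>(1) order_refl] obtain M where M: "disjoint_family_on M E"
    "(\<Union>x\<in>E. M x) = (\<Union>x\<in>E. N x) \<union> \<Union>\<D>" "\<forall>x\<in>E. x \<in> M x \<and> M x \<in> trim_at W P r X (ty x)"
    by auto
  moreover have "(\<Union>x\<in>E. N x) \<union> \<Union>\<D> = B"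
    using N(2) \<D>(3) unfolding D_def by blast
  ultimately show ?thesis by auto
qed

end

section \<open>Profiles of open sets\<close>

lemma disjoint_UN_parts:
  assumes "disjoint_family_on N E" "A \<subseteq> E" "B \<subseteq> E" "A \<inter> B = {}"
  shows "(\<Union>x\<in>A. N x) \<inter> (\<Union>x\<in>B. N x) = {}"
proof -
  have "N x \<inter> N y = {}" if "x \<in> A" "y \<in> B" for x y
    using disjoint_family_onD[OF assms(1), of x y] assms(2-4) that by blast
  then show ?thesis by blast
qed

lemma disjoint_UN_insert:
  assumes "disjoint_family_on K (insert x F)" "x \<notin> F"
  shows "K x \<inter> (\<Union>y\<in>F. K y) = {}"
proof -
  have "K x \<inter> K y = {}" if "y \<in> F" for y
    using disjoint_family_onD[OF assms(1), of x y] that assms(2) by auto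
  then show ?thesis by blast
qed

text \<open>The invariant of the back-and-forth argument: the types agree, and so do the numbers of points
  of those indices of \<open>S\<close> that have nothing below them in the type (not even themselves). Comparing these point
  sets by equipollence makes the invariant additive without any finiteness hypothesis. For compact sets
  \<open>S\<close> is the set of all indices, for complements of compact sets it is \<open>L\<close>.\<close>

definition same_profile ::
  "'i set \<Rightarrow> 'i rel \<Rightarrow> ('i \<Rightarrow> 'v set) \<Rightarrow> 'v set \<Rightarrow> ('i \<Rightarrow> 'w set) \<Rightarrow> 'w set \<Rightarrow> bool" where
  "same_profile S r Y A Z B \<longleftrightarrow> (\<forall>p\<in>S. A \<inter> Y p = {} \<longleftrightarrow> B \<inter> Z p = {}) \<and>
     (\<forall>p\<in>S. (\<forall>q\<in>S. (q, p) \<in> r \<longrightarrow> A \<inter> Y q = {}) \<longrightarrow> A \<inter> Y p \<approx> B \<inter> Z p)"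

lemma same_profile_sym:
  "same_profile S r Y A Z B \<Longrightarrow> same_profile S r Z B Y A"
  unfolding same_profile_def by (simp add: eqpoll_sym)

lemma same_profileD:
  assumes "same_profile S r Y A Z B" "p \<in> S"
  shows "A \<inter> Y p = {} \<longleftrightarrow> B \<inter> Z p = {}"
    and "(\<And>q. q \<in> S \<Longrightarrow> (q, p) \<in> r \<Longrightarrow> A \<inter> Y q = {}) \<Longrightarrow> A \<inter> Y p \<approx> B \<inter> Z p"
  using assms unfolding same_profile_def by simp_all

lemma same_profile_empty: "same_profile S r Y {} Z {}"
  by (simp add: same_profile_def)

lemma same_profile_disjoint:
  assumes "\<And>p. p \<in> S \<Longrightarrow> A \<inter> Y p = {}" "\<And>p. p \<in> S \<Longrightarrow> B \<inter> Z p = {}"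
  shows "same_profile S r Y A Z B"
  using assms by (simp add: same_profile_def)

lemma same_profile_Un:
  assumes "same_profile S r Y A Z B" "same_profile S r Y A' Z B'" "A \<inter> A' = {}" "B \<inter> B' = {}"
  shows "same_profile S r Y (A \<union> A') Z (B \<union> B')"
  unfolding same_profile_def
proof (intro conjI ballI impI)
  fix p assume p: "p \<in> S"
  show "(A \<union> A') \<inter> Y p = {} \<longleftrightarrow> (B \<union> B') \<inter> Z p = {}"
    using same_profileD(1)[OF assms(1) p] same_profileD(1)[OF assms(2) p] by (simp add: Int_Un_distrib2)
  assume min: "\<forall>q\<in>S. (q, p) \<in> r \<longrightarrow> (A \<union> A') \<inter> Y q = {}"
  have "A \<inter> Y p \<approx> B \<inter> Z p" "A' \<inter> Y p \<approx> B' \<inter> Z p"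
    using min by (auto intro!: same_profileD(2)[OF assms(1) p] same_profileD(2)[OF assms(2) p])
  then show "(A \<union> A') \<inter> Y p \<approx> (B \<union> B') \<inter> Z p"
    unfolding Int_Un_distrib2 using assms(3,4) by (intro Un_eqpoll_cong) (auto simp: disjnt_def)
qed

lemma same_profile_UN:
  assumes "finite F" "disjoint_family_on N F" "disjoint_family_on M F"
    and "\<And>x. x \<in> F \<Longrightarrow> same_profile S r Y (N x) Z (M x)"
  shows "same_profile S r Y (\<Union>x\<in>F. N x) Z (\<Union>x\<in>F. M x)"
  using assms
proof (induction rule: finite_induct)
  case (insert x F)
  have "N x \<inter> (\<Union>x\<in>F. N x) = {}" "M x \<inter> (\<Union>x\<in>F. M x) = {}"
    using disjoint_UN_insert[OF insert.prems(1) insert.hyps(2)] disjoint_UN_insert[OF insert.prems(2) insert.hyps(2)] by blast+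
  moreover have "same_profile S r Y (\<Union>x\<in>F. N x) Z (\<Union>x\<in>F. M x)"
    using insert by (simp add: disjoint_family_on_mono[OF subset_insertI])
  ultimately show ?case
    using same_profile_Un[of S r Y "N x" Z "M x"] insert.prems by simp
qed (simp add: same_profile_empty)

lemma same_profile_lower:
  assumes "same_profile P r Y A Z B" "L \<subseteq> P" "\<And>p q. (q, p) \<in> r \<Longrightarrow> p \<in> L \<Longrightarrow> q \<in> L"
  shows "same_profile L r Y A Z B"
  unfolding same_profile_def
proof (intro conjI ballI impI)
  fix p assume p: "p \<in> L"
  then have p': "p \<in> P" using assms(2) by blast
  show "A \<inter> Y p = {} \<longleftrightarrow> B \<inter> Z p = {}"
    using same_profileD(1)[OF assms(1) p'] .
  assume "\<forall>q\<in>L. (q, p) \<in> r \<longrightarrow> A \<inter> Y q = {}"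
  then show "A \<inter> Y p \<approx> B \<inter> Z p"
    using same_profileD(2)[OF assms(1) p'] assms(3) p by blast
qed

lemma eqpoll_card_1:
  assumes "card A = 1" "card B = 1"
  shows "A \<approx> B"
  using assms by (intro iffD2[OF eqpoll_iff_card]) (auto intro: card_ge_0_finite)

lemma same_profile_trim:
  assumes "p \<in> P" "A \<in> trim_at W P r Y p" "B \<in> trim_at V P r Z p"
  shows "same_profile P r Y A Z B"
  unfolding same_profile_def
proof (intro conjI ballI impI)
  fix q assume q: "q \<in> P"
  show "A \<inter> Y q = {} \<longleftrightarrow> B \<inter> Z q = {}"
    using trim_atD(2)[OF assms(2) q] trim_atD(2)[OF assms(3) q] by blast
  assume min: "\<forall>t\<in>P. (t, q) \<in> r \<longrightarrow> A \<inter> Y t = {}"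
  have p: "A \<inter> Y p \<noteq> {}"
    using trim_atD(2)[OF assms(2,1)] by blast
  show "A \<inter> Y q \<approx> B \<inter> Z q"
  proof (cases "p = q")
    case True
    then have "(p, p) \<notin> r"
      using min p assms(1) by blast
    then show ?thesis
      using trim_atD(3)[OF assms(2,1)] trim_atD(3)[OF assms(3,1)] eqpoll_card_1 True by blast
  next
    case False
    then have "A \<inter> Y q = {}"
      using min p trim_atD(2)[OF assms(2) q] assms(1) by blast
    moreover have "B \<inter> Z q = {}"
      using calculation trim_atD(2)[OF assms(2) q] trim_atD(2)[OF assms(3) q] by blast
    ultimately show ?thesis by simp
  qed
qed

lemma trim_at_same_profile:
  assumes "same_profile P r Y A Z B" "A \<in> trim_at W P r Y p" "B \<in> compact_opens V"
    and "p \<in> P" "antisym r"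
  shows "B \<in> trim_at V P r Z p"
  unfolding trim_at_iff
proof (intro conjI ballI impI)
  show "B \<inter> Z q \<noteq> {} \<longleftrightarrow> p = q \<or> (p, q) \<in> r" if "q \<in> P" for q
    using same_profileD(1)[OF assms(1) that] trim_atD(2)[OF assms(2) that] by blast
  assume pp: "(p, p) \<notin> r"
  have "A \<inter> Y p \<approx> B \<inter> Z p"
  proof (rule same_profileD(2)[OF assms(1,4)])
    show "A \<inter> Y q = {}" if "q \<in> P" "(q, p) \<in> r" for q
      using trim_atD(2)[OF assms(2) that(1)] that(2) pp assms(5) by (metis antisymD)
  qed
  then show "card (B \<inter> Z p) = 1"
    using trim_atD(3)[OF assms(2,4) pp] bij_betw_same_card unfolding eqpoll_def by metis
qed (rule assms(3))

lemma injection_into_infinite: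
  assumes "finite A" "infinite B"
  shows "\<exists>f. inj_on f A \<and> f ` A \<subseteq> B"
proof -
  obtain C where "finite C" "card C = card A" "C \<subseteq> B"
    using infinite_arbitrarily_large[OF assms(2)] by blast
  then show ?thesis
    using assms(1) finite_same_card_bij[of A C] unfolding bij_betw_def by metis
qed

locale trim_partition_pair =
  Y: trim_partition_space W P r Y + Z: trim_partition_space V P r Z
  for W :: "'v topology" and V :: "'w topology" and P :: "'i set" and r Y Z
begin

lemma trim_partition_pair_swap: "trim_partition_pair V W P r Z Y"
  by unfold_locales

text \<open>If \<open>p\<close> is above the index of some spine point, then \<open>B\<close> contains infinitely many points of \<open>Z p\<close>.
  Otherwise all points of \<open>Y p\<close> in \<open>A\<close> are spine points and they are counted by the profile.\<close>

lemma spine_fibre_transfer: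
  assumes prof: "same_profile P r Y A Z B" and B: "openin V B"
    and E: "spine P r Y A E" and p: "p \<in> P"
  shows "\<exists>f. inj_on f (E \<inter> Y p) \<and> f ` (E \<inter> Y p) \<subseteq> B \<inter> Z p \<and>
           ((\<forall>x\<in>E. (Y.ty x, p) \<notin> r) \<longrightarrow> f ` (E \<inter> Y p) = B \<inter> Z p)"
proof -
  have E': "finite E" "E \<subseteq> A \<inter> (\<Union>p\<in>P. Y p)"
    and above: "\<And>q z. q \<in> P \<Longrightarrow> z \<in> A \<inter> Y q - E \<Longrightarrow> \<exists>x\<in>E. (Y.ty x, q) \<in> r"
    using E unfolding spine_def by auto
  show ?thesis
  proof (cases "\<exists>x\<in>E. (Y.ty x, p) \<in> r")
    case True
    then obtain x where x: "x \<in> E" "(Y.ty x, p) \<in> r" by blast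
    then have ty: "Y.ty x \<in> P" "x \<in> Y (Y.ty x)"
      using E'(2) Y.ty_in Y.in_X_ty by blast+
    then have "A \<inter> Y (Y.ty x) \<noteq> {}"
      using x E'(2) by blast
    then obtain b where "b \<in> B" "b \<in> Z (Y.ty x)"
      using same_profileD(1)[OF prof ty(1)] by blast
    then have "infinite (B \<inter> Z p)"
      using Z.infinite_above[OF p ty(1) _ x(2) B] by blast
    then show ?thesis
      using injection_into_infinite[of "E \<inter> Y p" "B \<inter> Z p"] E'(1) True by blast
  next
    case False
    have "A \<inter> Y q = {}" if q: "q \<in> P" "(q, p) \<in> r" for q
    proof (rule ccontr)
      assume "A \<inter> Y q \<noteq> {}"
      then obtain z where z: "z \<in> A" "z \<in> Y q" by blast
      show False
      proof (cases "z \<in> E")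
        case True
        then show False using False Y.ty_eq[OF q(1) z(2)] q(2) by blast
      next
        case nz: False
        then obtain x where "x \<in> E" "(Y.ty x, q) \<in> r"
          using above[OF q(1)] z by blast
        then show False using False Y.r_trans q(2) by blast
      qed
    qed
    then have "A \<inter> Y p \<approx> B \<inter> Z p"
      using same_profileD(2)[OF prof p] by blast
    moreover have "A \<inter> Y p = E \<inter> Y p"
      using above[OF p] False E'(2) by blast
    ultimately obtain f where "bij_betw f (E \<inter> Y p) (B \<inter> Z p)"
      unfolding eqpoll_def by auto
    then show ?thesis
      unfolding bij_betw_def by blast
  qed
qed

text \<open>The copies of the fibres of the spine do not interfere since the parts \<open>Z p\<close> are disjoint.\<close>

lemma spine_transfer:
  assumes prof: "same_profile P r Y A Z B" and B: "openin V B" and E: "spine P r Y A E"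
  shows "\<exists>y. inj_on y E \<and> (\<forall>x\<in>E. y x \<in> Z (Y.ty x)) \<and> spine P r Z B (y ` E)"
proof -
  have E': "finite E" "E \<subseteq> A \<inter> (\<Union>p\<in>P. Y p)"
    and above: "\<And>q z. q \<in> P \<Longrightarrow> z \<in> A \<inter> Y q - E \<Longrightarrow> \<exists>x\<in>E. (Y.ty x, q) \<in> r"
    using E unfolding spine_def by auto
  have ty: "Y.ty x \<in> P" "x \<in> Y (Y.ty x)" if "x \<in> E" for x
    using that E'(2) Y.ty_in Y.in_X_ty by blast+
  have "\<forall>p\<in>P. \<exists>f. inj_on f (E \<inter> Y p) \<and> f ` (E \<inter> Y p) \<subseteq> B \<inter> Z p \<and>
           ((\<forall>x\<in>E. (Y.ty x, p) \<notin> r) \<longrightarrow> f ` (E \<inter> Y p) = B \<inter> Z p)"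
    using spine_fibre_transfer[OF prof B E] by blast
  from bchoice[OF this] obtain f where f: "\<And>p. p \<in> P \<Longrightarrow> inj_on (f p) (E \<inter> Y p)"
    "\<And>p. p \<in> P \<Longrightarrow> f p ` (E \<inter> Y p) \<subseteq> B \<inter> Z p"
    "\<And>p. p \<in> P \<Longrightarrow> (\<forall>x\<in>E. (Y.ty x, p) \<notin> r) \<Longrightarrow> f p ` (E \<inter> Y p) = B \<inter> Z p"
    by blast
  define y where "y = (\<lambda>x. f (Y.ty x) x)"
  have y: "y x \<in> B" "y x \<in> Z (Y.ty x)" if "x \<in> E" for x
    using f(2)[OF ty(1)[OF that]] that ty(2)[OF that] unfolding y_def by auto
  have yty: "Z.ty (y x) = Y.ty x" if "x \<in> E" for x
    using Z.ty_eq ty(1) y(2) that by blast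
  have inj: "inj_on y E"
  proof (rule inj_onI)
    fix x x' assume x: "x \<in> E" "x' \<in> E" "y x = y x'"
    then have t: "Y.ty x = Y.ty x'"
      using yty by metis
    have "x \<in> E \<inter> Y (Y.ty x)" "x' \<in> E \<inter> Y (Y.ty x)"
      using x ty(2)[of x] ty(2)[of x'] t by simp_all
    moreover have "f (Y.ty x) x = f (Y.ty x) x'"
      using x(3) t unfolding y_def by simp
    ultimately show "x = x'"
      using f(1)[OF ty(1)[OF x(1)]] by (meson inj_onD)
  qed
  have "spine P r Z B (y ` E)"
    unfolding spine_def
  proof (intro conjI ballI)
    show "y ` E \<subseteq> B \<inter> (\<Union>p\<in>P. Z p)"
      using y ty(1) by blast
    fix q z assume q: "q \<in> P" and z: "z \<in> B \<inter> Z q - y ` E"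
    have "\<exists>x\<in>E. (Y.ty x, q) \<in> r"
    proof (rule ccontr)
      assume "\<not> ?thesis"
      then have "f q ` (E \<inter> Y q) = B \<inter> Z q"
        using f(3)[OF q] by blast
      then obtain x where "x \<in> E" "x \<in> Y q" "z = f q x"
        using z by blast
      then show False
        using z Y.ty_eq[OF q] unfolding y_def by blast
    qed
    then show "\<exists>x\<in>y ` E. (Z.ty x, q) \<in> r"
      using yty by auto
  qed (use E'(1) in simp)
  then show ?thesis
    using inj y(2) by blast
qed

text \<open>Decompose both halves of \<open>A\<close> along spines, copy the union of the spines to \<open>B\<close> and collect the trim sets
  around the copies of each half.\<close>

lemma compact_split:
  assumes A: "A \<in> compact_opens W" and B: "B \<in> compact_opens V"
    and prof: "same_profile P r Y A Z B" and C: "C \<in> compact_opens W"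
  shows "\<exists>D\<in>compact_opens V. D \<subseteq> B \<and> same_profile P r Y (A \<inter> C) Z D \<and>
           same_profile P r Y (A - C) Z (B - D)"
proof -
  have AC: "A \<inter> C \<in> compact_opens W" "A - C \<in> compact_opens W"
    using A C Y.Hausdorff compact_opens_Int compact_opens_Diff by blast+
  obtain E1 E2 where E1: "spine P r Y (A \<inter> C) E1" and E2: "spine P r Y (A - C) E2"
    using Y.spine_exists AC by meson
  obtain N1 where N1: "disjoint_family_on N1 E1" "(\<Union>x\<in>E1. N1 x) = A \<inter> C"
    "\<And>x. x \<in> E1 \<Longrightarrow> x \<in> N1 x \<and> N1 x \<in> trim_at W P r Y (Y.ty x)"
    using Y.spine_decomposition[OF E1 AC(1)] by auto
  obtain N2 where N2: "disjoint_family_on N2 E2" "(\<Union>x\<in>E2. N2 x) = A - C"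
    "\<And>x. x \<in> E2 \<Longrightarrow> x \<in> N2 x \<and> N2 x \<in> trim_at W P r Y (Y.ty x)"
    using Y.spine_decomposition[OF E2 AC(2)] by auto
  have fin: "finite E1" "finite E2" and sub: "E1 \<subseteq> A \<inter> C" "E2 \<subseteq> A - C"
    and pts: "E1 \<union> E2 \<subseteq> (\<Union>p\<in>P. Y p)"
    using E1 E2 unfolding spine_def by auto
  have ty: "\<And>x. x \<in> E1 \<union> E2 \<Longrightarrow> Y.ty x \<in> P"
    using pts Y.ty_in by blast
  have E: "spine P r Y A (E1 \<union> E2)"
    unfolding spine_def
  proof (intro conjI ballI)
    show "finite (E1 \<union> E2)" using fin by simp
    show "E1 \<union> E2 \<subseteq> A \<inter> (\<Union>p\<in>P. Y p)"
      using E1 E2 unfolding spine_def by blast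
    fix q z assume q: "q \<in> P" and z: "z \<in> A \<inter> Y q - (E1 \<union> E2)"
    then have "(z \<in> (A \<inter> C) \<inter> Y q - E1) \<or> (z \<in> (A - C) \<inter> Y q - E2)"
      by blast
    then show "\<exists>x\<in>E1 \<union> E2. (Y.ty x, q) \<in> r"
      using E1 E2 q unfolding spine_def by blast
  qed
  obtain y where y: "inj_on y (E1 \<union> E2)" "\<And>x. x \<in> E1 \<union> E2 \<Longrightarrow> y x \<in> Z (Y.ty x)"
    "spine P r Z B (y ` (E1 \<union> E2))"
    using spine_transfer[OF prof _ E] B by (auto simp: compact_opens_iff)
  obtain M where M: "disjoint_family_on M (y ` (E1 \<union> E2))" "(\<Union>x\<in>y ` (E1 \<union> E2). M x) = B"
    "\<And>x. x \<in> y ` (E1 \<union> E2) \<Longrightarrow> M x \<in> trim_at V P r Z (Z.ty x)"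
    using Z.spine_decomposition[OF y(3) B] by auto
  define M' where "M' = (\<lambda>x. M (y x))"
  have M': "M' x \<in> trim_at V P r Z (Y.ty x)" if "x \<in> E1 \<union> E2" for x
    using M(3)[of "y x"] that Z.ty_eq[OF ty[OF that] y(2)[OF that]] unfolding M'_def by auto
  have M'disj: "M' x \<inter> M' x' = {}" if "x \<in> E1 \<union> E2" "x' \<in> E1 \<union> E2" "x \<noteq> x'" for x x'
    using M(1) y(1) that unfolding M'_def disjoint_family_on_def by (meson image_eqI inj_onD)
  define D where "D = (\<Union>x\<in>E1. M' x)"
  have "(\<Union>x\<in>E1 \<union> E2. M' x) = B"
    using M(2) unfolding M'_def by simp
  moreover have "E1 \<inter> E2 = {}"
    using sub by blast
  ultimately have BD: "B - D = (\<Union>x\<in>E2. M' x)" "D \<subseteq> B"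
    using M'disj unfolding D_def by blast+
  have "D \<in> compact_opens V"
    unfolding D_def using fin M' by (intro compact_opens_UN) (auto simp: trim_at_iff)
  moreover have "same_profile P r Y (A \<inter> C) Z D"
    unfolding D_def N1(2)[symmetric]
  proof (rule same_profile_UN[OF fin(1) N1(1)])
    show "disjoint_family_on M' E1"
      using M'disj unfolding disjoint_family_on_def by blast
    show "same_profile P r Y (N1 x) Z (M' x)" if "x \<in> E1" for x
      using same_profile_trim[OF ty _ M'] N1(3)[OF that] that by blast
  qed
  moreover have "same_profile P r Y (A - C) Z (B - D)"
    unfolding BD N2(2)[symmetric]
  proof (rule same_profile_UN[OF fin(2) N2(1)])
    show "disjoint_family_on M' E2"
      using M'disj unfolding disjoint_family_on_def by blast
    show "same_profile P r Y (N2 x) Z (M' x)" if "x \<in> E2" for x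
      using same_profile_trim[OF ty _ M'] N2(3)[OF that] that by blast
  qed
  ultimately show ?thesis
    using BD(2) by blast
qed

end

section \<open>Uniqueness of bounded trim partitions\<close>

context trim_partition_space
begin

lemma lower_subsetD: "lower_subset P r L \<Longrightarrow> (q, p) \<in> r \<Longrightarrow> p \<in> L \<Longrightarrow> q \<in> L"
  using po(1) unfolding lower_subset_def po_down_def po_le_def by blast

lemma nonempty_open_meets:
  assumes "openin W U" "U \<noteq> {}"
  shows "\<exists>p\<in>P. U \<inter> X p \<noteq> {}"
proof -
  obtain x where x: "x \<in> U" "x \<in> topspace W"
    using assms openin_subset by blast
  then obtain p A where "p \<in> P" "A \<in> trim_at W P r X p" "A \<subseteq> U"
    using trim_base[OF x(2) assms(1) x(1)] by blast
  then show ?thesis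
    using trim_point by blast
qed

lemma dense: "W closure_of (\<Union>p\<in>P. X p) = topspace W"
  unfolding dense_intersects_open using nonempty_open_meets by blast

text \<open>A part whose closure is not compact sticks out of every compact open set.\<close>

lemma trim_set_avoiding:
  assumes "p \<in> P" "\<not> compactin W (W closure_of X p)" "K \<in> compact_opens W"
  shows "\<exists>A\<in>trim_at W P r X p. A \<inter> K = {}"
proof -
  have "\<not> X p \<subseteq> K"
  proof
    assume "X p \<subseteq> K"
    then have "W closure_of X p \<subseteq> K"
      using assms(3) compact_opens_closedin[OF Hausdorff] by (simp add: closure_of_minimal)
    then show False
      using assms(2,3) closed_compactin[of W K "W closure_of X p"] by (simp add: compact_opens_def)
  qed
  then obtain x where "x \<in> X p" "x \<in> topspace W - K"
    using X_subset[OF assms(1)] by blast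
  moreover have "openin W (topspace W - K)"
    using compact_opens_closedin[OF Hausdorff assms(3)] by blast
  ultimately show ?thesis
    using trim_nbhd[OF assms(1), of x "topspace W - K"] by blast
qed

lemma trim_copies_avoiding:
  assumes "finite E" "\<And>x. x \<in> E \<Longrightarrow> t x \<in> P \<and> \<not> compactin W (W closure_of X (t x))"
    and K: "K \<in> compact_opens W"
  shows "\<exists>M. disjoint_family_on M E \<and> (\<forall>x\<in>E. M x \<in> trim_at W P r X (t x) \<and> M x \<inter> K = {})"
  using assms(1,2)
proof (induction rule: finite_induct)
  case (insert x E)
  then obtain M where M: "disjoint_family_on M E"
    "\<And>x. x \<in> E \<Longrightarrow> M x \<in> trim_at W P r X (t x) \<and> M x \<inter> K = {}"
    by auto
  have "(\<Union>y\<in>E. M y) \<in> compact_opens W"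
    using M(2) insert.hyps by (intro compact_opens_UN) (simp_all add: trim_at_iff)
  then have "K \<union> (\<Union>y\<in>E. M y) \<in> compact_opens W"
    using K compact_opens_Un by blast
  then obtain A where A: "A \<in> trim_at W P r X (t x)" "A \<inter> (K \<union> (\<Union>y\<in>E. M y)) = {}"
    using trim_set_avoiding insert.prems by (metis insertI1)
  have disj: "disjoint_family_on (M(x := A)) (insert x E)"
    using M(1) A(2) insert.hyps unfolding disjoint_family_on_def by auto
  have "A \<inter> K = {}"
    using A(2) by blast
  then have "\<forall>y\<in>insert x E. (M(x := A)) y \<in> trim_at W P r X (t y) \<and> (M(x := A)) y \<inter> K = {}"
    using A M(2) insert.hyps by auto
  with disj show ?case
    by blast
qed (simp add: disjoint_family_on_def)

lemma lower_points_in_compact_open: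
  assumes "compactin W (W closure_of (\<Union>p\<in>L. X p))" "L \<subseteq> P"
    and U: "openin W U" "closedin W U" and C: "C \<in> compact_opens W"
  shows "\<exists>K\<in>compact_opens W. K \<subseteq> U \<and> U \<inter> C \<subseteq> K \<and> (\<forall>p\<in>L. U \<inter> X p \<subseteq> K)"
proof -
  obtain K where K: "K \<in> compact_opens W" "W closure_of (\<Union>p\<in>L. X p) \<subseteq> K"
    using compact_subset_compact_open[OF stone assms(1)] by blast
  have "(\<Union>p\<in>L. X p) \<subseteq> W closure_of (\<Union>p\<in>L. X p)"
    using assms(2) X_subset by (intro closure_of_subset) blast
  then have "\<forall>p\<in>L. X p \<subseteq> K"
    using K(2) by blast
  then show ?thesis
    using clopen_Int_compact_open[OF U compact_opens_Un[OF K(1) C]]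
    by (intro bexI[of _ "U \<inter> (K \<union> C)"]) auto
qed

text \<open>The trim pieces of \<open>K\<close> with index in \<open>L\<close> contain all points of \<open>K\<close> with index in the lower set \<open>L\<close>, and
  their type is the upper set generated by these indices.\<close>

lemma lower_part:
  assumes L: "lower_subset P r L"
    and N: "(\<Union>x\<in>E. N x) = K" "\<forall>x\<in>E. ty x \<in> P \<and> N x \<in> trim_at W P r X (ty x)"
  defines "J \<equiv> (\<Union>x\<in>{x \<in> E. ty x \<in> L}. N x)"
  shows "p \<in> L \<Longrightarrow> J \<inter> X p = K \<inter> X p"
    and "p \<in> P \<Longrightarrow> J \<inter> X p \<noteq> {} \<longleftrightarrow> (\<exists>q\<in>L. (q = p \<or> (q, p) \<in> r) \<and> K \<inter> X q \<noteq> {})"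
proof -
  have L_sub: "L \<subseteq> P"
    using L by (simp add: lower_subset_def)
  have J: "J \<inter> X p = K \<inter> X p" if p: "p \<in> L" for p
  proof
    show "J \<inter> X p \<subseteq> K \<inter> X p"
      using N(1) unfolding J_def by blast
    show "K \<inter> X p \<subseteq> J \<inter> X p"
    proof
      fix z assume z: "z \<in> K \<inter> X p"
      then obtain x where x: "x \<in> E" "z \<in> N x"
        using N(1) by blast
      have "p \<in> P" using p L_sub by blast
      then have "ty x = p \<or> (ty x, p) \<in> r"
        using trim_atD(2)[of "N x" W P r X "ty x" p] bspec[OF N(2) x(1)] x z by blast
      then have "ty x \<in> L"
        using lower_subsetD[OF L] p by blast
      then show "z \<in> J \<inter> X p"
        using x z unfolding J_def by blast
    qed
  qed
  then show "p \<in> L \<Longrightarrow> J \<inter> X p = K \<inter> X p" .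
  assume p: "p \<in> P"
  show "J \<inter> X p \<noteq> {} \<longleftrightarrow> (\<exists>q\<in>L. (q = p \<or> (q, p) \<in> r) \<and> K \<inter> X q \<noteq> {})"
  proof
    assume "J \<inter> X p \<noteq> {}"
    then obtain x z where x: "x \<in> E" "ty x \<in> L" and z: "z \<in> N x" "z \<in> X p"
      unfolding J_def by blast
    have "ty x = p \<or> (ty x, p) \<in> r"
      using trim_atD(2)[of "N x" W P r X "ty x" p] bspec[OF N(2) x(1)] p z by blast
    moreover have "K \<inter> X (ty x) \<noteq> {}"
      using trim_point[of "ty x" "N x"] N(1) bspec[OF N(2) x(1)] x(1) by blast
    ultimately show "\<exists>q\<in>L. (q = p \<or> (q, p) \<in> r) \<and> K \<inter> X q \<noteq> {}"
      using x(2) by blast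
  next
    assume "\<exists>q\<in>L. (q = p \<or> (q, p) \<in> r) \<and> K \<inter> X q \<noteq> {}"
    then obtain q where q: "q \<in> L" "q = p \<or> (q, p) \<in> r" "K \<inter> X q \<noteq> {}"
      by blast
    have "openin W (N x)" if "x \<in> E" for x
      using bspec[OF N(2) that] by (simp add: trim_at_iff compact_opens_iff)
    then have "openin W J"
      unfolding J_def by blast
    then show "J \<inter> X p \<noteq> {}"
      using q J[OF q(1)] meets_above[OF p] L_sub by (metis subsetD)
  qed
qed

lemma in_X_if_trim_base:
  assumes "p \<in> P" "w \<in> topspace W"
    and "\<And>U. openin W U \<Longrightarrow> w \<in> U \<Longrightarrow> \<exists>A\<in>trim_at W P r X p. w \<in> A \<and> A \<subseteq> U"
  shows "w \<in> X p"
proof -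
  have "neighbourhood_base_at w (\<lambda>A. A \<in> trim_at W P r X p) W"
  proof (subst neighbourhood_base_at_open)
    show "openin W A" if "A \<in> trim_at W P r X p" for A
      using trim_at_openin[OF that] .
    show "\<forall>U. openin W U \<and> w \<in> U \<longrightarrow> (\<exists>A. A \<in> trim_at W P r X p \<and> w \<in> A \<and> A \<subseteq> U)"
      using assms(3) by blast
  qed
  moreover have "p \<in> trim_indices W P r X"
    using assms unfolding trim_indices_def by (metis (mono_tags, lifting) empty_iff mem_Collect_eq openin_topspace)
  ultimately show ?thesis
    using trim assms(2) unfolding trim_partition_def by blast
qed

end

definition cocompact :: "'w topology \<Rightarrow> 'w set \<Rightarrow> bool" where
  "cocompact W U \<longleftrightarrow> U \<subseteq> topspace W \<and> topspace W - U \<in> compact_opens W \<and> \<not> compactin W U"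

lemma cocompact_clopen:
  assumes "Hausdorff_space W" "cocompact W U"
  shows "openin W U" "closedin W U"
proof -
  have "U = topspace W - (topspace W - U)"
    using assms(2) unfolding cocompact_def by blast
  then show "openin W U" "closedin W U"
    using assms compact_opens_closedin[OF assms(1)] unfolding cocompact_def
    by (metis openin_closedin_eq compact_opens_iff closedin_def Diff_subset openin_diff openin_topspace closedin_diff closedin_topspace)+
qed

lemma cocompact_Diff:
  assumes "Hausdorff_space W" "cocompact W U" "K \<in> compact_opens W"
  shows "cocompact W (U - K)"
  unfolding cocompact_def
proof (intro conjI notI)
  have U: "U \<subseteq> topspace W" "topspace W - U \<in> compact_opens W" "\<not> compactin W U"
    using assms(2) by (simp_all add: cocompact_def)
  have K: "K \<subseteq> topspace W" using compact_opens_subset_topspace[OF assms(3)] .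
  show "U - K \<subseteq> topspace W" using U by blast
  have "topspace W - (U - K) = (topspace W - U) \<union> K" using K by blast
  then show "topspace W - (U - K) \<in> compact_opens W"
    using compact_opens_Un U assms(3) by metis
  assume "compactin W (U - K)"
  moreover have "compactin W (U \<inter> K)"
    using clopen_Int_compact_open[OF cocompact_clopen[OF assms(1,2)] assms(3)] by (simp add: compact_opens_def)
  ultimately have "compactin W ((U - K) \<union> (U \<inter> K))"
    by (rule compactin_Un)
  moreover have "(U - K) \<union> (U \<inter> K) = U" by blast
  ultimately show False using U by simp
qed

text \<open>In a non-compact space the back-and-forth argument also meets complements of compact open sets. These contain
  points of all indices outside \<open>L\<close>, so only their profile on \<open>L\<close> matters.\<close>

definition matched ::
  "'v topology \<Rightarrow> 'w topology \<Rightarrow> 'i set \<Rightarrow> 'i rel \<Rightarrow> 'i set \<Rightarrow> ('i \<Rightarrow> 'v set) \<Rightarrow> ('i \<Rightarrow> 'w set) \<Rightarrow>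
     'v set \<Rightarrow> 'w set \<Rightarrow> bool" where
  "matched W V P r L Y Z A B \<longleftrightarrow>
     A \<in> compact_opens W \<and> B \<in> compact_opens V \<and> same_profile P r Y A Z B \<or>
     cocompact W A \<and> cocompact V B \<and> same_profile L r Y A Z B"

lemma matched_sym: "matched W V P r L Y Z A B \<Longrightarrow> matched V W P r L Z Y B A"
  unfolding matched_def using same_profile_sym by blast

locale bounded_pair = trim_partition_pair W V P r Y Z
  for W :: "'v topology" and V :: "'w topology" and P :: "'i set" and r Y Z +
  fixes L
  assumes L: "lower_subset P r L"
    and compact_Y: "compactin W (W closure_of (\<Union>p\<in>L. Y p))"
    and compact_Z: "compactin V (V closure_of (\<Union>p\<in>L. Z p))"
    and noncompact_Y: "\<And>p. p \<in> P \<Longrightarrow> p \<notin> L \<Longrightarrow> \<not> compactin W (W closure_of Y p)"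
    and noncompact_Z: "\<And>p. p \<in> P \<Longrightarrow> p \<notin> L \<Longrightarrow> \<not> compactin V (V closure_of Z p)"
begin

lemma L_sub: "L \<subseteq> P"
  using L by (simp add: lower_subset_def)

lemma bounded_pair_swap: "bounded_pair V W P r Z Y L"
  by unfold_locales (use L compact_Y compact_Z noncompact_Y noncompact_Z in auto)

lemma lower_parts_same_profile:
  assumes prof: "same_profile L r Y A Z B"
    and K: "\<And>p. p \<in> L \<Longrightarrow> K \<inter> Y p = A \<inter> Y p" and K': "\<And>p. p \<in> L \<Longrightarrow> K' \<inter> Z p = B \<inter> Z p"
    and N: "(\<Union>x\<in>E. N x) = K" "\<forall>x\<in>E. Y.ty x \<in> P \<and> N x \<in> trim_at W P r Y (Y.ty x)"
    and N': "(\<Union>x\<in>E'. N' x) = K'" "\<forall>x\<in>E'. Z.ty x \<in> P \<and> N' x \<in> trim_at V P r Z (Z.ty x)"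
  shows "same_profile P r Y (\<Union>x\<in>{x \<in> E. Y.ty x \<in> L}. N x) Z (\<Union>x\<in>{x \<in> E'. Z.ty x \<in> L}. N' x)"
    (is "same_profile P r Y ?J Z ?J'")
proof -
  note J = Y.lower_part[OF L N]
  note J' = Z.lower_part[OF L N']
  have meet: "?J \<inter> Y p = {} \<longleftrightarrow> ?J' \<inter> Z p = {}" if p: "p \<in> P" for p
  proof -
    have "K \<inter> Y q \<noteq> {} \<longleftrightarrow> K' \<inter> Z q \<noteq> {}" if "q \<in> L" for q
      using K[OF that] K'[OF that] same_profileD(1)[OF prof that] by simp
    then have "(\<exists>q\<in>L. (q = p \<or> (q, p) \<in> r) \<and> K \<inter> Y q \<noteq> {}) \<longleftrightarrow>
        (\<exists>q\<in>L. (q = p \<or> (q, p) \<in> r) \<and> K' \<inter> Z q \<noteq> {})"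
      by (intro bex_cong) auto
    then show ?thesis
      using J(2)[OF p] J'(2)[OF p] by argo
  qed
  show ?thesis
    unfolding same_profile_def
  proof (intro conjI ballI impI)
    fix p assume p: "p \<in> P"
    show "?J \<inter> Y p = {} \<longleftrightarrow> ?J' \<inter> Z p = {}"
      using meet[OF p] .
    assume min: "\<forall>q\<in>P. (q, p) \<in> r \<longrightarrow> ?J \<inter> Y q = {}"
    show "?J \<inter> Y p \<approx> ?J' \<inter> Z p"
    proof (cases "p \<in> L")
      case True
      have "A \<inter> Y p \<approx> B \<inter> Z p"
      proof (rule same_profileD(2)[OF prof True])
        show "A \<inter> Y q = {}" if q: "q \<in> L" "(q, p) \<in> r" for q
        proof -
          have "?J \<inter> Y q = {}"
            using min q L_sub by blast
          then show ?thesis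
            using J(1)[OF q(1)] K[OF q(1)] by simp
        qed
      qed
      then show ?thesis
        using J(1)[OF True] J'(1)[OF True] K[OF True] K'[OF True] by simp
    next
      case False
      have "?J \<inter> Y p = {}"
      proof (rule ccontr)
        assume "?J \<inter> Y p \<noteq> {}"
        then obtain q where q: "q \<in> L" "q = p \<or> (q, p) \<in> r" "K \<inter> Y q \<noteq> {}"
          using J(2)[OF p] by blast
        then have "(q, p) \<in> r" using False by blast
        then show False
          using min q L_sub J(1)[OF q(1)] by blast
      qed
      moreover from this have "?J' \<inter> Z p = {}"
        using meet[OF p] by simp
      ultimately show ?thesis by simp
    qed
  qed
qed

text \<open>Reduces the splitting of complements of compact sets to that of compact sets. Choose compact open sets \<open>K0\<close> and
  \<open>K1\<close> that contain all points of \<open>A\<close> and \<open>B\<close> with index in \<open>L\<close>, and decompose them into trim sets. Those with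
  index in \<open>L\<close> already form unions of equal profile. For each other trim piece on one side, a
  trim set of the same index is added on the other side, outside the sets chosen so far.\<close>

lemma cocompact_match:
  assumes A: "cocompact W A" and B: "cocompact V B"
    and prof: "same_profile L r Y A Z B" and C: "C \<in> compact_opens W"
  shows "\<exists>K\<in>compact_opens W. \<exists>K'\<in>compact_opens V. K \<subseteq> A \<and> A \<inter> C \<subseteq> K \<and> K' \<subseteq> B \<and>
    same_profile P r Y K Z K' \<and> (\<forall>p\<in>L. (A - K) \<inter> Y p = {} \<and> (B - K') \<inter> Z p = {})"
proof -
  obtain K0 where K0: "K0 \<in> compact_opens W" "K0 \<subseteq> A" "A \<inter> C \<subseteq> K0" "\<And>p. p \<in> L \<Longrightarrow> A \<inter> Y p \<subseteq> K0"
    using Y.lower_points_in_compact_open[OF compact_Y L_sub cocompact_clopen[OF Y.Hausdorff A] C] by blast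
  obtain K1 where K1: "K1 \<in> compact_opens V" "K1 \<subseteq> B" "\<And>p. p \<in> L \<Longrightarrow> B \<inter> Z p \<subseteq> K1"
    using Z.lower_points_in_compact_open[OF compact_Z L_sub cocompact_clopen[OF Z.Hausdorff B]
      empty_in_compact_opens] by blast
  obtain E where E: "spine P r Y K0 E"
    using Y.spine_exists[OF K0(1)] by blast
  obtain E' where E': "spine P r Z K1 E'"
    using Z.spine_exists[OF K1(1)] by blast
  obtain N where N: "disjoint_family_on N E" "(\<Union>x\<in>E. N x) = K0" "\<And>x. x \<in> E \<Longrightarrow> N x \<in> trim_at W P r Y (Y.ty x)"
    using Y.spine_decomposition[OF E K0(1)] by auto
  obtain N' where N': "disjoint_family_on N' E'" "(\<Union>x\<in>E'. N' x) = K1" "\<And>x. x \<in> E' \<Longrightarrow> N' x \<in> trim_at V P r Z (Z.ty x)"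
    using Z.spine_decomposition[OF E' K1(1)] by auto
  have fin: "finite E" "finite E'"
    using E E' unfolding spine_def by auto
  have ty: "Y.ty x \<in> P" if "x \<in> E" for x
    using E Y.ty_in that unfolding spine_def by blast
  have ty': "Z.ty x \<in> P" if "x \<in> E'" for x
    using E' Z.ty_in that unfolding spine_def by blast
  define EL where "EL = {x \<in> E. Y.ty x \<in> L}"
  define EN where "EN = E - EL"
  define E'L where "E'L = {x \<in> E'. Z.ty x \<in> L}"
  define E'N where "E'N = E' - E'L"
  have "K0 \<union> (topspace W - A) \<in> compact_opens W"
    using K0(1) A compact_opens_Un unfolding cocompact_def by blast
  then obtain M where M: "disjoint_family_on M E'N"
    "\<And>x. x \<in> E'N \<Longrightarrow> M x \<in> trim_at W P r Y (Z.ty x) \<and> M x \<inter> (K0 \<union> (topspace W - A)) = {}"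
    using Y.trim_copies_avoiding[of E'N Z.ty "K0 \<union> (topspace W - A)"] fin ty' noncompact_Y
    unfolding E'N_def E'L_def by auto
  have "K1 \<union> (topspace V - B) \<in> compact_opens V"
    using K1(1) B compact_opens_Un unfolding cocompact_def by blast
  then obtain M' where M': "disjoint_family_on M' EN"
    "\<And>x. x \<in> EN \<Longrightarrow> M' x \<in> trim_at V P r Z (Y.ty x) \<and> M' x \<inter> (K1 \<union> (topspace V - B)) = {}"
    using Z.trim_copies_avoiding[of EN Y.ty "K1 \<union> (topspace V - B)"] fin ty noncompact_Z
    unfolding EN_def EL_def by auto
  define J where "J = (\<Union>x\<in>EL. N x)"
  define J' where "J' = (\<Union>x\<in>E'L. N' x)"
  define G where "G = (\<Union>x\<in>EN. N x)"
  define G' where "G' = (\<Union>x\<in>E'N. N' x)"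
  define H where "H = (\<Union>x\<in>E'N. M x)"
  define H' where "H' = (\<Union>x\<in>EN. M' x)"
  have sub: "EL \<subseteq> E" "EN \<subseteq> E" "E'L \<subseteq> E'" "E'N \<subseteq> E'" "EL \<inter> EN = {}" "E'L \<inter> E'N = {}"
    "EL \<union> EN = E" "E'L \<union> E'N = E'"
    unfolding EL_def EN_def E'L_def E'N_def by auto
  have K0_eq: "K0 = J \<union> G"
    unfolding J_def G_def N(2)[symmetric] sub(7)[symmetric] by blast
  have K1_eq: "K1 = J' \<union> G'"
    unfolding J'_def G'_def N'(2)[symmetric] sub(8)[symmetric] by blast
  have JG: "J \<inter> G = {}"
    unfolding J_def G_def using disjoint_UN_parts[OF N(1) sub(1,2,5)] .
  have JG': "J' \<inter> G' = {}"
    unfolding J'_def G'_def using disjoint_UN_parts[OF N'(1) sub(3,4,6)] .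
  have HK: "H \<inter> K0 = {}" "H \<inter> (topspace W - A) = {}"
    using M(2) unfolding H_def by blast+
  have HK': "H' \<inter> K1 = {}" "H' \<inter> (topspace V - B) = {}"
    using M'(2) unfolding H'_def by blast+
  have HC: "H \<in> compact_opens W"
    unfolding H_def using M(2) fin sub by (intro compact_opens_UN) (auto simp: trim_at_iff intro: finite_subset)
  have HC': "H' \<in> compact_opens V"
    unfolding H'_def using M'(2) fin sub by (intro compact_opens_UN) (auto simp: trim_at_iff intro: finite_subset)
  have HA: "H \<subseteq> A" and HB: "H' \<subseteq> B"
    using HK HK' compact_opens_subset_topspace[OF HC] compact_opens_subset_topspace[OF HC'] by blast+
  have profJ: "same_profile P r Y J Z J'"
    unfolding J_def J'_def EL_def E'L_def
  proof (rule lower_parts_same_profile[OF prof _ _ N(2) _ N'(2)])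
    show "K0 \<inter> Y p = A \<inter> Y p" if "p \<in> L" for p
      using K0(2) K0(4)[OF that] by blast
    show "K1 \<inter> Z p = B \<inter> Z p" if "p \<in> L" for p
      using K1(2) K1(3)[OF that] by blast
  qed (use N(3) N'(3) ty ty' in auto)
  have profG: "same_profile P r Y G Z H'"
    unfolding G_def H'_def
  proof (rule same_profile_UN)
    show "finite EN" using fin sub finite_subset by blast
    show "disjoint_family_on N EN"
      using N(1) sub(2) disjoint_family_on_mono by blast
    show "same_profile P r Y (N x) Z (M' x)" if "x \<in> EN" for x
      using same_profile_trim[of "Y.ty x" P "N x" W r Y "M' x" V Z] N(3) M'(2) ty that sub(2) by blast
  qed (rule M'(1))
  have profH: "same_profile P r Y H Z G'"
    unfolding G'_def H_def
  proof (rule same_profile_UN)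
    show "finite E'N" using fin sub finite_subset by blast
    show "disjoint_family_on N' E'N"
      using N'(1) sub(4) disjoint_family_on_mono by blast
    show "same_profile P r Y (M x) Z (N' x)" if "x \<in> E'N" for x
      using same_profile_trim[of "Z.ty x" P "M x" W r Y "N' x" V Z] N'(3) M(2) ty' that sub(4) by blast
  qed (rule M(1))
  have "same_profile P r Y (J \<union> (G \<union> H)) Z (J' \<union> (H' \<union> G'))"
    using JG JG' HK(1) HK'(1) unfolding K0_eq K1_eq
    by (intro same_profile_Un profJ profG profH) blast+
  moreover have "J \<union> (G \<union> H) = K0 \<union> H" "J' \<union> (H' \<union> G') = K1 \<union> H'"
    unfolding K0_eq K1_eq by blast+
  ultimately have "same_profile P r Y (K0 \<union> H) Z (K1 \<union> H')"
    by simp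
  moreover have "(A - (K0 \<union> H)) \<inter> Y p = {} \<and> (B - (K1 \<union> H')) \<inter> Z p = {}" if "p \<in> L" for p
    using K0(4)[OF that] K1(3)[OF that] by blast
  ultimately show ?thesis
    using compact_opens_Un[OF K0(1) HC] compact_opens_Un[OF K1(1) HC'] K0(2,3) K1(2) HA HB
    by (intro bexI[of _ "K0 \<union> H"] bexI[of _ "K1 \<union> H'"]) blast+
qed

lemma matched_split:
  assumes m: "matched W V P r L Y Z A B" and C: "C \<in> compact_opens W"
  shows "\<exists>D\<subseteq>B. matched W V P r L Y Z (A \<inter> C) D \<and> matched W V P r L Y Z (A - C) (B - D)"
proof (cases "A \<in> compact_opens W \<and> B \<in> compact_opens V \<and> same_profile P r Y A Z B")
  case True
  then obtain D where D: "D \<in> compact_opens V" "D \<subseteq> B" "same_profile P r Y (A \<inter> C) Z D"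
    "same_profile P r Y (A - C) Z (B - D)"
    using compact_split[OF _ _ _ C] by blast
  moreover have "A \<inter> C \<in> compact_opens W" "A - C \<in> compact_opens W" "B - D \<in> compact_opens V"
    using True C D(1) compact_opens_Int[OF Y.Hausdorff] compact_opens_Diff[OF Y.Hausdorff]
      compact_opens_Diff[OF Z.Hausdorff] by blast+
  ultimately show ?thesis
    unfolding matched_def by blast
next
  case False
  then have A: "cocompact W A" and B: "cocompact V B" and prof: "same_profile L r Y A Z B"
    using m unfolding matched_def by blast+
  obtain K K' where K: "K \<in> compact_opens W" "K \<subseteq> A" "A \<inter> C \<subseteq> K"
    and K': "K' \<in> compact_opens V" "K' \<subseteq> B" and profK: "same_profile P r Y K Z K'"
    and rest: "\<And>p. p \<in> L \<Longrightarrow> (A - K) \<inter> Y p = {}" "\<And>p. p \<in> L \<Longrightarrow> (B - K') \<inter> Z p = {}"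
    using cocompact_match[OF A B prof C] by blast
  obtain D where D: "D \<in> compact_opens V" "D \<subseteq> K'" "same_profile P r Y (K \<inter> C) Z D"
    "same_profile P r Y (K - C) Z (K' - D)"
    using compact_split[OF K(1) K'(1) profK C] by blast
  have eq: "K \<inter> C = A \<inter> C" "(K - C) \<union> (A - K) = A - C" "(K' - D) \<union> (B - K') = B - D"
    using K K' D(2) by blast+
  have "A \<inter> C \<in> compact_opens W"
    using compact_opens_Int[OF Y.Hausdorff K(1) C] unfolding eq(1) .
  then have "matched W V P r L Y Z (A \<inter> C) D"
    using D(1,3) unfolding matched_def eq(1) by blast
  moreover have "same_profile L r Y (A - C) Z (B - D)"
    unfolding eq(2,3)[symmetric]
  proof (rule same_profile_Un)
    show "same_profile L r Y (K - C) Z (K' - D)"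
      using same_profile_lower[OF D(4) L_sub] Y.lower_subsetD[OF L] by blast
    show "same_profile L r Y (A - K) Z (B - K')"
      using rest by (rule same_profile_disjoint)
  qed auto
  then have "matched W V P r L Y Z (A - C) (B - D)"
    using cocompact_Diff[OF Y.Hausdorff A C] cocompact_Diff[OF Z.Hausdorff B D(1)]
    unfolding matched_def by blast
  ultimately show ?thesis
    using D(2) K'(2) by blast
qed

end

context trim_partition_pair
begin

text \<open>The parts are recovered from the trim sets: \<open>Z p\<close> consists of the points with a neighbourhood base of \<open>p\<close>-trim
  sets, and being \<open>p\<close>-trim is a matter of the profile.\<close>

lemma in_part_if_homeomorphic_image:
  assumes h: "homeomorphic_map W V h"
    and prof: "\<And>C. C \<in> compact_opens W \<Longrightarrow> same_profile P r Y C Z (h ` C)"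
    and p: "p \<in> P" and y: "y \<in> Y p"
  shows "h y \<in> Z p"
proof (rule Z.in_X_if_trim_base[OF p])
  have ytop: "y \<in> topspace W"
    using y Y.X_subset[OF p] by blast
  then show "h y \<in> topspace V"
    using homeomorphic_imp_surjective_map[OF h] by blast
  fix U assume U: "openin V U" "h y \<in> U"
  have "openin W {x \<in> topspace W. h x \<in> U}"
    using homeomorphic_imp_continuous_map[OF h] U(1) by (simp add: continuous_map_def)
  then obtain A where A: "A \<in> trim_at W P r Y p" "y \<in> A" "A \<subseteq> {x \<in> topspace W. h x \<in> U}"
    using Y.trim_nbhd[OF p y] U(2) ytop by blast
  have AC: "A \<in> compact_opens W"
    using trim_atD(1)[OF A(1)] .
  have "h ` A \<in> trim_at V P r Z p"
    using trim_at_same_profile[OF prof[OF AC] A(1) homeomorphic_map_compact_opens[OF h AC] p Y.po(2)] .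
  then show "\<exists>A\<in>trim_at V P r Z p. h y \<in> A \<and> A \<subseteq> U"
    using A by blast
qed

lemma homeomorphism_respects_parts:
  assumes h: "homeomorphic_map W V h"
    and prof: "\<And>C. C \<in> compact_opens W \<Longrightarrow> same_profile P r Y C Z (h ` C)" and p: "p \<in> P"
  shows "h ` Y p = Z p"
proof
  show "h ` Y p \<subseteq> Z p"
    using in_part_if_homeomorphic_image[OF h prof p] by blast
  obtain k where hk: "homeomorphic_maps W V h k"
    using h homeomorphic_map_maps by blast
  then have k: "homeomorphic_map V W k" and hk_id: "\<And>y. y \<in> topspace V \<Longrightarrow> h (k y) = y"
    by (simp_all add: homeomorphic_maps_map)
  interpret swap: trim_partition_pair V W P r Z Y
    by (rule trim_partition_pair_swap)
  have "same_profile P r Z D Y (k ` D)" if D: "D \<in> compact_opens V" for D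
  proof -
    have "h (k x) = x" if "x \<in> D" for x
      using hk_id compact_opens_subset_topspace[OF D] that by blast
    then have "h ` (k ` D) = D"
      by (simp add: image_image)
    then show ?thesis
      using same_profile_sym[OF prof[OF homeomorphic_map_compact_opens[OF k D]]] by simp
  qed
  then have kz: "k z \<in> Y p" if "z \<in> Z p" for z
    by (rule swap.in_part_if_homeomorphic_image[OF k _ p that])
  show "Z p \<subseteq> h ` Y p"
  proof
    fix z assume z: "z \<in> Z p"
    then have "h (k z) = z"
      using hk_id Z.X_subset[OF p] by blast
    then show "z \<in> h ` Y p"
      using kz[OF z] by (metis image_eqI)
  qed
qed

lemma empty_iff_same_profile:
  assumes "same_profile P r Y A Z B" "openin W A" "openin V B"
  shows "A = {} \<longleftrightarrow> B = {}"
proof -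
  have meet: "A \<inter> Y p = {} \<longleftrightarrow> B \<inter> Z p = {}" if "p \<in> P" for p
    using same_profileD(1)[OF assms(1) that] .
  show ?thesis
  proof
    show "B = {}" if "A = {}"
      using that meet Z.nonempty_open_meets[OF assms(3)] by auto
    show "A = {}" if "B = {}"
      using that meet Y.nonempty_open_meets[OF assms(2)] by auto
  qed
qed

end

context bounded_pair
begin

lemma matched_clopen:
  assumes "matched W V P r L Y Z A B"
  shows "openin W A \<and> closedin W A \<and> openin V B \<and> closedin V B \<and> (A = {} \<longleftrightarrow> B = {}) \<and>
    (compactin W A \<longleftrightarrow> compactin V B)"
proof (cases "A \<in> compact_opens W \<and> B \<in> compact_opens V \<and> same_profile P r Y A Z B")
  case True
  then show ?thesis
    using empty_iff_same_profile[of A B] compact_opens_closedin[OF Y.Hausdorff] compact_opens_closedin[OF Z.Hausdorff]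
    by (auto simp: compact_opens_iff)
next
  case False
  then have *: "cocompact W A" "cocompact V B"
    using assms unfolding matched_def by blast+
  then have "\<not> compactin W A" "\<not> compactin V B"
    by (simp_all add: cocompact_def)
  moreover from this have "A \<noteq> {}" "B \<noteq> {}" by auto
  ultimately show ?thesis
    using cocompact_clopen[OF Y.Hausdorff *(1)] cocompact_clopen[OF Z.Hausdorff *(2)] by blast
qed

lemma matched_compact:
  assumes "matched W V P r L Y Z A B" "compactin W A"
  shows "A \<in> compact_opens W" "B \<in> compact_opens V" "same_profile P r Y A Z B"
  using assms unfolding matched_def cocompact_def by blast+

lemma matched_homeomorphism:
  assumes count: "countable (compact_opens W)" "countable (compact_opens V)"
    and AB: "matched W V P r L Y Z A B"
  shows "\<exists>h. homeomorphic_map (subtopology W A) (subtopology V B) h \<and>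
    (\<forall>C\<in>compact_opens W. C \<subseteq> A \<longrightarrow> h ` C \<in> compact_opens V \<and> same_profile P r Y C Z (h ` C))"
proof -
  interpret swap: bounded_pair V W P r Z Y L
    by (rule bounded_pair_swap)
  have "\<exists>h. homeomorphic_map (subtopology W A) (subtopology V B) h \<and>
    (\<forall>C\<in>compact_opens W. C \<subseteq> A \<longrightarrow> matched W V P r L Y Z C (h ` C))"
  proof (rule back_and_forth[OF Y.stone Z.stone count matched_clopen matched_split _ _ AB])
    fix A B D assume m: "matched W V P r L Y Z A B" and D: "D \<in> compact_opens V"
    obtain C where C: "C \<subseteq> A" "matched V W P r L Z Y (B \<inter> D) C" "matched V W P r L Z Y (B - D) (A - C)"
      using swap.matched_split[OF matched_sym[OF m] D] by metis
    show "\<exists>C\<subseteq>A. matched W V P r L Y Z C (B \<inter> D) \<and> matched W V P r L Y Z (A - C) (B - D)"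
      using C(1) matched_sym[OF C(2)] matched_sym[OF C(3)] by (intro exI[of _ C] conjI)
  next
    fix A B A' B' assume m: "matched W V P r L Y Z A B" "matched W V P r L Y Z A' B'"
      and c: "compactin W A" "compactin W A'" and "A \<inter> A' = {}" "B \<inter> B' = {}"
    then have "same_profile P r Y (A \<union> A') Z (B \<union> B')"
      using matched_compact(3)[OF m(1) c(1)] matched_compact(3)[OF m(2) c(2)] by (intro same_profile_Un)
    then show "matched W V P r L Y Z (A \<union> A') (B \<union> B')"
      using compact_opens_Un[OF matched_compact(1)[OF m(1) c(1)] matched_compact(1)[OF m(2) c(2)]]
        compact_opens_Un[OF matched_compact(2)[OF m(1) c(1)] matched_compact(2)[OF m(2) c(2)]]
      unfolding matched_def by (intro disjI1 conjI)
  qed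
  then obtain h where h: "homeomorphic_map (subtopology W A) (subtopology V B) h"
    and img: "\<And>C. C \<in> compact_opens W \<Longrightarrow> C \<subseteq> A \<Longrightarrow> matched W V P r L Y Z C (h ` C)"
    by blast
  have "h ` C \<in> compact_opens V \<and> same_profile P r Y C Z (h ` C)" if C: "C \<in> compact_opens W" "C \<subseteq> A" for C
  proof -
    have "compactin W C"
      using C(1) by (simp add: compact_opens_iff)
    then show ?thesis
      using matched_compact(2,3)[OF img[OF C]] by blast
  qed
  then show ?thesis
    using h by blast
qed

end

text \<open>The back-and-forth argument inside compact open sets. It applies to any two trim sets of the same index.\<close>

lemma compact_profile_homeomorphism:
  assumes "omega_stone_space W" "omega_stone_space V" "trim_partition W P r Y" "trim_partition V P r Z"
    and A: "A \<in> compact_opens W" and B: "B \<in> compact_opens V" and prof: "same_profile P r Y A Z B"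
  shows "\<exists>h. homeomorphic_map (subtopology W A) (subtopology V B) h"
proof -
  have stone: "stone_space W" "stone_space V"
    and count: "countable (compact_opens W)" "countable (compact_opens V)"
    using assms(1,2) by (simp_all add: omega_stone_space_def)
  interpret trim_partition_pair W V P r Y Z
    by unfold_locales (use stone assms in auto)
  interpret swap: trim_partition_pair V W P r Z Y
    by (rule trim_partition_pair_swap)
  define E where "E = (\<lambda>A B. A \<in> compact_opens W \<and> B \<in> compact_opens V \<and> same_profile P r Y A Z B)"
  have "\<exists>h. homeomorphic_map (subtopology W A) (subtopology V B) h \<and>
    (\<forall>C\<in>compact_opens W. C \<subseteq> A \<longrightarrow> E C (h ` C))"
  proof (rule back_and_forth[OF stone count])
    show "E A B"
      using A B prof by (simp add: E_def)
    fix A B assume AB: "E A B"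
    then have A: "A \<in> compact_opens W" and B: "B \<in> compact_opens V" and prof: "same_profile P r Y A Z B"
      by (simp_all add: E_def)
    show "openin W A \<and> closedin W A \<and> openin V B \<and> closedin V B \<and> (A = {} \<longleftrightarrow> B = {}) \<and>
      (compactin W A \<longleftrightarrow> compactin V B)"
      using A B empty_iff_same_profile[OF prof] compact_opens_closedin[OF Y.Hausdorff]
        compact_opens_closedin[OF Z.Hausdorff] by (auto simp: compact_opens_iff)
    show "\<exists>D\<subseteq>B. E (A \<inter> C) D \<and> E (A - C) (B - D)" if C: "C \<in> compact_opens W" for C
      using compact_split[OF A B prof C] compact_opens_Int[OF Y.Hausdorff A C]
        compact_opens_Diff[OF Y.Hausdorff A C] compact_opens_Diff[OF Z.Hausdorff B]
      unfolding E_def by blast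
    show "\<exists>C\<subseteq>A. E C (B \<inter> D) \<and> E (A - C) (B - D)" if D: "D \<in> compact_opens V" for D
      using swap.compact_split[OF B A same_profile_sym[OF prof] D] compact_opens_Int[OF Z.Hausdorff B D]
        compact_opens_Diff[OF Z.Hausdorff B D] compact_opens_Diff[OF Y.Hausdorff A] same_profile_sym
      unfolding E_def by metis
    show "E (A \<union> A') (B \<union> B')" if "E A' B'" "A \<inter> A' = {}" "B \<inter> B' = {}" for A' B'
      using that AB compact_opens_Un same_profile_Un unfolding E_def by metis
  qed
  then show ?thesis by blast
qed

lemma po_min_dI:
  assumes "extended_po P r L f" "p \<in> L" "\<And>q. q \<in> L \<Longrightarrow> (q, p) \<notin> r"
  shows "p \<in> po_min_d P r L"
  using assms unfolding po_min_d_def po_min_def po_d_def po_le_def extended_po_def lower_subset_def by blast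

lemma bounded_trimD:
  assumes "bounded_trim_partition_for W P r L f X"
  shows "stone_space W" "extended_po P r L f" "lower_subset P r L" "L \<subseteq> P" "trim_partition W P r X"
    and "\<And>p. p \<in> P \<Longrightarrow> compactin W (W closure_of X p) \<longleftrightarrow> p \<in> L"
    and "\<And>p. p \<in> po_min_d P r L \<Longrightarrow> card (X p) = f p"
    and "\<And>p. p \<in> po_min_d P r L \<Longrightarrow> f p > 0"
    and "compactin W (W closure_of (\<Union>p\<in>L. X p))"
    and "primitive_stone_space W"
  using assms unfolding bounded_trim_partition_for_def primitive_stone_space_def extended_po_def lower_subset_def
  by simp_all

text \<open>The union of all parts is dense, by the neighbourhood bases of trim sets.\<close>

lemma compact_iff_all_lower:
  assumes "bounded_trim_partition_for W P r L f X"
  shows "compactin W (topspace W) \<longleftrightarrow> L = P"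
proof
  interpret trim_partition_space W P r X
    using bounded_trimD[OF assms] by unfold_locales
  assume c: "compactin W (topspace W)"
  have "compactin W (W closure_of X p)" for p
    using closed_compactin[OF c] by (simp add: closure_of_subset_topspace)
  then show "L = P"
    using bounded_trimD(4,6)[OF assms] by blast
next
  interpret trim_partition_space W P r X
    using bounded_trimD[OF assms] by unfold_locales
  assume "L = P"
  then show "compactin W (topspace W)"
    using bounded_trimD(9)[OF assms] dense by simp
qed

text \<open>The two whole spaces are matched: an index in \<open>L\<close> with no element of \<open>L\<close> below it lies in \<open>L\<^sub>m\<^sub>i\<^sub>n\<^sup>d\<close>, so
  the size of its part is given by \<open>f\<close>.\<close>

theorem bounded_trim_partition_unique:
  assumes "omega_stone_space W" "omega_stone_space V"
    and Y: "bounded_trim_partition_for W P r L f Y" and Z: "bounded_trim_partition_for V P r L f Z"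
  shows "\<exists>h. homeomorphic_map W V h \<and> (\<forall>p\<in>P. h ` Y p = Z p)"
proof -
  have count: "countable (compact_opens W)" "countable (compact_opens V)"
    using assms(1,2) by (simp_all add: omega_stone_space_def)
  interpret bounded_pair W V P r Y Z L
    by unfold_locales (use bounded_trimD[OF Y] bounded_trimD[OF Z] in auto)
  have ext: "extended_po P r L f"
    using bounded_trimD(2)[OF Y] .
  have Ytop: "topspace W \<inter> Y p = Y p" and Ztop: "topspace V \<inter> Z p = Z p" if "p \<in> L" for p
    using Y.X_subset Z.X_subset that L_sub by blast+
  have prof: "same_profile L r Y (topspace W) Z (topspace V)"
    unfolding same_profile_def
  proof (intro conjI ballI impI)
    fix p assume p: "p \<in> L"
    show "topspace W \<inter> Y p = {} \<longleftrightarrow> topspace V \<inter> Z p = {}"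
      using Ytop[OF p] Ztop[OF p] Y.X_nonempty Z.X_nonempty p L_sub by auto
    assume min: "\<forall>q\<in>L. (q, p) \<in> r \<longrightarrow> topspace W \<inter> Y q = {}"
    have "(q, p) \<notin> r" if "q \<in> L" for q
      using min that Ytop[OF that] Y.X_nonempty L_sub by blast
    then have "p \<in> po_min_d P r L"
      using po_min_dI[OF ext p] by blast
    then have "card (Y p) = card (Z p)" "card (Y p) > 0"
      using bounded_trimD(7,8)[OF Y] bounded_trimD(7)[OF Z] by auto
    then show "topspace W \<inter> Y p \<approx> topspace V \<inter> Z p"
      unfolding Ytop[OF p] Ztop[OF p] using card_gt_0_iff eqpoll_iff_card by metis
  qed
  have "matched W V P r L Y Z (topspace W) (topspace V)"
  proof (cases "L = P")
    case True
    then show ?thesis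
      using prof compact_iff_all_lower[OF Y] compact_iff_all_lower[OF Z]
      by (simp add: matched_def compact_opens_iff)
  next
    case False
    then show ?thesis
      using prof compact_iff_all_lower[OF Y] compact_iff_all_lower[OF Z]
      by (simp add: matched_def cocompact_def)
  qed
  then obtain h where h: "homeomorphic_map W V h"
    and prof: "\<And>C. C \<in> compact_opens W \<Longrightarrow> same_profile P r Y C Z (h ` C)"
    using matched_homeomorphism[OF count] compact_opens_subset_topspace by (metis subtopology_topspace)
  then show ?thesis
    using homeomorphism_respects_parts by blast
qed

section \<open>Coarsening a partition along a morphism\<close>

text \<open>The condition that defines the order on extended PO systems, with the morphism made explicit.\<close>

definition covering_morphism ::
  "'j set \<Rightarrow> 'j rel \<Rightarrow> 'j set \<Rightarrow> ('j \<Rightarrow> nat) \<Rightarrow> 'i set \<Rightarrow> 'i rel \<Rightarrow> 'i set \<Rightarrow> ('i \<Rightarrow> nat) \<Rightarrow> ('j \<Rightarrow> 'i) \<Rightarrow> bool" where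
  "covering_morphism Q s M g P r L f \<alpha> \<longleftrightarrow> po_morphism Q s P r \<alpha> \<and> \<alpha> ` Q = P \<and>
     L = {p \<in> P. {q \<in> Q. \<alpha> q = p} \<subseteq> M} \<and>
     (\<forall>p\<in>po_min_d P r L. finite {q \<in> Q. \<alpha> q = p} \<and> f p = (\<Sum>q\<in>{q \<in> Q. \<alpha> q = p}. g q))"

lemma ext_po_below_iff:
  "ext_po_below (Q, s, M, g) (P, r, L, f) \<longleftrightarrow> (\<exists>\<alpha>. covering_morphism Q s M g P r L f \<alpha>)"
  by (simp add: ext_po_below_def covering_morphism_def)

lemma po_morphism_up:
  assumes "po_morphism Q s P r \<alpha>" "q \<in> Q" "(\<alpha> q, p) \<in> r" "p \<in> P"
  shows "\<exists>t\<in>Q. (q, t) \<in> s \<and> \<alpha> t = p"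
proof -
  have "p \<in> \<alpha> ` {t \<in> Q. (q, t) \<in> s}"
    using assms unfolding po_morphism_def by blast
  then show ?thesis by blast
qed

lemma po_morphism_mono:
  assumes "po_morphism Q s P r \<alpha>" "(q, t) \<in> s" "q \<in> Q" "t \<in> Q"
  shows "(\<alpha> q, \<alpha> t) \<in> r"
proof -
  have "\<alpha> t \<in> {p \<in> P. (\<alpha> q, p) \<in> r}"
    using assms unfolding po_morphism_def by blast
  then show ?thesis by blast
qed

text \<open>Something below \<open>q\<close> in \<open>s\<close> would be mapped to something below \<open>p\<close>. This is what makes sums over fibres compose.\<close>

lemma fibre_over_minimal:
  assumes "po_morphism Q s P r \<alpha>" "s \<subseteq> Q \<times> Q" "L = {p \<in> P. {q \<in> Q. \<alpha> q = p} \<subseteq> M}" "M \<subseteq> Q"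
    and lower: "lower_subset P r L" and p: "p \<in> po_min_d P r L" and q: "q \<in> Q" "\<alpha> q = p"
  shows "q \<in> po_min_d Q s M"
proof -
  have pL: "p \<in> L" "p \<in> P" "(p, p) \<notin> r" and min: "\<And>p'. p' \<in> L \<Longrightarrow> (p', p) \<in> r \<Longrightarrow> p' = p"
    using p unfolding po_min_d_def po_min_def po_d_def po_le_def by auto
  have no: "(t, q) \<notin> s" for t
  proof
    assume tq: "(t, q) \<in> s"
    then have "t \<in> Q" using assms(2) by blast
    then have "(\<alpha> t, p) \<in> r" "\<alpha> t \<in> P"
      using po_morphism_mono[OF assms(1) tq] q assms(1) unfolding po_morphism_def by auto
    then have "\<alpha> t \<in> L"
      using lower pL unfolding lower_subset_def po_down_def po_le_def by blast
    then show False
      using min \<open>(\<alpha> t, p) \<in> r\<close> pL(3) by metis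
  qed
  have "q \<in> M"
    using pL(1) q assms(3) by blast
  then show ?thesis
    using no assms(4) unfolding po_min_d_def po_min_def po_d_def po_le_def by blast
qed

text \<open>The unions of the parts over each fibre of \<open>\<alpha>\<close> need not form a trim partition. If \<open>(p, p) \<in> r\<close>, the fibre over
  \<open>p\<close> can contain an infinite strictly increasing sequence of indices, and a point outside all parts may have a
  neighbourhood base of trim sets with these indices. All these sets are \<open>p\<close>-trim with respect to the unions, so such
  a point has to be added to the part with index \<open>p\<close>.\<close>

definition coarsening :: "'w topology \<Rightarrow> 'j set \<Rightarrow> ('j \<Rightarrow> 'w set) \<Rightarrow> 'i set \<Rightarrow> 'i rel \<Rightarrow> ('j \<Rightarrow> 'i) \<Rightarrow> 'i \<Rightarrow> 'w set" where
  "coarsening W Q Y P r \<alpha> p = {w \<in> topspace W. \<forall>U. openin W U \<and> w \<in> U \<longrightarrow>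
     (\<exists>A\<in>trim_at W P r (\<lambda>p. \<Union>q\<in>{q \<in> Q. \<alpha> q = p}. Y q) p. w \<in> A \<and> A \<subseteq> U)}"

locale coarsened_partition =
  Y: trim_partition_space W Q s Y for W :: "'w topology" and Q :: "'j set" and s Y +
  fixes P :: "'i set" and r and \<alpha>
  assumes po_P: "po_system P r" and morph: "po_morphism Q s P r \<alpha>" and surj: "\<alpha> ` Q = P"
begin

definition "fibre_union p = (\<Union>q\<in>{q \<in> Q. \<alpha> q = p}. Y q)"
abbreviation "Z \<equiv> coarsening W Q Y P r \<alpha>"

lemma Z_def: "Z p = {w \<in> topspace W. \<forall>U. openin W U \<and> w \<in> U \<longrightarrow> (\<exists>A\<in>trim_at W P r fibre_union p. w \<in> A \<and> A \<subseteq> U)}"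
  unfolding coarsening_def fibre_union_def[abs_def] ..

lemma r_anti: "(p, q) \<in> r \<Longrightarrow> (q, p) \<in> r \<Longrightarrow> p = q"
  using po_P unfolding po_system_def by (meson antisymD)

lemma \<alpha>_in: "q \<in> Q \<Longrightarrow> \<alpha> q \<in> P"
  using surj by blast

text \<open>A morphism maps the upper set of \<open>q\<close> onto the upper set of \<open>\<alpha> q\<close>. If \<open>(\<alpha> q, \<alpha> q) \<notin> r\<close>, no
  other element above \<open>q\<close> is mapped to \<open>\<alpha> q\<close>.\<close>

lemma trim_at_pushforward:
  assumes q: "q \<in> Q" and A: "A \<in> trim_at W Q s Y q"
  shows "A \<in> trim_at W P r fibre_union (\<alpha> q)"
  unfolding trim_at_iff
proof (intro conjI ballI impI)
  show "A \<in> compact_opens W"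
    using trim_atD(1)[OF A] .
  fix p assume p: "p \<in> P"
  have "A \<inter> fibre_union p \<noteq> {} \<longleftrightarrow> (\<exists>t\<in>Q. \<alpha> t = p \<and> A \<inter> Y t \<noteq> {})"
    unfolding fibre_union_def by blast
  also have "\<dots> \<longleftrightarrow> (\<exists>t\<in>Q. \<alpha> t = p \<and> (q = t \<or> (q, t) \<in> s))"
    using trim_atD(2)[OF A] by blast
  also have "\<dots> \<longleftrightarrow> \<alpha> q = p \<or> (\<alpha> q, p) \<in> r"
    using po_morphism_up[OF morph q _ p] po_morphism_mono[OF morph _ q] q by blast
  finally show "A \<inter> fibre_union p \<noteq> {} \<longleftrightarrow> \<alpha> q = p \<or> (\<alpha> q, p) \<in> r" .
next
  assume irr: "(\<alpha> q, \<alpha> q) \<notin> r"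
  have "A \<inter> fibre_union (\<alpha> q) = A \<inter> Y q"
  proof
    show "A \<inter> Y q \<subseteq> A \<inter> fibre_union (\<alpha> q)"
      unfolding fibre_union_def using q by blast
    show "A \<inter> fibre_union (\<alpha> q) \<subseteq> A \<inter> Y q"
    proof
      fix x assume "x \<in> A \<inter> fibre_union (\<alpha> q)"
      then obtain t where t: "t \<in> Q" "\<alpha> t = \<alpha> q" "x \<in> A" "x \<in> Y t"
        unfolding fibre_union_def by blast
      then have "q = t \<or> (q, t) \<in> s"
        using trim_atD(2)[OF A t(1)] by blast
      then have "q = t"
        using po_morphism_mono[OF morph _ q t(1)] t(2) irr by auto
      then show "x \<in> A \<inter> Y q" using t by blast
    qed
  qed
  moreover have "(q, q) \<notin> s"
    using po_morphism_mono[OF morph _ q q] irr by blast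
  ultimately show "card (A \<inter> fibre_union (\<alpha> q)) = 1"
    using trim_atD(3)[OF A q] by simp
qed

lemma fibre_union_subset_Z:
  assumes "p \<in> P" shows "fibre_union p \<subseteq> Z p"
proof
  fix w assume "w \<in> fibre_union p"
  then obtain q where q: "q \<in> Q" "\<alpha> q = p" "w \<in> Y q"
    unfolding fibre_union_def by blast
  have "\<exists>A\<in>trim_at W P r fibre_union p. w \<in> A \<and> A \<subseteq> U" if U: "openin W U" "w \<in> U" for U
  proof -
    obtain A where "A \<in> trim_at W Q s Y q" "w \<in> A" "A \<subseteq> U"
      using Y.trim_nbhd[OF q(1,3) U] by blast
    then show ?thesis
      using trim_at_pushforward[OF q(1)] q(2) by blast
  qed
  moreover have "w \<in> topspace W"
    using Y.X_subset[OF q(1)] q(3) by blast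
  ultimately show "w \<in> Z p"
    unfolding Z_def by blast
qed

lemma open_meets_Z_iff:
  assumes "p \<in> P" "openin W U"
  shows "U \<inter> Z p \<noteq> {} \<longleftrightarrow> U \<inter> fibre_union p \<noteq> {}"
proof
  assume "U \<inter> Z p \<noteq> {}"
  then obtain w where "w \<in> U" "w \<in> Z p" by blast
  then obtain A where "A \<in> trim_at W P r fibre_union p" "A \<subseteq> U"
    unfolding Z_def using assms(2) by blast
  then show "U \<inter> fibre_union p \<noteq> {}"
    using trim_atD(2)[of A W P r fibre_union p p] assms(1) by blast
qed (use fibre_union_subset_Z[OF assms(1)] in blast)

text \<open>If \<open>(p, p) \<notin> r\<close>, the fibre over \<open>p\<close> is an antichain. The trim sets of the original partition in a
  neighbourhood base of a point of \<open>Z p\<close> then have constant index, so the point already belongs to a part.\<close>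

lemma Z_eq_fibre_union_if_discrete:
  assumes p: "p \<in> P" "(p, p) \<notin> r"
  shows "Z p = fibre_union p"
proof
  show "Z p \<subseteq> fibre_union p"
  proof
    fix w assume "w \<in> Z p"
    then have w: "w \<in> topspace W" and base: "\<And>U. openin W U \<Longrightarrow> w \<in> U \<Longrightarrow> \<exists>A\<in>trim_at W P r fibre_union p. w \<in> A \<and> A \<subseteq> U"
      unfolding Z_def by blast+
    have type: "\<alpha> q = p" if q: "q \<in> Q" "B \<in> trim_at W Q s Y q" "w \<in> B" "B \<subseteq> A" "A \<in> trim_at W P r fibre_union p" for q A B
    proof -
      have BP: "B \<in> trim_at W P r fibre_union (\<alpha> q)"
        using trim_at_pushforward[OF q(1,2)] .
      have "openin W B"
        using trim_at_openin[OF BP] .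
      then obtain C where C: "C \<in> trim_at W P r fibre_union p" "C \<subseteq> B"
        using base q(3) by blast
      have "C \<inter> fibre_union p \<noteq> {}"
        using trim_atD(2)[OF C(1) p(1)] by blast
      then have "\<alpha> q = p \<or> (\<alpha> q, p) \<in> r"
        using trim_atD(2)[OF BP p(1)] C(2) by blast
      moreover have "B \<inter> fibre_union (\<alpha> q) \<noteq> {}"
        using trim_atD(2)[OF BP \<alpha>_in[OF q(1)]] by blast
      then have "p = \<alpha> q \<or> (p, \<alpha> q) \<in> r"
        using trim_atD(2)[OF q(5) \<alpha>_in[OF q(1)]] q(4) by blast
      ultimately show ?thesis
        using r_anti by blast
    qed
    obtain A where A: "A \<in> trim_at W P r fibre_union p" "w \<in> A"
      using base[OF openin_topspace w] by blast
    have "openin W A"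
      using trim_at_openin[OF A(1)] .
    then obtain q B where q: "q \<in> Q" "B \<in> trim_at W Q s Y q" "w \<in> B" "B \<subseteq> A"
      using Y.trim_base[OF w _ A(2)] by blast
    have qp: "\<alpha> q = p"
      using type[OF q A(1)] .
    have oB: "openin W B"
      using trim_at_openin[OF q(2)] .
    have "w \<in> Y q"
    proof (rule Y.in_X_if_trim_base[OF q(1) w])
      fix U assume U: "openin W U" "w \<in> U"
      then obtain t C where t: "t \<in> Q" "C \<in> trim_at W Q s Y t" "w \<in> C" "C \<subseteq> U \<inter> B"
        using Y.trim_base[OF w, of "U \<inter> B"] oB q(3) by blast
      have "\<alpha> t = p"
        using type[OF t(1-3) _ A(1)] t(4) q(4) by blast
      have "C \<inter> Y t \<noteq> {}"
        using trim_atD(2)[OF t(2,1)] by blast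
      then have "q = t \<or> (q, t) \<in> s"
        using trim_atD(2)[OF q(2) t(1)] t(4) by blast
      then have "q = t"
        using po_morphism_mono[OF morph _ q(1) t(1)] \<open>\<alpha> t = p\<close> qp p(2) by auto
      then show "\<exists>A\<in>trim_at W Q s Y q. w \<in> A \<and> A \<subseteq> U"
        using t by blast
    qed
    then show "w \<in> fibre_union p"
      unfolding fibre_union_def using q(1) qp by blast
  qed
qed (rule fibre_union_subset_Z[OF p(1)])

lemma trim_at_Z_eq:
  assumes p: "p \<in> P"
  shows "trim_at W P r Z p = trim_at W P r fibre_union p"
proof (rule Set.set_eqI)
  fix A
  show "A \<in> trim_at W P r Z p \<longleftrightarrow> A \<in> trim_at W P r fibre_union p"
  proof (cases "A \<in> compact_opens W")
    case True
    then have "A \<inter> Z q \<noteq> {} \<longleftrightarrow> A \<inter> fibre_union q \<noteq> {}" if "q \<in> P" for q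
      using open_meets_Z_iff[OF that] by (simp add: compact_opens_iff)
    then have meet: "(\<forall>q\<in>P. A \<inter> Z q \<noteq> {} \<longleftrightarrow> p = q \<or> (p, q) \<in> r) \<longleftrightarrow>
        (\<forall>q\<in>P. A \<inter> fibre_union q \<noteq> {} \<longleftrightarrow> p = q \<or> (p, q) \<in> r)"
      by (intro ball_cong) auto
    show ?thesis
    proof (cases "(p, p) \<in> r")
      case True
      then show ?thesis
        by (simp only: trim_at_iff meet simp_thms)
    next
      case False
      then show ?thesis
        by (simp only: trim_at_iff meet Z_eq_fibre_union_if_discrete[OF p False] simp_thms)
    qed
  next
    case False
    then show ?thesis using trim_atD(1) by metis
  qed
qed

lemma Z_trim_nbhd:
  assumes "p \<in> P" "w \<in> Z p" "openin W U" "w \<in> U"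
  shows "\<exists>A\<in>trim_at W P r Z p. w \<in> A \<and> A \<subseteq> U"
  using assms unfolding trim_at_Z_eq[OF assms(1)] by (simp add: Z_def)

lemma Z_disjoint:
  assumes "p \<in> P" "q \<in> P" "w \<in> Z p" "w \<in> Z q"
  shows "p = q"
proof -
  have *: "p = q \<or> (p, q) \<in> r" if pq: "p \<in> P" "q \<in> P" "w \<in> Z p" "w \<in> Z q" for p q
  proof -
    have "w \<in> topspace W"
      using pq(3) unfolding Z_def by blast
    then obtain A where "A \<in> trim_at W P r Z p" "w \<in> A"
      using Z_trim_nbhd[OF pq(1,3) openin_topspace] by blast
    then show ?thesis
      using trim_atD(2)[of A W P r Z p q] pq by blast
  qed
  show ?thesis
    using *[OF assms] *[OF assms(2,1,4,3)] r_anti by blast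
qed

text \<open>Up: in a trim neighbourhood of \<open>x\<close> all indices are \<open>\<ge> q\<close>. Down: the morphism property lifts \<open>(q, p) \<in> r\<close>
  to the original partition, where a part accumulates at every point of a part below it.\<close>

lemma Z_derived:
  assumes p: "p \<in> P" and q: "q \<in> P" and x: "x \<in> Z q"
  shows "x \<in> W derived_set_of Z p \<longleftrightarrow> (q, p) \<in> r"
proof
  have xtop: "x \<in> topspace W"
    using x unfolding Z_def by blast
  show "(q, p) \<in> r" if lim: "x \<in> W derived_set_of Z p"
  proof -
    obtain A where A: "A \<in> trim_at W P r Z q" "x \<in> A"
      using Z_trim_nbhd[OF q x openin_topspace xtop] by blast
    have "openin W A"
      using trim_at_openin[OF A(1)] .
    then obtain y where y: "y \<noteq> x" "y \<in> Z p" "y \<in> A"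
      using lim A(2) unfolding derived_set_of_def by blast
    then have "q = p \<or> (q, p) \<in> r"
      using trim_atD(2)[OF A(1) p] by blast
    moreover have "(q, p) \<in> r" if "q = p"
    proof (rule ccontr)
      assume "(q, p) \<notin> r"
      then have "card (A \<inter> Z p) = 1"
        using trim_atD(3)[OF A(1) q] that by simp
      then obtain z where "A \<inter> Z p = {z}"
        by (meson card_1_singletonE)
      moreover have "y \<in> A \<inter> Z p" "x \<in> A \<inter> Z p"
        using y x A(2) that by auto
      ultimately show False using y(1) by auto
    qed
    ultimately show ?thesis by blast
  qed
  show "x \<in> W derived_set_of Z p" if qp: "(q, p) \<in> r"
    unfolding derived_set_of_def
  proof (intro CollectI conjI allI impI)
    fix T assume T: "x \<in> T \<and> openin W T"
    then have "T \<inter> fibre_union q \<noteq> {}"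
      using open_meets_Z_iff[OF q] x by blast
    then obtain t y where t: "t \<in> Q" "\<alpha> t = q" "y \<in> T" "y \<in> Y t"
      unfolding fibre_union_def by blast
    obtain t' where t': "t' \<in> Q" "(t, t') \<in> s" "\<alpha> t' = p"
      using po_morphism_up[OF morph t(1) _ p] qp t(2) by blast
    have "infinite (T \<inter> Y t')"
      using Y.infinite_above[OF t'(1) t(1,4) t'(2)] T t(3) by blast
    \<comment> \<open>infinitely many points, because \<open>x\<close> itself may lie in \<open>Y t'\<close>\<close>
    then have "infinite (T \<inter> Y t' - {x})"
      by simp
    then obtain z where "z \<in> T \<inter> Y t' - {x}"
      using infinite_imp_nonempty by blast
    moreover have "Y t' \<subseteq> Z p"
      using fibre_union_subset_Z[OF p] t'(1,3) unfolding fibre_union_def by blast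
    ultimately show "\<exists>y. y \<noteq> x \<and> y \<in> Z p \<and> y \<in> T" by blast
  qed (rule xtop)
qed

lemma Z_trim_partition: "trim_partition W P r Z"
proof -
  have "Z p \<subseteq> topspace W" for p
    unfolding Z_def by blast
  moreover have "Z p \<noteq> {}" if p: "p \<in> P" for p
  proof -
    obtain q where "q \<in> Q" "\<alpha> q = p"
      using surj p by blast
    then show ?thesis
      using fibre_union_subset_Z[OF p] Y.X_nonempty[of q] unfolding fibre_union_def by blast
  qed
  moreover have "disjoint_family_on Z P"
    using Z_disjoint unfolding disjoint_family_on_def by blast
  moreover have "(W derived_set_of Z p) \<inter> (\<Union>q\<in>P. Z q) = (\<Union>q\<in>{q \<in> P. (q, p) \<in> r}. Z q)" if "p \<in> P" for p
    using Z_derived[OF that] by blast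
  ultimately have part: "po_partition W P r Z"
    unfolding po_partition_def using po_P by blast
  have o: "openin W A" if "A \<in> trim_at W P r Z p" for A p
    using trim_at_openin[OF that] .
  have "neighbourhood_base_at w (trim_set W P r Z) W" if w: "w \<in> topspace W" for w
  proof (subst neighbourhood_base_at_open[OF trim_set_openin], assumption, intro allI impI)
    fix U assume "openin W U \<and> w \<in> U"
    then obtain q A where "q \<in> Q" "A \<in> trim_at W Q s Y q" "w \<in> A" "A \<subseteq> U"
      using Y.trim_base[OF w] by blast
    then show "\<exists>A. trim_set W P r Z A \<and> w \<in> A \<and> A \<subseteq> U"
      using trim_at_pushforward[of q A] trim_at_Z_eq[OF \<alpha>_in] \<alpha>_in unfolding trim_set_def by blast
  qed
  moreover have "w \<in> Z p" if p: "p \<in> trim_indices W P r Z" and w: "w \<in> topspace W"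
    and nb: "neighbourhood_base_at w (\<lambda>A. A \<in> trim_at W P r Z p) W" for p w
  proof -
    have p: "p \<in> P" using p by (simp add: trim_indices_def)
    have "\<forall>U. openin W U \<and> w \<in> U \<longrightarrow> (\<exists>A. A \<in> trim_at W P r Z p \<and> w \<in> A \<and> A \<subseteq> U)"
      using nb by (subst (asm) neighbourhood_base_at_open) (auto dest: o)
    then show ?thesis
      unfolding Z_def trim_at_Z_eq[OF p] using w by blast
  qed
  moreover have "\<exists>A\<in>trim_at W P r Z p. w \<in> A" if "p \<in> P" "w \<in> Z p" for p w
  proof -
    have "w \<in> topspace W" using that(2) unfolding Z_def by blast
    then show ?thesis
      using Z_trim_nbhd[OF that openin_topspace] by blast
  qed
  ultimately show ?thesis
    unfolding trim_partition_def using part by blast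
qed

lemma Z_subset_closure:
  assumes "p \<in> P" shows "Z p \<subseteq> W closure_of fibre_union p"
proof
  fix w assume w: "w \<in> Z p"
  then have "w \<in> topspace W" unfolding Z_def by blast
  moreover have "\<exists>y. y \<in> fibre_union p \<and> y \<in> T" if "w \<in> T" "openin W T" for T
    using open_meets_Z_iff[OF assms that(2)] w that(1) by blast
  ultimately show "w \<in> W closure_of fibre_union p"
    unfolding closure_of_def by blast
qed

lemma refines_Z: "regularly_refines_via W Q Y P r Z \<alpha>"
  unfolding regularly_refines_via_def
proof (intro conjI ballI)
  show "\<alpha> ` Q \<subseteq> P" using surj by blast
  show "Y q \<subseteq> Z (\<alpha> q)" if "q \<in> Q" for q
    using fibre_union_subset_Z[OF \<alpha>_in[OF that]] that unfolding fibre_union_def by blast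
  fix p A assume p: "p \<in> trim_indices W P r Z" and A: "A \<in> trim_at W P r Z p"
  have p: "p \<in> P" using p by (simp add: trim_indices_def)
  have "A \<inter> fibre_union p \<noteq> {}"
    using A trim_atD(2)[of A W P r fibre_union p p] p trim_at_Z_eq[OF p] by blast
  then show "p \<in> \<alpha> ` type_set Q Y A"
    unfolding fibre_union_def type_set_def by blast
qed

end

text \<open>Relabelling is a special case of coarsening, and then no points are added.\<close>

lemma (in coarsened_partition) coarsening_along_iso:
  assumes iso: "po_iso Q s P r \<alpha>" and q: "q \<in> Q"
  shows "Z (\<alpha> q) = Y q"
proof
  have inj: "\<And>q t. q \<in> Q \<Longrightarrow> t \<in> Q \<Longrightarrow> \<alpha> q = \<alpha> t \<Longrightarrow> q = t"
    and rel: "\<And>q t. q \<in> Q \<Longrightarrow> t \<in> Q \<Longrightarrow> (q, t) \<in> s \<longleftrightarrow> (\<alpha> q, \<alpha> t) \<in> r"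
    using iso by (auto simp: po_iso_def bij_betw_def inj_on_def)
  have fibre_union_eq: "fibre_union (\<alpha> t) = Y t" if "t \<in> Q" for t
    unfolding fibre_union_def using inj[OF _ that] that by blast
  show "Y q \<subseteq> Z (\<alpha> q)"
    using fibre_union_subset_Z[OF \<alpha>_in[OF q]] fibre_union_eq[OF q] by simp
  have trim: "A \<in> trim_at W Q s Y q" if A: "A \<in> trim_at W P r fibre_union (\<alpha> q)" for A
    unfolding trim_at_iff
  proof (intro conjI ballI impI)
    show "A \<in> compact_opens W" using trim_atD(1)[OF A] .
    show "A \<inter> Y t \<noteq> {} \<longleftrightarrow> q = t \<or> (q, t) \<in> s" if t: "t \<in> Q" for t
      using trim_atD(2)[OF A \<alpha>_in[OF t]] fibre_union_eq[OF t] inj[OF q t] rel[OF q t] by auto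
    show "card (A \<inter> Y q) = 1" if "(q, q) \<notin> s"
      using trim_atD(3)[OF A \<alpha>_in[OF q]] fibre_union_eq[OF q] rel[OF q q] that by auto
  qed
  show "Z (\<alpha> q) \<subseteq> Y q"
  proof
    fix w assume w: "w \<in> Z (\<alpha> q)"
    show "w \<in> Y q"
    proof (rule Y.in_X_if_trim_base[OF q])
      show "w \<in> topspace W" using w unfolding Z_def by blast
      show "\<exists>A\<in>trim_at W Q s Y q. w \<in> A \<and> A \<subseteq> U" if U: "openin W U" "w \<in> U" for U
      proof -
        obtain A where "A \<in> trim_at W P r fibre_union (\<alpha> q)" "w \<in> A" "A \<subseteq> U"
          using w U unfolding Z_def by blast
        then show ?thesis using trim by blast
      qed
    qed
  qed
qed

text \<open>Since \<open>Z p\<close> lies between the union over the fibre and its closure, compactness of closures can be tested on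
  the parts of the original partition.\<close>

lemma coarsening_bounded:
  assumes Y: "bounded_trim_partition_for W Q s M g Y"
    and over: "covering_morphism Q s M g P r L f \<alpha>" and ext: "extended_po P r L f"
  shows "bounded_trim_partition_for W P r L f (coarsening W Q Y P r \<alpha>)"
    and "regularly_refines_via W Q Y P r (coarsening W Q Y P r \<alpha>) \<alpha>"
proof -
  have ov: "po_morphism Q s P r \<alpha>" "\<alpha> ` Q = P" "L = {p \<in> P. {q \<in> Q. \<alpha> q = p} \<subseteq> M}"
    "\<And>p. p \<in> po_min_d P r L \<Longrightarrow> finite {q \<in> Q. \<alpha> q = p} \<and> f p = (\<Sum>q\<in>{q \<in> Q. \<alpha> q = p}. g q)"
    using over by (simp_all add: covering_morphism_def)
  interpret coarsened_partition W Q s Y P r \<alpha>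
    by unfold_locales (use bounded_trimD[OF Y] ext ov in \<open>auto simp: extended_po_def\<close>)
  show "regularly_refines_via W Q Y P r Z \<alpha>"
    by (rule refines_Z)
  have M: "compactin W (W closure_of (\<Union>q\<in>M. Y q))" "M \<subseteq> Q"
    using bounded_trimD[OF Y] by blast+
  have fibre_union_M: "fibre_union p \<subseteq> (\<Union>q\<in>M. Y q)" if "p \<in> L" for p
    using that ov(3) unfolding fibre_union_def by blast
  have sub: "Z p \<subseteq> W closure_of (\<Union>q\<in>M. Y q)" if "p \<in> L" for p
    using Z_subset_closure[of p] closure_of_mono[OF fibre_union_M[OF that]] that ov(3) by blast
  have cpt: "compactin W (W closure_of Z p) \<longleftrightarrow> p \<in> L" if p: "p \<in> P" for p
  proof
    show "compactin W (W closure_of Z p)" if "p \<in> L"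
      using compact_closure_mono[OF M(1) sub[OF that]] .
    show "p \<in> L" if c: "compactin W (W closure_of Z p)"
    proof (rule ccontr)
      assume "p \<notin> L"
      then obtain q where q: "q \<in> Q" "\<alpha> q = p" "q \<notin> M"
        using ov(3) p by blast
      have "Y q \<subseteq> W closure_of Z p"
        using fibre_union_subset_Z[OF p] closure_of_subset[of "Z p" W] q(1,2) unfolding Z_def fibre_union_def by blast
      then have "compactin W (W closure_of Y q)"
        using compact_closure_mono[OF c] by blast
      then show False
        using bounded_trimD(6)[OF Y q(1)] q(3) by blast
    qed
  qed
  have card: "card (Z p) = f p" if p: "p \<in> po_min_d P r L" for p
  proof -
    have pP: "p \<in> P" "(p, p) \<notin> r"
      using p by (auto simp: po_min_d_def po_d_def)
    have g: "card (Y q) = g q" "g q > 0" if "q \<in> Q" "\<alpha> q = p" for q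
      using fibre_over_minimal[OF ov(1) Y.po(1) ov(3) M(2) _ p that] ext
        bounded_trimD(7,8)[OF Y] by (auto simp: extended_po_def)
    have "card (fibre_union p) = (\<Sum>q\<in>{q \<in> Q. \<alpha> q = p}. card (Y q))"
      unfolding fibre_union_def
    proof (rule card_UN_disjoint)
      show "\<forall>q\<in>{q \<in> Q. \<alpha> q = p}. finite (Y q)"
        using g by (auto intro: card_ge_0_finite)
      show "\<forall>q\<in>{q \<in> Q. \<alpha> q = p}. \<forall>t\<in>{q \<in> Q. \<alpha> q = p}. q \<noteq> t \<longrightarrow> Y q \<inter> Y t = {}"
        using Y.X_disjoint by blast
    qed (use ov(4)[OF p] in blast)
    also have "\<dots> = f p"
      using ov(4)[OF p] g(1) by simp
    finally show ?thesis
      using Z_eq_fibre_union_if_discrete[OF pP] by simp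
  qed
  have "compactin W (W closure_of (\<Union>p\<in>L. Z p))"
    using sub by (intro compact_closure_mono[OF M(1)]) blast
  then show "bounded_trim_partition_for W P r L f Z"
    unfolding bounded_trim_partition_for_def
    using bounded_trimD(10)[OF Y] ext Z_trim_partition cpt card by blast
qed

section \<open>From regular refinements to morphisms\<close>

text \<open>Each property of \<open>\<alpha>\<close> is read off from points: \<open>\<alpha>\<close> is onto because every \<open>p\<close>-trim set contains a point of
  some \<open>Y q\<close> with \<open>\<alpha> q = p\<close>, monotone by comparing derived sets, and lifts relations because the points of \<open>Z p\<close> near a point
  of \<open>Y q\<close> have trim neighbourhoods that meet a part over \<open>p\<close>. For the same reason \<open>Z p\<close> lies in the closure of
  the parts over \<open>p\<close>, which gives the statements about \<open>L\<close> and \<open>f\<close>.\<close>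

lemma covering_morphism_if_refines:
  assumes Y: "bounded_trim_partition_for W Q s M g Y" and Z: "bounded_trim_partition_for W P r L f Z"
    and ref: "regularly_refines_via W Q Y P r Z \<alpha>"
  shows "covering_morphism Q s M g P r L f \<alpha>"
proof -
  interpret Y: trim_partition_space W Q s Y
    using bounded_trimD[OF Y] by unfold_locales
  interpret Z: trim_partition_space W P r Z
    using bounded_trimD[OF Z] by unfold_locales
  have \<alpha>P: "\<alpha> q \<in> P" and YZ: "Y q \<subseteq> Z (\<alpha> q)" if "q \<in> Q" for q
    using ref that unfolding regularly_refines_via_def by blast+
  have trimZ: "\<exists>q\<in>Q. \<alpha> q = p \<and> A \<inter> Y q \<noteq> {}" if "p \<in> P" "A \<in> trim_at W P r Z p" for p A
  proof -
    have "p \<in> trim_indices W P r Z"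
      using that unfolding trim_indices_def by blast
    then have "p \<in> \<alpha> ` type_set Q Y A"
      using ref that(2) unfolding regularly_refines_via_def by blast
    then show ?thesis
      unfolding type_set_def by blast
  qed
  have surj: "\<alpha> ` Q = P"
  proof
    show "P \<subseteq> \<alpha> ` Q"
    proof
      fix p assume p: "p \<in> P"
      then obtain z where z: "z \<in> Z p" "z \<in> topspace W"
        using Z.X_nonempty Z.X_subset by blast
      then obtain A where "A \<in> trim_at W P r Z p"
        using Z.trim_nbhd[OF p z(1) openin_topspace] by blast
      then show "p \<in> \<alpha> ` Q"
        using trimZ[OF p] by blast
    qed
  qed (use \<alpha>P in blast)
  have up: "(\<alpha> q, \<alpha> t) \<in> r" if qt: "q \<in> Q" "t \<in> Q" "(q, t) \<in> s" for q t
  proof -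
    obtain y where y: "y \<in> Y q"
      using Y.X_nonempty[OF qt(1)] by blast
    then have "y \<in> W derived_set_of Y t"
      using Y.derived[OF qt(2,1) y] qt(3) by blast
    then have "y \<in> W derived_set_of Z (\<alpha> t)"
      using derived_set_of_mono[OF YZ[OF qt(2)]] by blast
    then show ?thesis
      using Z.derived[OF \<alpha>P[OF qt(2)] \<alpha>P[OF qt(1)]] YZ[OF qt(1)] y by blast
  qed
  have lift: "\<exists>t\<in>Q. (q, t) \<in> s \<and> \<alpha> t = p" if q: "q \<in> Q" and p: "p \<in> P" and qp: "(\<alpha> q, p) \<in> r" for q p
  proof -
    obtain y where y: "y \<in> Y q" "y \<in> topspace W"
      using Y.X_nonempty[OF q] Y.X_subset[OF q] by blast
    obtain A where A: "A \<in> trim_at W Q s Y q" "y \<in> A"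
      using Y.trim_nbhd[OF q y(1) openin_topspace y(2)] by blast
    have oA: "openin W A"
      using trim_at_openin[OF A(1)] .
    have "infinite (A \<inter> Z p)"
      using Z.infinite_above[OF p \<alpha>P[OF q] _ qp oA A(2)] YZ[OF q] y(1) by blast
    then have "infinite (A \<inter> Z p - {y})" by simp
    then obtain z where z: "z \<in> A" "z \<in> Z p" "z \<noteq> y"
      using infinite_imp_nonempty by blast
    \<comment> \<open>removing \<open>y\<close> matters if \<open>\<alpha> q = p\<close>: the lifted element has to be strictly above \<open>q\<close> in the sense of \<open>s\<close>\<close>
    have "openin W (A - {y})"
      using oA Z.finite_closedin[of "{y}"] y(2) by (intro openin_diff) auto
    then obtain B where B: "B \<in> trim_at W P r Z p" "B \<subseteq> A - {y}"
      using Z.trim_nbhd[OF p z(2)] z by blast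
    obtain t x where t: "t \<in> Q" "\<alpha> t = p" "x \<in> B" "x \<in> Y t"
      using trimZ[OF p B(1)] by blast
    then have "q = t \<or> (q, t) \<in> s"
      using trim_atD(2)[OF A(1) t(1)] B(2) by blast
    moreover have "(q, t) \<in> s" if "q = t"
    proof (rule ccontr)
      assume "(q, t) \<notin> s"
      then have "card (A \<inter> Y q) = 1"
        using trim_atD(3)[OF A(1) q] that by simp
      then obtain a where "A \<inter> Y q = {a}"
        by (meson card_1_singletonE)
      moreover have "x \<in> A \<inter> Y q" "y \<in> A \<inter> Y q" "x \<noteq> y"
        using t B(2) y A(2) that by auto
      ultimately show False by auto
    qed
    ultimately show ?thesis
      using t by blast
  qed
  have morph: "po_morphism Q s P r \<alpha>"
    unfolding po_morphism_def
  proof (intro conjI ballI)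
    show "\<alpha> ` Q \<subseteq> P" using surj by simp
    show "\<alpha> ` {t \<in> Q. (q, t) \<in> s} = {p \<in> P. (\<alpha> q, p) \<in> r}" if q: "q \<in> Q" for q
    proof
      show "\<alpha> ` {t \<in> Q. (q, t) \<in> s} \<subseteq> {p \<in> P. (\<alpha> q, p) \<in> r}"
        using up[OF q] \<alpha>P by blast
      show "{p \<in> P. (\<alpha> q, p) \<in> r} \<subseteq> \<alpha> ` {t \<in> Q. (q, t) \<in> s}"
        using lift[OF q] by blast
    qed
  qed
  have L: "L = {p \<in> P. {q \<in> Q. \<alpha> q = p} \<subseteq> M}"
  proof (intro Set.set_eqI iffI)
    fix p assume p: "p \<in> L"
    then have pP: "p \<in> P" using bounded_trimD(4)[OF Z] by blast
    have c: "compactin W (W closure_of Z p)"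
      using bounded_trimD(6)[OF Z pP] p by blast
    have "q \<in> M" if q: "q \<in> Q" "\<alpha> q = p" for q
    proof -
      have "Y q \<subseteq> W closure_of Z p"
        using YZ[OF q(1)] q(2) closure_of_subset[OF Z.X_subset[OF pP]] by blast
      then show ?thesis
        using compact_closure_mono[OF c] bounded_trimD(6)[OF Y q(1)] by blast
    qed
    then show "p \<in> {p \<in> P. {q \<in> Q. \<alpha> q = p} \<subseteq> M}"
      using pP by blast
  next
    fix p assume "p \<in> {p \<in> P. {q \<in> Q. \<alpha> q = p} \<subseteq> M}"
    then have p: "p \<in> P" "\<And>q. q \<in> Q \<Longrightarrow> \<alpha> q = p \<Longrightarrow> q \<in> M" by auto
    have "Z p \<subseteq> W closure_of (\<Union>q\<in>M. Y q)"
    proof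
      fix z assume z: "z \<in> Z p"
      have "\<exists>y. y \<in> (\<Union>q\<in>M. Y q) \<and> y \<in> T" if T: "z \<in> T" "openin W T" for T
      proof -
        obtain A where A: "A \<in> trim_at W P r Z p" "A \<subseteq> T"
          using Z.trim_nbhd[OF p(1) z T(2,1)] by blast
        show ?thesis
          using trimZ[OF p(1) A(1)] p(2) A(2) by blast
      qed
      then show "z \<in> W closure_of (\<Union>q\<in>M. Y q)"
        unfolding closure_of_def using z Z.X_subset[OF p(1)] by blast
    qed
    then show "p \<in> L"
      using compact_closure_mono[OF bounded_trimD(9)[OF Y]]
        bounded_trimD(6)[OF Z p(1)] by blast
  qed
  have "finite {q \<in> Q. \<alpha> q = p} \<and> f p = (\<Sum>q\<in>{q \<in> Q. \<alpha> q = p}. g q)" if p: "p \<in> po_min_d P r L" for p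
  proof -
    have pP: "p \<in> P" "(p, p) \<notin> r"
      using p by (auto simp: po_min_d_def po_d_def)
    let ?F = "{q \<in> Q. \<alpha> q = p}"
    have fin: "finite (Z p)"
      using bounded_trimD(7,8)[OF Z p] by (auto intro: card_ge_0_finite)
    have g: "card (Y q) = g q" if "q \<in> ?F" for q
      using fibre_over_minimal[OF morph Y.po(1) L bounded_trimD(4)[OF Y]
          bounded_trimD(3)[OF Z] p] that bounded_trimD(7)[OF Y] by blast
    have Zp: "Z p = (\<Union>q\<in>?F. Y q)"
    proof
      show "Z p \<subseteq> (\<Union>q\<in>?F. Y q)"
      proof
        fix z assume z: "z \<in> Z p"
        then obtain A where A: "A \<in> trim_at W P r Z p" "z \<in> A"
          using Z.trim_nbhd[OF pP(1) z openin_topspace] Z.X_subset[OF pP(1)] by blast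
        then obtain a where "A \<inter> Z p = {a}"
          using trim_atD(3)[OF A(1) pP] by (meson card_1_singletonE)
        moreover obtain q x where q: "q \<in> ?F" "x \<in> A" "x \<in> Y q"
          using trimZ[OF pP(1) A(1)] by blast
        moreover have "x \<in> Z p"
          using YZ q by blast
        ultimately have "x = z"
          using z A(2) by (metis IntI singletonD)
        then show "z \<in> (\<Union>q\<in>?F. Y q)"
          using q by blast
      qed
    qed (use YZ in blast)
    have inj: "inj_on Y ?F"
      using Y.X_disjoint Y.X_nonempty by (intro inj_onI) blast
    have "Y ` ?F \<subseteq> Pow (Z p)"
      using YZ by blast
    then have finF: "finite ?F"
      using fin finite_imageD[OF _ inj] by (meson finite_Pow_iff finite_subset)
    have "card (Z p) = (\<Sum>q\<in>?F. card (Y q))"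
      unfolding Zp
    proof (rule card_UN_disjoint[OF finF])
      show "\<forall>q\<in>?F. finite (Y q)"
        using fin YZ by (auto intro: finite_subset)
      show "\<forall>q\<in>?F. \<forall>t\<in>?F. q \<noteq> t \<longrightarrow> Y q \<inter> Y t = {}"
        using Y.X_disjoint by blast
    qed
    then have "f p = (\<Sum>q\<in>?F. g q)"
      using bounded_trimD(7)[OF Z p] g by simp
    then show ?thesis
      using finF by blast
  qed
  then show ?thesis
    unfolding covering_morphism_def using morph surj L by blast
qed

section \<open>Isomorphism classes of extended PO systems\<close>

lemma po_iso_min_d:
  assumes iso: "po_iso P r Q s \<alpha>" and "\<alpha> ` L = M" "L \<subseteq> P" and p: "p \<in> po_min_d P r L"
  shows "\<alpha> p \<in> po_min_d Q s M"
proof -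
  have rel: "\<And>p q. p \<in> P \<Longrightarrow> q \<in> P \<Longrightarrow> (p, q) \<in> r \<longleftrightarrow> (\<alpha> p, \<alpha> q) \<in> s" and im: "\<alpha> ` P = Q"
    using iso by (auto simp: po_iso_def bij_betw_def)
  have p': "p \<in> L" "p \<in> P" "(p, p) \<notin> r" "\<And>q. q \<in> L \<Longrightarrow> (q, p) \<in> r \<Longrightarrow> q = p"
    using p unfolding po_min_d_def po_min_def po_d_def po_le_def by auto
  have "(\<alpha> q, \<alpha> p) \<notin> s" if "q \<in> L" for q
    using p'(3,4) rel[of q p] assms(3) p'(2) that by blast
  then show ?thesis
    using p'(1-3) rel[of p p] im assms(2) unfolding po_min_d_def po_min_def po_d_def po_le_def by blast
qed

lemma ext_po_isosD:
  assumes "((P, r, L, f), (Q, s, M, g)) \<in> ext_po_isos"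
  obtains \<alpha> where "extended_po P r L f" "extended_po Q s M g" "po_iso P r Q s \<alpha>" "\<alpha> ` L = M"
    "\<And>p. p \<in> po_min_d P r L \<Longrightarrow> g (\<alpha> p) = f p"
  using assms unfolding ext_po_isos_def by auto

lemma ext_po_isosI:
  assumes "extended_po P r L f" "extended_po Q s M g" "po_iso P r Q s \<alpha>" "\<alpha> ` L = M"
    "\<And>p. p \<in> po_min_d P r L \<Longrightarrow> g (\<alpha> p) = f p"
  shows "((P, r, L, f), (Q, s, M, g)) \<in> ext_po_isos"
  using assms unfolding ext_po_isos_def by auto

lemma extended_poD:
  assumes "extended_po P r L f"
  shows "po_system P r" "r \<subseteq> P \<times> P" "lower_subset P r L" "L \<subseteq> P"
  using assms by (auto simp: extended_po_def po_system_def lower_subset_def)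

lemma po_iso_inv:
  assumes "po_iso P r Q s \<alpha>"
  shows "po_iso Q s P r (inv_into P \<alpha>)"
proof -
  have bij: "bij_betw \<alpha> P Q" and rel: "\<And>p q. p \<in> P \<Longrightarrow> q \<in> P \<Longrightarrow> (p, q) \<in> r \<longleftrightarrow> (\<alpha> p, \<alpha> q) \<in> s"
    using assms by (auto simp: po_iso_def)
  have "inv_into P \<alpha> q \<in> P" "\<alpha> (inv_into P \<alpha> q) = q" if "q \<in> Q" for q
    using that bij by (auto simp: bij_betw_def inv_into_into f_inv_into_f)
  then show ?thesis
    using bij_betw_inv_into[OF bij] rel by (simp add: po_iso_def)
qed

lemma po_iso_comp:
  assumes "po_iso P r Q s \<alpha>" "po_iso Q s S t \<beta>"
  shows "po_iso P r S t (\<beta> \<circ> \<alpha>)"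
proof -
  have "\<alpha> p \<in> Q" if "p \<in> P" for p
    using assms(1) that by (auto simp: po_iso_def bij_betw_def)
  then show ?thesis
    using assms bij_betw_trans by (fastforce simp: po_iso_def)
qed

lemma equiv_ext_po_isos:
  "equiv {(P, r, L, f). extended_po P r L f} (ext_po_isos :: 'i ext_po rel)"
  (is "equiv ?A ?R")
proof (rule equivI)
  show "?R \<subseteq> ?A \<times> ?A"
    unfolding ext_po_isos_def by auto
  show "refl_on ?A ?R"
  proof (rule refl_onI)
    fix e :: "'i ext_po" assume "e \<in> ?A"
    then obtain P r L f where e: "e = (P, r, L, f)" and "extended_po P r L f"
      by blast
    moreover have "po_iso P r P r id"
      by (simp add: po_iso_def)
    ultimately show "(e, e) \<in> ext_po_isos"
      unfolding e by (intro ext_po_isosI[where \<alpha> = id]) auto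
  qed
  show "sym ?R"
  proof (rule symI)
    fix e e' :: "'i ext_po" assume ee: "(e, e') \<in> ext_po_isos"
    obtain P r L f Q s M g where e: "e = (P, r, L, f)" "e' = (Q, s, M, g)"
      by (metis prod_cases4)
    obtain \<alpha> where a: "extended_po P r L f" "extended_po Q s M g" "po_iso P r Q s \<alpha>" "\<alpha> ` L = M"
      "\<And>p. p \<in> po_min_d P r L \<Longrightarrow> g (\<alpha> p) = f p"
      using ee unfolding e by (rule ext_po_isosD) blast
    have bij: "bij_betw \<alpha> P Q"
      using a(3) by (simp add: po_iso_def)
    have im_inv: "inv_into P \<alpha> ` M = L"
      using bij a(4) extended_poD(4)[OF a(1)] by (auto simp: bij_betw_def image_iff inv_into_f_f subset_iff)
    show "(e', e) \<in> ext_po_isos"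
      unfolding e
    proof (rule ext_po_isosI[OF a(2,1) po_iso_inv[OF a(3)] im_inv])
      fix q assume q: "q \<in> po_min_d Q s M"
      then have "inv_into P \<alpha> q \<in> po_min_d P r L"
        using po_iso_min_d[OF po_iso_inv[OF a(3)] im_inv extended_poD(4)[OF a(2)]] by blast
      moreover have "\<alpha> (inv_into P \<alpha> q) = q"
        using q bij by (auto simp: bij_betw_def f_inv_into_f po_min_d_def po_d_def)
      ultimately show "f (inv_into P \<alpha> q) = g q"
        using a(5) by metis
    qed
  qed
  show "trans ?R"
  proof (rule transI)
    fix e e' e'' :: "'i ext_po" assume ee: "(e, e') \<in> ext_po_isos" "(e', e'') \<in> ext_po_isos"
    obtain P r L f Q s M g S t N k where e: "e = (P, r, L, f)" "e' = (Q, s, M, g)" "e'' = (S, t, N, k)"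
      by (metis prod_cases4)
    obtain \<alpha> \<beta> where a: "extended_po P r L f" "po_iso P r Q s \<alpha>" "\<alpha> ` L = M"
      "\<And>p. p \<in> po_min_d P r L \<Longrightarrow> g (\<alpha> p) = f p"
      and b: "extended_po S t N k" "po_iso Q s S t \<beta>" "\<beta> ` M = N"
      "\<And>p. p \<in> po_min_d Q s M \<Longrightarrow> k (\<beta> p) = g p"
      using ee unfolding e by (auto elim!: ext_po_isosD)
    show "(e, e'') \<in> ext_po_isos"
      unfolding e
    proof (rule ext_po_isosI[OF a(1) b(1) po_iso_comp[OF a(2) b(2)]])
      show "(\<beta> \<circ> \<alpha>) ` L = N"
        unfolding image_comp[symmetric] using a(3) b(3) by simp
      show "k ((\<beta> \<circ> \<alpha>) p) = f p" if "p \<in> po_min_d P r L" for p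
        using a(4)[OF that] b(4)[OF po_iso_min_d[OF a(2,3) extended_poD(4)[OF a(1)] that]] by simp
    qed
  qed
qed

lemma covering_morphism_iso:
  assumes ext: "extended_po P r L f" "extended_po Q s M g" and iso: "po_iso P r Q s \<alpha>" "\<alpha> ` L = M"
    and f: "\<And>p. p \<in> po_min_d P r L \<Longrightarrow> g (\<alpha> p) = f p"
  shows "covering_morphism P r L f Q s M g \<alpha>"
proof -
  have morph: "po_morphism P r Q s \<alpha>" and inj: "inj_on \<alpha> P" and im: "\<alpha> ` P = Q"
    using iso(1) unfolding po_iso_iff_morphism bij_betw_def by blast+
  have fibre: "{p \<in> P. \<alpha> p = \<alpha> p'} = {p'}" if "p' \<in> P" for p'
    using inj that by (auto simp: inj_on_def)
  have M: "M = {q \<in> Q. {p \<in> P. \<alpha> p = q} \<subseteq> L}"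
  proof (intro Set.set_eqI iffI)
    fix q assume "q \<in> M"
    then obtain p where p: "p \<in> L" "q = \<alpha> p" using iso(2) by blast
    then have "p \<in> P" using extended_poD(4)[OF ext(1)] by blast
    then have "{p \<in> P. \<alpha> p = q} = {p}" "q \<in> Q"
      using fibre[of p] p(2) im by auto
    then show "q \<in> {q \<in> Q. {p \<in> P. \<alpha> p = q} \<subseteq> L}"
      using p(1) by simp
  next
    fix q assume "q \<in> {q \<in> Q. {p \<in> P. \<alpha> p = q} \<subseteq> L}"
    then show "q \<in> M" using im iso(2) by blast
  qed
  have "finite {p \<in> P. \<alpha> p = q} \<and> g q = (\<Sum>p\<in>{p \<in> P. \<alpha> p = q}. f p)" if q: "q \<in> po_min_d Q s M" for q
  proof -
    obtain p where p: "p \<in> P" "q = \<alpha> p"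
      using q im by (auto simp: po_min_d_def po_d_def)
    have "p \<in> po_min_d P r L"
      using fibre_over_minimal[OF morph extended_poD(2)[OF ext(1)] M extended_poD(4)[OF ext(1)]
        extended_poD(3)[OF ext(2)] q p(1)] p(2) by simp
    then show ?thesis
      using fibre[OF p(1)] f p(2) by simp
  qed
  then show ?thesis
    unfolding covering_morphism_def using morph im M by blast
qed

text \<open>Fibres over \<open>L\<^sub>m\<^sub>i\<^sub>n\<^sup>d\<close> lie in \<open>M\<^sub>m\<^sub>i\<^sub>n\<^sup>d\<close>, so the two sum formulas can be nested.\<close>

lemma covering_morphism_comp:
  assumes S: "extended_po S t N h" and Q: "extended_po Q s M g" and P: "extended_po P r L f"
    and a: "covering_morphism S t N h Q s M g \<alpha>" and b: "covering_morphism Q s M g P r L f \<beta>"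
  shows "covering_morphism S t N h P r L f (\<beta> \<circ> \<alpha>)"
proof -
  have a': "po_morphism S t Q s \<alpha>" "\<alpha> ` S = Q" "M = {q \<in> Q. {x \<in> S. \<alpha> x = q} \<subseteq> N}"
    "\<And>q. q \<in> po_min_d Q s M \<Longrightarrow> finite {x \<in> S. \<alpha> x = q} \<and> g q = (\<Sum>x\<in>{x \<in> S. \<alpha> x = q}. h x)"
    using a unfolding covering_morphism_def by blast+
  have b': "po_morphism Q s P r \<beta>" "\<beta> ` Q = P" "L = {p \<in> P. {q \<in> Q. \<beta> q = p} \<subseteq> M}"
    "\<And>p. p \<in> po_min_d P r L \<Longrightarrow> finite {q \<in> Q. \<beta> q = p} \<and> f p = (\<Sum>q\<in>{q \<in> Q. \<beta> q = p}. g q)"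
    using b unfolding covering_morphism_def by blast+
  have \<alpha>Q: "\<alpha> x \<in> Q" if "x \<in> S" for x
    using a'(2) that by blast
  have fibres: "{x \<in> S. (\<beta> \<circ> \<alpha>) x = p} = (\<Union>q\<in>{q \<in> Q. \<beta> q = p}. {x \<in> S. \<alpha> x = q})" for p
    using \<alpha>Q by auto
  have "po_morphism S t P r (\<beta> \<circ> \<alpha>)"
    unfolding po_morphism_def
  proof (intro conjI ballI)
    show "(\<beta> \<circ> \<alpha>) ` S \<subseteq> P" using a'(2) b'(2) by auto
    fix x assume x: "x \<in> S"
    have "(\<beta> \<circ> \<alpha>) ` {y \<in> S. (x, y) \<in> t} = \<beta> ` (\<alpha> ` {y \<in> S. (x, y) \<in> t})"
      by (simp add: image_comp)
    also have "\<alpha> ` {y \<in> S. (x, y) \<in> t} = {q \<in> Q. (\<alpha> x, q) \<in> s}"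
      using a'(1) x by (simp add: po_morphism_def)
    also have "\<beta> ` {q \<in> Q. (\<alpha> x, q) \<in> s} = {p \<in> P. (\<beta> (\<alpha> x), p) \<in> r}"
      using b'(1) \<alpha>Q[OF x] by (simp add: po_morphism_def)
    finally show "(\<beta> \<circ> \<alpha>) ` {y \<in> S. (x, y) \<in> t} = {p \<in> P. ((\<beta> \<circ> \<alpha>) x, p) \<in> r}"
      by simp
  qed
  moreover have "(\<beta> \<circ> \<alpha>) ` S = P"
    unfolding image_comp[symmetric] using a'(2) b'(2) by simp
  moreover have "L = {p \<in> P. {x \<in> S. (\<beta> \<circ> \<alpha>) x = p} \<subseteq> N}"
    unfolding fibres b'(3) a'(3) by blast
  moreover have "finite {x \<in> S. (\<beta> \<circ> \<alpha>) x = p} \<and> f p = (\<Sum>x\<in>{x \<in> S. (\<beta> \<circ> \<alpha>) x = p}. h x)"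
    if p: "p \<in> po_min_d P r L" for p
  proof -
    let ?F = "{q \<in> Q. \<beta> q = p}"
    have min: "q \<in> po_min_d Q s M" if "q \<in> ?F" for q
      using fibre_over_minimal[OF b'(1) extended_poD(2)[OF Q] b'(3) extended_poD(4)[OF Q]
        extended_poD(3)[OF P] p] that by blast
    have F: "finite ?F" "f p = (\<Sum>q\<in>?F. g q)"
      using b'(4)[OF p] by blast+
    have fin: "\<forall>q\<in>?F. finite {x \<in> S. \<alpha> x = q}"
      using a'(4) min by blast
    have "(\<Sum>x\<in>{x \<in> S. (\<beta> \<circ> \<alpha>) x = p}. h x) = (\<Sum>q\<in>?F. \<Sum>x\<in>{x \<in> S. \<alpha> x = q}. h x)"
      unfolding fibres using F(1) fin by (intro sum.UNION_disjoint) auto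
    also have "\<dots> = (\<Sum>q\<in>?F. g q)"
      using a'(4) min by (intro sum.cong) auto
    finally show ?thesis
      using F fin unfolding fibres by simp
  qed
  ultimately show ?thesis
    unfolding covering_morphism_def by blast
qed

lemma ext_po_below_trans:
  assumes "ext_po_below e e'" "ext_po_below e' e''"
    and "e \<in> {(P, r, L, f). extended_po P r L f}" "e' \<in> {(P, r, L, f). extended_po P r L f}"
      "e'' \<in> {(P, r, L, f). extended_po P r L f}"
  shows "ext_po_below e e''"
proof -
  obtain S t N h Q s M g P r L f where e: "e = (S, t, N, h)" "e' = (Q, s, M, g)" "e'' = (P, r, L, f)"
    by (metis prod_cases4)
  show ?thesis
    using assms covering_morphism_comp[of S t N h Q s M g P r L f] unfolding e ext_po_below_iff by auto
qed

lemma ext_po_below_if_iso: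
  assumes "(e, e') \<in> ext_po_isos" shows "ext_po_below e e'"
proof -
  obtain Q s M g P r L f where e: "e = (Q, s, M, g)" "e' = (P, r, L, f)"
    by (metis prod_cases4)
  obtain \<alpha> where "extended_po Q s M g" "extended_po P r L f" "po_iso Q s P r \<alpha>" "\<alpha> ` M = L"
    "\<And>q. q \<in> po_min_d Q s M \<Longrightarrow> f (\<alpha> q) = g q"
    using assms unfolding e by (rule ext_po_isosD) blast
  then show ?thesis
    using covering_morphism_iso unfolding e ext_po_below_iff by blast
qed

lemma preorder_P: "preorder_on (P_sys W) (P_prec W)"
proof -
  note eqv = equiv_ext_po_isos
  let ?A = "{(P, r, L, f). \<exists>X. bounded_trim_partition_for W P r L f X}"
  have sub: "?A \<subseteq> {(P, r, L, f). extended_po P r L f}"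
    using bounded_trimD(2) by auto
  have cls: "\<exists>e\<in>E. e \<in> ?A \<and> E = ext_po_isos `` {e}" if "E \<in> P_sys W" for E
    using that sub equiv_class_self[OF eqv] unfolding P_sys_def by (auto elim!: quotientE) blast
  have ext: "e \<in> {(P, r, L, f). extended_po P r L f}" and iso: "e' \<in> E \<Longrightarrow> (e, e') \<in> ext_po_isos"
    if E: "E \<in> P_sys W" "e \<in> E" for E e e'
  proof -
    obtain c where c: "E = ext_po_isos `` {c}" using cls[OF E(1)] by blast
    then show "e \<in> {(P, r, L, f). extended_po P r L f}"
      using E(2) eqv unfolding equiv_def by blast
    show "(e, e') \<in> ext_po_isos" if "e' \<in> E"
      using that E(2) c eqv unfolding equiv_def by (blast dest: symD transD)
  qed
  have "refl_on (P_sys W) (P_prec W)"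
    unfolding refl_on_def
  proof
    fix E assume E: "E \<in> P_sys W"
    then obtain e where e: "e \<in> E" using cls by blast
    then show "(E, E) \<in> P_prec W"
      unfolding P_prec_def using E ext_po_below_if_iso[OF iso[OF E e e]] by blast
  qed
  moreover have "trans (P_prec W)"
  proof (rule transI)
    fix E F G assume "(E, F) \<in> P_prec W" "(F, G) \<in> P_prec W"
    then obtain e f f' g where m: "E \<in> P_sys W" "F \<in> P_sys W" "G \<in> P_sys W" "e \<in> E" "f \<in> F" "f' \<in> F" "g \<in> G"
      and b: "ext_po_below e f" "ext_po_below f' g"
      unfolding P_prec_def by blast
    have "ext_po_below f f'"
      using ext_po_below_if_iso iso[OF m(2,5,6)] by blast
    then have "ext_po_below e f'"
      using ext_po_below_trans[OF b(1)] ext m by blast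
    then have "ext_po_below e g"
      using ext_po_below_trans[OF _ b(2)] ext m by blast
    then show "(E, G) \<in> P_prec W"
      unfolding P_prec_def using m by blast
  qed
  moreover have "P_prec W \<subseteq> P_sys W \<times> P_sys W"
    unfolding P_prec_def by blast
  ultimately show ?thesis
    by (simp add: preorder_on_def)
qed

section \<open>Equivalence classes of bounded trim partitions\<close>

lemma equiv_partition_equiv:
  "equiv (bounded_trim_partitions W) (partition_equiv W)"
proof (rule equivI)
  show "partition_equiv W \<subseteq> bounded_trim_partitions W \<times> bounded_trim_partitions W"
    unfolding partition_equiv_def bounded_trim_partitions_def by auto
  show "refl_on (bounded_trim_partitions W) (partition_equiv W)"
  proof (rule refl_onI)
    fix x assume x: "x \<in> bounded_trim_partitions W"
    obtain P r X where e: "x = (P, r, X)" by (metis prod_cases3)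
    have "homeomorphic_map W W id" "po_iso P r P r id" "\<forall>q\<in>P. id ` X q = X (id q)"
      by (simp_all add: po_iso_def)
    then show "(x, x) \<in> partition_equiv W"
      using x unfolding e partition_equiv_def bounded_trim_partitions_def by blast
  qed
  show "sym (partition_equiv W)"
  proof (rule symI)
    fix x y assume xy: "(x, y) \<in> partition_equiv W"
    obtain Q s Y P r Z where e: "x = (Q, s, Y)" "y = (P, r, Z)" by (metis prod_cases3)
    obtain h \<alpha> where b: "bounded_trim_partition W Q s Y" "bounded_trim_partition W P r Z"
      and h: "homeomorphic_map W W h" and a: "po_iso Q s P r \<alpha>" and im: "\<And>q. q \<in> Q \<Longrightarrow> h ` Y q = Z (\<alpha> q)"
      using xy unfolding e partition_equiv_def by blast
    obtain k where k: "homeomorphic_map W W k" "\<And>w. w \<in> topspace W \<Longrightarrow> k (h w) = w"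
      by (rule homeomorphic_map_inverseE[OF h]) blast
    have "k ` Z p = Y (inv_into Q \<alpha> p)" if p: "p \<in> P" for p
    proof -
      define q where "q = inv_into Q \<alpha> p"
      have q: "q \<in> Q" "\<alpha> q = p"
        using a p unfolding q_def po_iso_def bij_betw_def by (auto simp: inv_into_into f_inv_into_f)
      have "Y q \<subseteq> topspace W"
        using b(1) q(1) unfolding bounded_trim_partition_def bounded_trim_partition_for_def
          trim_partition_def po_partition_def by blast
      then have "k ` h ` Y q = Y q"
        using k(2) by (force simp: image_image)
      then show ?thesis
        using im[OF q(1)] q(2) unfolding q_def by simp
    qed
    then show "(y, x) \<in> partition_equiv W"
      using b k(1) po_iso_inv[OF a] unfolding e partition_equiv_def by blast
  qed
  show "trans (partition_equiv W)"
  proof (rule transI)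
    fix x y z assume xy: "(x, y) \<in> partition_equiv W" "(y, z) \<in> partition_equiv W"
    obtain Q s Y P r Z S t V where e: "x = (Q, s, Y)" "y = (P, r, Z)" "z = (S, t, V)" by (metis prod_cases3)
    obtain h \<alpha> where b: "bounded_trim_partition W Q s Y" and h: "homeomorphic_map W W h"
      and a: "po_iso Q s P r \<alpha>" and im: "\<And>q. q \<in> Q \<Longrightarrow> h ` Y q = Z (\<alpha> q)"
      using xy(1) unfolding e partition_equiv_def by blast
    obtain k \<beta> where b': "bounded_trim_partition W S t V" and k: "homeomorphic_map W W k"
      and a': "po_iso P r S t \<beta>" and im': "\<And>q. q \<in> P \<Longrightarrow> k ` Z q = V (\<beta> q)"
      using xy(2) unfolding e partition_equiv_def by blast
    have "(k \<circ> h) ` Y q = V ((\<beta> \<circ> \<alpha>) q)" if q: "q \<in> Q" for q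
    proof -
      have "\<alpha> q \<in> P" using a q by (auto simp: po_iso_def bij_betw_def)
      then show ?thesis
        unfolding image_comp[symmetric] using im[OF q] im' by simp
    qed
    then show "(x, z) \<in> partition_equiv W"
      using b b' homeomorphic_map_compose[OF h k] po_iso_comp[OF a a'] unfolding e partition_equiv_def by blast
  qed
qed

lemma ext_po_isos_if_partition_equiv:
  assumes eq: "((Q, s, Y), (P, r, Z)) \<in> partition_equiv W"
    and Y: "bounded_trim_partition_for W Q s M g Y" and Z: "bounded_trim_partition_for W P r L f Z"
  shows "((Q, s, M, g), (P, r, L, f)) \<in> ext_po_isos"
proof -
  obtain h \<alpha> where h: "homeomorphic_map W W h"
    and a: "po_iso Q s P r \<alpha>" and im: "\<And>q. q \<in> Q \<Longrightarrow> h ` Y q = Z (\<alpha> q)"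
    using eq unfolding partition_equiv_def by blast
  have \<alpha>P: "\<alpha> ` Q = P" using a by (simp add: po_iso_def bij_betw_def)
  have Ytop: "Y q \<subseteq> topspace W" if "q \<in> Q" for q
    using bounded_trimD(5)[OF Y] that unfolding trim_partition_def po_partition_def by blast
  have "q \<in> M \<longleftrightarrow> \<alpha> q \<in> L" if q: "q \<in> Q" for q
  proof -
    have "W closure_of Z (\<alpha> q) = h ` (W closure_of Y q)"
      using homeomorphic_map_closure_of[OF h Ytop[OF q]] im[OF q] by simp
    then have "compactin W (W closure_of Z (\<alpha> q)) \<longleftrightarrow> compactin W (W closure_of Y q)"
      using homeomorphic_map_compactness[OF h closure_of_subset_topspace] by simp
    then show ?thesis
      using bounded_trimD(6)[OF Y q] bounded_trimD(6)[OF Z] \<alpha>P q by blast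
  qed
  then have LM: "\<alpha> ` M = L"
    using \<alpha>P bounded_trimD(4)[OF Y] bounded_trimD(4)[OF Z] by blast
  show ?thesis
  proof (rule ext_po_isosI[OF bounded_trimD(2)[OF Y] bounded_trimD(2)[OF Z] a LM])
    fix q assume q: "q \<in> po_min_d Q s M"
    then have qQ: "q \<in> Q" by (simp add: po_min_d_def po_d_def)
    have "inj_on h (Y q)"
      using homeomorphic_imp_injective_map[OF h] Ytop[OF qQ] inj_on_subset by blast
    then have "card (Z (\<alpha> q)) = card (Y q)"
      using im[OF qQ] card_image by metis
    then show "f (\<alpha> q) = g q"
      using bounded_trimD(7)[OF Y q] bounded_trimD(7)[OF Z]
        po_iso_min_d[OF a LM bounded_trimD(4)[OF Y] q] by simp
  qed
qed

text \<open>Relabel \<open>Y\<close> along the isomorphism and apply uniqueness.\<close>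

lemma partition_equiv_if_ext_po_isos:
  assumes \<omega>: "omega_stone_space W" and eq: "((Q, s, M, g), (P, r, L, f)) \<in> ext_po_isos"
    and Y: "bounded_trim_partition_for W Q s M g Y" and Z: "bounded_trim_partition_for W P r L f Z"
  shows "((Q, s, Y), (P, r, Z)) \<in> partition_equiv W"
proof -
  obtain \<alpha> where e: "extended_po Q s M g" "extended_po P r L f" and a: "po_iso Q s P r \<alpha>"
    and i: "\<alpha> ` M = L" "\<And>q. q \<in> po_min_d Q s M \<Longrightarrow> f (\<alpha> q) = g q"
    using eq by (rule ext_po_isosD) blast
  have over: "covering_morphism Q s M g P r L f \<alpha>"
    using covering_morphism_iso[OF e a i] .
  obtain h where h: "homeomorphic_map W W h" "\<And>p. p \<in> P \<Longrightarrow> h ` coarsening W Q Y P r \<alpha> p = Z p"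
    using bounded_trim_partition_unique[OF \<omega> \<omega> coarsening_bounded(1)[OF Y over e(2)] Z] by blast
  interpret coarsened_partition W Q s Y P r \<alpha>
    by unfold_locales (use bounded_trimD[OF Y] extended_poD[OF e(2)] over in \<open>auto simp: covering_morphism_def\<close>)
  have "h ` Y q = Z (\<alpha> q)" if "q \<in> Q" for q
    using h(2)[OF \<alpha>_in[OF that]] coarsening_along_iso[OF a that] by simp
  then show ?thesis
    using h(1) a Y Z unfolding partition_equiv_def bounded_trim_partition_def by blast
qed

text \<open>The isomorphism between the two quasi-ordered systems. It is defined on classes without choosing
  representatives; it is a full isomorphism class by the next lemma.\<close>

definition ext_po_class :: "'w topology \<Rightarrow> 'w indexed_partition set \<Rightarrow> ('w set set) ext_po set" where
  "ext_po_class W \<Y> = {(Q, s, M, g). \<exists>Y. (Q, s, Y) \<in> \<Y> \<and> bounded_trim_partition_for W Q s M g Y}"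

lemma ext_po_class_eq:
  assumes \<omega>: "omega_stone_space W" and Y: "bounded_trim_partition_for W Q s M g Y"
  shows "ext_po_class W (partition_equiv W `` {(Q, s, Y)}) = ext_po_isos `` {(Q, s, M, g)}"
proof (intro Set.set_eqI iffI)
  fix e assume e: "e \<in> ext_po_class W (partition_equiv W `` {(Q, s, Y)})"
  obtain P r L f where e': "e = (P, r, L, f)" by (metis prod_cases4)
  obtain Z where "((Q, s, Y), (P, r, Z)) \<in> partition_equiv W" "bounded_trim_partition_for W P r L f Z"
    using e unfolding e' ext_po_class_def by blast
  then show "e \<in> ext_po_isos `` {(Q, s, M, g)}"
    using ext_po_isos_if_partition_equiv[OF _ Y] unfolding e' by blast
next
  fix e assume e: "e \<in> ext_po_isos `` {(Q, s, M, g)}"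
  obtain P r L f where e': "e = (P, r, L, f)" by (metis prod_cases4)
  have iso: "((Q, s, M, g), (P, r, L, f)) \<in> ext_po_isos"
    using e unfolding e' by blast
  obtain \<alpha> where "extended_po Q s M g" and ext: "extended_po P r L f" and "po_iso Q s P r \<alpha>" "\<alpha> ` M = L"
    "\<And>q. q \<in> po_min_d Q s M \<Longrightarrow> f (\<alpha> q) = g q"
    using iso by (rule ext_po_isosD) blast
  then have "covering_morphism Q s M g P r L f \<alpha>"
    using covering_morphism_iso by blast
  then have Z: "bounded_trim_partition_for W P r L f (coarsening W Q Y P r \<alpha>)"
    using coarsening_bounded(1)[OF Y _ ext] by blast
  then have "((Q, s, Y), (P, r, coarsening W Q Y P r \<alpha>)) \<in> partition_equiv W"
    using partition_equiv_if_ext_po_isos[OF \<omega> iso Y] by blast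
  then show "e \<in> ext_po_class W (partition_equiv W `` {(Q, s, Y)})"
    using Z unfolding e' ext_po_class_def by blast
qed

lemma T_sysE:
  assumes "\<Y> \<in> T_sys W"
  obtains Q s M g Y where "bounded_trim_partition_for W Q s M g Y" "\<Y> = partition_equiv W `` {(Q, s, Y)}"
  using assms unfolding T_sys_def bounded_trim_partitions_def bounded_trim_partition_def
  by (auto elim!: quotientE)

lemma P_sysE:
  assumes "E \<in> P_sys W"
  obtains Q s M g Y where "bounded_trim_partition_for W Q s M g Y" "E = ext_po_isos `` {(Q, s, M, g)}"
  using assms unfolding P_sys_def by (auto elim!: quotientE)

lemma ext_po_class_bij:
  assumes \<omega>: "omega_stone_space W"
  shows "bij_betw (ext_po_class W) (T_sys W) (P_sys W)"
  unfolding bij_betw_def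
proof (intro conjI)
  show "ext_po_class W ` T_sys W = P_sys W"
  proof
    show "ext_po_class W ` T_sys W \<subseteq> P_sys W"
    proof
      fix E assume "E \<in> ext_po_class W ` T_sys W"
      then obtain \<Y> where Y: "\<Y> \<in> T_sys W" "E = ext_po_class W \<Y>" by blast
      obtain Q s M g Y where b: "bounded_trim_partition_for W Q s M g Y" "\<Y> = partition_equiv W `` {(Q, s, Y)}"
        using T_sysE[OF Y(1)] .
      have "E = ext_po_isos `` {(Q, s, M, g)}"
        using ext_po_class_eq[OF \<omega> b(1)] Y(2) b(2) by simp
      then show "E \<in> P_sys W"
        unfolding P_sys_def using b(1) by (auto intro: quotientI)
    qed
    show "P_sys W \<subseteq> ext_po_class W ` T_sys W"
    proof
      fix E assume "E \<in> P_sys W"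
      then obtain Q s M g Y where b: "bounded_trim_partition_for W Q s M g Y" "E = ext_po_isos `` {(Q, s, M, g)}"
        by (rule P_sysE)
      have "partition_equiv W `` {(Q, s, Y)} \<in> T_sys W"
        unfolding T_sys_def bounded_trim_partitions_def bounded_trim_partition_def
        using b(1) by (auto intro: quotientI)
      then show "E \<in> ext_po_class W ` T_sys W"
        using ext_po_class_eq[OF \<omega> b(1)] b(2) by blast
    qed
  qed
  show "inj_on (ext_po_class W) (T_sys W)"
  proof (rule inj_onI)
    fix \<Y> \<Z> assume Y: "\<Y> \<in> T_sys W" and Z: "\<Z> \<in> T_sys W" and eq: "ext_po_class W \<Y> = ext_po_class W \<Z>"
    obtain Q s M g Y where Y: "bounded_trim_partition_for W Q s M g Y" "\<Y> = partition_equiv W `` {(Q, s, Y)}"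
      using T_sysE[OF Y] .
    obtain P r L f Z where Z: "bounded_trim_partition_for W P r L f Z" "\<Z> = partition_equiv W `` {(P, r, Z)}"
      using T_sysE[OF Z] .
    have "ext_po_isos `` {(Q, s, M, g)} = ext_po_isos `` {(P, r, L, f)}"
      using eq ext_po_class_eq[OF \<omega> Y(1)] ext_po_class_eq[OF \<omega> Z(1)] Y(2) Z(2) by simp
    then have "((Q, s, M, g), (P, r, L, f)) \<in> ext_po_isos"
      using eq_equiv_class[OF _ equiv_ext_po_isos] bounded_trimD(2)[OF Z(1)] by blast
    then have "((Q, s, Y), (P, r, Z)) \<in> partition_equiv W"
      using partition_equiv_if_ext_po_isos[OF \<omega> _ Y(1) Z(1)] by blast
    then show "\<Y> = \<Z>"
      unfolding Y(2) Z(2) by (rule equiv_class_eq[OF equiv_partition_equiv])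
  qed
qed

lemma T_sys_member:
  assumes "\<Y> \<in> T_sys W" "(Q, s, Y) \<in> \<Y>"
  shows "\<exists>M g. bounded_trim_partition_for W Q s M g Y" "\<Y> = partition_equiv W `` {(Q, s, Y)}"
proof -
  obtain y where y: "\<Y> = partition_equiv W `` {y}"
    using assms(1) unfolding T_sys_def by (auto elim: quotientE)
  then have yy: "(y, (Q, s, Y)) \<in> partition_equiv W"
    using assms(2) by blast
  then show "\<Y> = partition_equiv W `` {(Q, s, Y)}"
    unfolding y by (rule equiv_class_eq[OF equiv_partition_equiv])
  show "\<exists>M g. bounded_trim_partition_for W Q s M g Y"
    using yy unfolding partition_equiv_def bounded_trim_partition_def by auto
qed

text \<open>From right to left, the coarsening of \<open>Y\<close> along the given morphism is regularly refined by \<open>Y\<close>, and it belongs to the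
  class of \<open>Z\<close> because both have the same extended PO system.\<close>

lemma ext_po_class_prec_iff:
  assumes \<omega>: "omega_stone_space W" and YT: "\<Y> \<in> T_sys W" and ZT: "\<Z> \<in> T_sys W"
  shows "(\<Y>, \<Z>) \<in> T_prec W \<longleftrightarrow> (ext_po_class W \<Y>, ext_po_class W \<Z>) \<in> P_prec W"
proof
  assume "(\<Y>, \<Z>) \<in> T_prec W"
  then obtain Q s Y P r Z \<alpha> where m: "(Q, s, Y) \<in> \<Y>" "(P, r, Z) \<in> \<Z>"
    and ref: "regularly_refines_via W Q Y P r Z \<alpha>"
    unfolding T_prec_def by blast
  obtain M g where Y: "bounded_trim_partition_for W Q s M g Y"
    using T_sys_member(1)[OF YT m(1)] by blast
  obtain L f where Z: "bounded_trim_partition_for W P r L f Z"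
    using T_sys_member(1)[OF ZT m(2)] by blast
  have "ext_po_below (Q, s, M, g) (P, r, L, f)"
    using covering_morphism_if_refines[OF Y Z ref] ext_po_below_iff by blast
  moreover have "(Q, s, M, g) \<in> ext_po_class W \<Y>" "(P, r, L, f) \<in> ext_po_class W \<Z>"
    using m Y Z unfolding ext_po_class_def by blast+
  moreover have "ext_po_class W \<Y> \<in> P_sys W" "ext_po_class W \<Z> \<in> P_sys W"
    using ext_po_class_bij[OF \<omega>] YT ZT unfolding bij_betw_def by blast+
  ultimately show "(ext_po_class W \<Y>, ext_po_class W \<Z>) \<in> P_prec W"
    unfolding P_prec_def by blast
next
  assume "(ext_po_class W \<Y>, ext_po_class W \<Z>) \<in> P_prec W"
  then obtain e e' where e: "e \<in> ext_po_class W \<Y>" "e' \<in> ext_po_class W \<Z>" "ext_po_below e e'"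
    unfolding P_prec_def by blast
  obtain Q s M g P r L f where ee: "e = (Q, s, M, g)" "e' = (P, r, L, f)" by (metis prod_cases4)
  obtain Y Z where m: "(Q, s, Y) \<in> \<Y>" "(P, r, Z) \<in> \<Z>" and Y: "bounded_trim_partition_for W Q s M g Y"
    and Z: "bounded_trim_partition_for W P r L f Z"
    using e unfolding ee ext_po_class_def by blast
  obtain \<alpha> where over: "covering_morphism Q s M g P r L f \<alpha>"
    using e(3) unfolding ee ext_po_below_iff by blast
  have ext: "extended_po P r L f"
    using bounded_trimD(2)[OF Z] .
  note c = coarsening_bounded[OF Y over ext]
  have "((P, r, L, f), (P, r, L, f)) \<in> ext_po_isos"
    using equiv_ext_po_isos ext unfolding equiv_def refl_on_def by blast
  then have "((P, r, Z), (P, r, coarsening W Q Y P r \<alpha>)) \<in> partition_equiv W"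
    using partition_equiv_if_ext_po_isos[OF \<omega> _ Z c(1)] by blast
  then have "(P, r, coarsening W Q Y P r \<alpha>) \<in> \<Z>"
    using T_sys_member(2)[OF ZT m(2)] by blast
  then show "(\<Y>, \<Z>) \<in> T_prec W"
    unfolding T_prec_def using YT ZT m(1) c(2) by blast
qed

section \<open>The canonical partition\<close>

lemma below_ring_iso:
  assumes h: "homeomorphic_map (subtopology W A) (subtopology V B) h"
    and A: "A \<in> compact_opens W" and B: "B \<in> compact_opens V"
  shows "below_ring W A \<simeq> below_ring V B"
proof -
  obtain k where hk: "homeomorphic_maps (subtopology W A) (subtopology V B) h k"
    using h homeomorphic_map_maps by blast
  then have k: "homeomorphic_map (subtopology V B) (subtopology W A) k"
    by (simp add: homeomorphic_maps_map)
  have top: "topspace (subtopology W A) = A" "topspace (subtopology V B) = B"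
    using compact_opens_subset_topspace[OF A] compact_opens_subset_topspace[OF B] by auto
  have kh: "\<And>x. x \<in> A \<Longrightarrow> k (h x) = x" "\<And>y. y \<in> B \<Longrightarrow> h (k y) = y"
    using hk unfolding homeomorphic_maps_map top by blast+
  have him: "h ` A = B" and inj: "inj_on h A"
    using homeomorphic_imp_surjective_map[OF h] homeomorphic_imp_injective_map[OF h] unfolding top by blast+
  have CO: "C \<in> compact_opens (subtopology U D) \<longleftrightarrow> C \<in> compact_opens U \<and> C \<subseteq> D"
    if "openin U D" for U :: "'z topology" and C D
    using that by (auto simp: compact_opens_def compactin_subtopology openin_open_subtopology)
  have oA: "openin W A" "openin V B"
    using A B by (simp_all add: compact_opens_iff)
  have hC: "h ` C \<in> compact_opens V \<and> h ` C \<subseteq> B" if "C \<in> compact_opens W" "C \<subseteq> A" for C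
    using homeomorphic_map_compact_opens[OF h, of C] that
    by (simp add: compact_opens_def compactin_subtopology openin_open_subtopology oA)
  have kC: "k ` C \<in> compact_opens W \<and> k ` C \<subseteq> A" if "C \<in> compact_opens V" "C \<subseteq> B" for C
    using homeomorphic_map_compact_opens[OF k, of C] that
    by (simp add: compact_opens_def compactin_subtopology openin_open_subtopology oA)
  have "(\<lambda>C. h ` C) \<in> ring_iso (below_ring W A) (below_ring V B)"
  proof (rule ring_iso_memI)
    show "h ` C \<in> carrier (below_ring V B)" if "C \<in> carrier (below_ring W A)" for C
      using that hC by (simp add: below_ring_def)
    show "h ` (C \<otimes>\<^bsub>below_ring W A\<^esub> D) = h ` C \<otimes>\<^bsub>below_ring V B\<^esub> h ` D"
      if "C \<in> carrier (below_ring W A)" "D \<in> carrier (below_ring W A)" for C D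
      using that inj_on_image_Int[OF inj] by (simp add: below_ring_def)
    show "h ` (C \<oplus>\<^bsub>below_ring W A\<^esub> D) = h ` C \<oplus>\<^bsub>below_ring V B\<^esub> h ` D"
      if "C \<in> carrier (below_ring W A)" "D \<in> carrier (below_ring W A)" for C D
    proof -
      have "C \<subseteq> A" "D \<subseteq> A" using that by (simp_all add: below_ring_def)
      then have "h ` (C - D) = h ` C - h ` D" "h ` (D - C) = h ` D - h ` C"
        by (intro inj_on_image_set_diff[OF inj]; blast)+
      then show ?thesis by (simp add: below_ring_def image_Un)
    qed
    show "h ` \<one>\<^bsub>below_ring W A\<^esub> = \<one>\<^bsub>below_ring V B\<^esub>"
      using him by (simp add: below_ring_def)
    show "bij_betw (\<lambda>C. h ` C) (carrier (below_ring W A)) (carrier (below_ring V B))"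
    proof (rule bij_betw_byWitness[where f' = "\<lambda>C. k ` C"])
      show "\<forall>C\<in>carrier (below_ring W A). k ` h ` C = C"
        using kh(1) by (force simp: below_ring_def image_image)
      show "\<forall>C\<in>carrier (below_ring V B). h ` k ` C = C"
        using kh(2) by (force simp: below_ring_def image_image)
      show "(\<lambda>C. h ` C) ` carrier (below_ring W A) \<subseteq> carrier (below_ring V B)"
        unfolding image_subset_iff using hC by (simp add: below_ring_def)
      show "(\<lambda>C. k ` C) ` carrier (below_ring V B) \<subseteq> carrier (below_ring W A)"
        unfolding image_subset_iff using kC by (simp add: below_ring_def)
    qed
  qed
  then show ?thesis
    unfolding is_ring_iso_def by blast
qed

lemma co_class_eq:
  assumes h: "homeomorphic_map (subtopology W A) (subtopology W B) h"
    and A: "A \<in> compact_opens W" and B: "B \<in> compact_opens W"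
  shows "co_class W A = co_class W B"
proof -
  obtain k where "homeomorphic_map (subtopology W B) (subtopology W A) k"
    by (rule homeomorphic_map_inverseE[OF h]) blast
  then show ?thesis
    using below_ring_iso[OF h A B] below_ring_iso[OF _ B A] ring_iso_trans
    unfolding co_class_def by blast
qed

lemma canon_part_iff:
  "w \<in> canon_part W p \<longleftrightarrow> w \<in> topspace W \<and>
     (\<forall>U. openin W U \<and> w \<in> U \<longrightarrow> (\<exists>A\<in>compact_opens W. co_class W A = p \<and> w \<in> A \<and> A \<subseteq> U))"
proof -
  have "neighbourhood_base_at w (\<lambda>A. A \<in> compact_opens W \<and> co_class W A = p) W \<longleftrightarrow>
      (\<forall>U. openin W U \<and> w \<in> U \<longrightarrow> (\<exists>A. (A \<in> compact_opens W \<and> co_class W A = p) \<and> w \<in> A \<and> A \<subseteq> U))"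
    by (rule neighbourhood_base_at_open) (simp add: compact_opens_iff)
  then show ?thesis
    by (simp add: canon_part_def Bex_def conj_assoc)
qed

lemma canon_part_homeomorphic_image:
  assumes h: "homeomorphic_map W W h"
  shows "h ` canon_part W p = canon_part W p"
proof -
  have sub: "h w \<in> canon_part W p" if h: "homeomorphic_map W W h" and w: "w \<in> canon_part W p" for h w
  proof -
    have wtop: "w \<in> topspace W" and base: "\<And>U. openin W U \<Longrightarrow> w \<in> U \<Longrightarrow>
        \<exists>A\<in>compact_opens W. co_class W A = p \<and> w \<in> A \<and> A \<subseteq> U"
      using w unfolding canon_part_iff by blast+
    have "\<exists>A\<in>compact_opens W. co_class W A = p \<and> h w \<in> A \<and> A \<subseteq> U" if U: "openin W U" "h w \<in> U" for U
    proof -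
      have "openin W {x \<in> topspace W. h x \<in> U}"
        using homeomorphic_imp_continuous_map[OF h] U(1) by (simp add: continuous_map_def)
      then obtain A where A: "A \<in> compact_opens W" "co_class W A = p" "w \<in> A" "A \<subseteq> {x \<in> topspace W. h x \<in> U}"
        using base[of "{x \<in> topspace W. h x \<in> U}"] wtop U(2) by blast
      have hA: "h ` A \<in> compact_opens W"
        using homeomorphic_map_compact_opens[OF h A(1)] .
      have "homeomorphic_map (subtopology W A) (subtopology W (h ` A)) h"
        using compact_opens_subset_topspace[OF A(1)] compact_opens_subset_topspace[OF hA]
        by (intro homeomorphic_map_subtopologies[OF h]) (simp add: Int_absorb1)
      then have "co_class W (h ` A) = p"
        using co_class_eq[OF _ A(1) hA] A(2) by simp
      then show ?thesis
        using hA A(3,4) by blast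
    qed
    then show ?thesis
      unfolding canon_part_iff using wtop homeomorphic_imp_surjective_map[OF h] by blast
  qed
  obtain k where k: "homeomorphic_map W W k" "\<And>w. w \<in> topspace W \<Longrightarrow> h (k w) = w"
    by (rule homeomorphic_map_inverseE[OF h]) blast
  have "w \<in> h ` canon_part W p" if "w \<in> canon_part W p" for w
  proof -
    have "w \<in> topspace W" using that by (simp add: canon_part_def)
    then show ?thesis
      using sub[OF k(1) that] k(2) by (metis image_eqI)
  qed
  then show ?thesis
    using sub[OF h] by blast
qed

lemma trim_sets_same_class:
  assumes "omega_stone_space W" "trim_partition W P r Z" "p \<in> P" "A \<in> trim_at W P r Z p" "B \<in> trim_at W P r Z p"
  shows "below_ring W A \<simeq> below_ring W B" "co_class W A = co_class W B"
proof -
  obtain h where "homeomorphic_map (subtopology W A) (subtopology W B) h"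
    using compact_profile_homeomorphism[OF assms(1,1,2,2) trim_atD(1)[OF assms(4)] trim_atD(1)[OF assms(5)]
      same_profile_trim[OF assms(3-5)]] by blast
  then show "below_ring W A \<simeq> below_ring W B" "co_class W A = co_class W B"
    using below_ring_iso co_class_eq trim_atD(1)[OF assms(4)] trim_atD(1)[OF assms(5)] by blast+
qed

lemma (in trim_partition_space) trim_at_subset:
  assumes p: "p \<in> P" and A: "A \<in> trim_at W P r X p" and B: "B \<in> compact_opens W" "B \<subseteq> A" "B \<inter> X p \<noteq> {}"
  shows "B \<in> trim_at W P r X p"
  unfolding trim_at_iff
proof (intro conjI ballI impI)
  show "B \<in> compact_opens W" by (rule B(1))
  have oB: "openin W B" using B(1) by (simp add: compact_opens_iff)
  show "B \<inter> X q \<noteq> {} \<longleftrightarrow> p = q \<or> (p, q) \<in> r" if q: "q \<in> P" for q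
    using meets_above[OF q p oB B(3)] B(2,3) trim_atD(2)[OF A q] by blast
  assume "(p, p) \<notin> r"
  then obtain a where a: "A \<inter> X p = {a}"
    using trim_atD(3)[OF A p] by (meson card_1_singletonE)
  then have "B \<inter> X p \<subseteq> {a}"
    using B(2) by blast
  then have "B \<inter> X p = {a}"
    using B(3) by (meson subset_singletonD)
  then show "card (B \<inter> X p) = 1" by simp
qed

text \<open>Of any two complementary compact open subsets of a \<open>p\<close>-trim set, one contains a point of the part with index \<open>p\<close>,
  hence is \<open>p\<close>-trim itself.\<close>

lemma trim_set_pseudo_indecomposable:
  assumes \<omega>: "omega_stone_space W" and Z: "trim_partition W P r Z" and p: "p \<in> P" and A: "A \<in> trim_at W P r Z p"
  shows "pseudo_indecomposable W A"
proof -
  interpret trim_partition_space W P r Z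
    using \<omega> Z by unfold_locales (simp_all add: omega_stone_space_def)
  have AC: "A \<in> compact_opens W" using trim_atD(1)[OF A] .
  have ne: "A \<inter> Z p \<noteq> {}" using trim_atD(2)[OF A p] by blast
  show ?thesis
    unfolding pseudo_indecomposable_def
  proof (intro conjI ballI impI)
    show "A \<noteq> {}" using ne by blast
    fix B assume B: "B \<in> compact_opens W" "B \<subseteq> A"
    have D: "A - B \<in> compact_opens W"
      using compact_opens_Diff[OF Hausdorff AC B(1)] .
    show "below_ring W B \<simeq> below_ring W A \<or> below_ring W (A - B) \<simeq> below_ring W A"
    proof (cases "B \<inter> Z p = {}")
      case True
      then have "(A - B) \<inter> Z p \<noteq> {}" using ne by blast
      then show ?thesis
        using trim_sets_same_class(1)[OF \<omega> Z p trim_at_subset[OF p A D] A] by blast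
    next
      case False
      then show ?thesis
        using trim_sets_same_class(1)[OF \<omega> Z p trim_at_subset[OF p A B] A] by blast
    qed
  qed (rule AC)
qed

text \<open>Every point of \<open>Z p\<close> has a neighbourhood base of \<open>p\<close>-trim sets, and these are all isomorphic.\<close>

lemma part_subset_canon_part:
  assumes \<omega>: "omega_stone_space W" and Z: "trim_partition W P r Z" and p: "p \<in> P"
  shows "\<exists>c\<in>canon_index W. Z p \<subseteq> canon_part W c"
proof -
  interpret trim_partition_space W P r Z
    using \<omega> Z by unfold_locales (simp_all add: omega_stone_space_def)
  obtain z where z: "z \<in> Z p" "z \<in> topspace W"
    using X_nonempty[OF p] X_subset[OF p] by blast
  obtain A where A: "A \<in> trim_at W P r Z p"
    using trim_nbhd[OF p z(1) openin_topspace z(2)] by blast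
  define c where "c = co_class W A"
  have "c \<in> canon_index W"
    unfolding c_def canon_index_def using trim_set_pseudo_indecomposable[OF \<omega> Z p A] by blast
  moreover have "Z p \<subseteq> canon_part W c"
  proof
    fix w assume w: "w \<in> Z p"
    have "\<exists>B\<in>compact_opens W. co_class W B = c \<and> w \<in> B \<and> B \<subseteq> U" if U: "openin W U" "w \<in> U" for U
    proof -
      obtain B where B: "B \<in> trim_at W P r Z p" "w \<in> B" "B \<subseteq> U"
        using trim_nbhd[OF p w U] by blast
      then show ?thesis
        using trim_sets_same_class(2)[OF \<omega> Z p B(1) A] trim_atD(1)[OF B(1)] unfolding c_def by blast
    qed
    then show "w \<in> canon_part W c"
      unfolding canon_part_iff using w X_subset[OF p] by blast
  qed
  ultimately show ?thesis by blast
qed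

text \<open>Let \<open>Y\<close> be the canonical partition up to equivalence. Homeomorphisms fix the canonical parts, so the parts of
  \<open>Y\<close> are the canonical ones, each part of \<open>Z\<close> lies in one of them, and \<open>\<alpha>\<close> says that each of them lies in a part of \<open>Z\<close>.\<close>

lemma T_canon_maximal:
  assumes \<omega>: "omega_stone_space W" and b: "bounded_stone_space W"
  shows "qo_maximal (T_sys W) (T_prec W) (T_canon W)"
  unfolding qo_maximal_def
proof (intro conjI ballI impI)
  let ?X = "canon_part W"
  have X: "bounded_trim_partition_for W (canon_index W) (canon_rel W) (canon_L W) (canon_f W) ?X"
    using b by (simp add: bounded_stone_space_def)
  show "T_canon W \<in> T_sys W"
    unfolding T_canon_def T_sys_def
    using X by (intro quotientI) (auto simp: bounded_trim_partitions_def bounded_trim_partition_def)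
  fix \<Z> assume ZT: "\<Z> \<in> T_sys W" and "(T_canon W, \<Z>) \<in> T_prec W"
  then obtain Q s Y P r Z \<alpha> where m: "(Q, s, Y) \<in> T_canon W" "(P, r, Z) \<in> \<Z>"
    and ref: "regularly_refines_via W Q Y P r Z \<alpha>"
    unfolding T_prec_def by blast
  obtain h \<beta> where Y: "bounded_trim_partition W Q s Y" and h: "homeomorphic_map W W h"
    and \<beta>: "po_iso (canon_index W) (canon_rel W) Q s \<beta>"
    and im: "\<And>c. c \<in> canon_index W \<Longrightarrow> h ` ?X c = Y (\<beta> c)"
    using m(1) unfolding T_canon_def partition_equiv_def by blast
  have YX: "Y (\<beta> c) = ?X c" if "c \<in> canon_index W" for c
    using im[OF that] canon_part_homeomorphic_image[OF h] by simp
  have \<beta>Q: "\<beta> c \<in> Q" if "c \<in> canon_index W" for c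
    using \<beta> that by (auto simp: po_iso_def bij_betw_def)
  have Zt: "trim_partition W P r Z"
    using T_sys_member(1)[OF ZT m(2)] bounded_trimD(5) by blast
  interpret Y: trim_partition_space W Q s Y
    using \<omega> Y unfolding bounded_trim_partition_def
    by unfold_locales (auto simp: omega_stone_space_def dest: bounded_trimD(5))
  have "\<forall>p\<in>P. \<exists>c. c \<in> canon_index W \<and> Z p \<subseteq> ?X c"
    using part_subset_canon_part[OF \<omega> Zt] by blast
  from bchoice[OF this] obtain c where c: "\<And>p. p \<in> P \<Longrightarrow> c p \<in> canon_index W \<and> Z p \<subseteq> ?X (c p)"
    by blast
  have ZY: "Z p \<subseteq> Y (\<beta> (c p))" if "p \<in> P" for p
    using c[OF that] YX by blast
  have "regularly_refines_via W P Z Q s Y (\<beta> \<circ> c)"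
    unfolding regularly_refines_via_def
  proof (intro conjI ballI)
    show "(\<beta> \<circ> c) ` P \<subseteq> Q"
      using c \<beta>Q by auto
    show "Z p \<subseteq> Y ((\<beta> \<circ> c) p)" if "p \<in> P" for p
      using ZY[OF that] by simp
    fix q A assume q: "q \<in> trim_indices W Q s Y" and A: "A \<in> trim_at W Q s Y q"
    have qQ: "q \<in> Q" using q by (simp add: trim_indices_def)
    obtain y where y: "y \<in> A" "y \<in> Y q"
      using Y.trim_point[OF qQ A] by blast
    have \<alpha>q: "\<alpha> q \<in> P" "y \<in> Z (\<alpha> q)"
      using ref qQ y(2) unfolding regularly_refines_via_def by blast+
    then have "y \<in> Y (\<beta> (c (\<alpha> q)))"
      using ZY by blast
    then have "\<beta> (c (\<alpha> q)) = q"
      using Y.X_disjoint[OF \<beta>Q qQ] c[OF \<alpha>q(1)] y(2) by blast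
    moreover have "\<alpha> q \<in> type_set P Z A"
      using \<alpha>q y(1) unfolding type_set_def by blast
    ultimately show "q \<in> (\<beta> \<circ> c) ` type_set P Z A"
      by (metis comp_apply image_eqI)
  qed
  then show "(\<Z>, T_canon W) \<in> T_prec W"
    unfolding T_prec_def using m ZT \<open>T_canon W \<in> T_sys W\<close> by blast
qed

theorem theorem3p37:
  fixes W :: "'w topology"
  assumes "omega_stone_space W" and "bounded_stone_space W"
  shows "preorder_on (T_sys W) (T_prec W) \<and> preorder_on (P_sys W) (P_prec W) \<and>
    qo_isomorphic (T_sys W) (T_prec W) (P_sys W) (P_prec W) \<and>
    qo_maximal (T_sys W) (T_prec W) (T_canon W) \<and>
    qo_maximal (P_sys W) (P_prec W) (P_canon W)"
proof -
  note \<omega> = assms(1)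
  let ?\<phi> = "ext_po_class W"
  have bij: "bij_betw ?\<phi> (T_sys W) (P_sys W)"
    by (rule ext_po_class_bij[OF \<omega>])
  have \<phi>P: "?\<phi> \<Y> \<in> P_sys W" if "\<Y> \<in> T_sys W" for \<Y>
    using bij that by (auto simp: bij_betw_def)
  have ord: "(\<Y>, \<Z>) \<in> T_prec W \<longleftrightarrow> (?\<phi> \<Y>, ?\<phi> \<Z>) \<in> P_prec W" if "\<Y> \<in> T_sys W" "\<Z> \<in> T_sys W" for \<Y> \<Z>
    by (rule ext_po_class_prec_iff[OF \<omega> that])
  have preP: "preorder_on (P_sys W) (P_prec W)"
    by (rule preorder_P)
  then have reflP: "refl_on (P_sys W) (P_prec W)" and transP: "trans (P_prec W)"
    by (simp_all add: preorder_on_def)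
  have Tsub: "T_prec W \<subseteq> T_sys W \<times> T_sys W"
    unfolding T_prec_def by blast
  have "refl_on (T_sys W) (T_prec W)"
    using ord \<phi>P reflP by (intro refl_onI) (blast dest: refl_onD)
  moreover have "trans (T_prec W)"
  proof (rule transI)
    fix x y z assume xy: "(x, y) \<in> T_prec W" "(y, z) \<in> T_prec W"
    then have "x \<in> T_sys W" "y \<in> T_sys W" "z \<in> T_sys W"
      using Tsub by blast+
    then show "(x, z) \<in> T_prec W"
      using xy ord transD[OF transP] by blast
  qed
  ultimately have preT: "preorder_on (T_sys W) (T_prec W)"
    using Tsub by (simp add: preorder_on_def)
  have maxT: "qo_maximal (T_sys W) (T_prec W) (T_canon W)"
    by (rule T_canon_maximal[OF assms])
  have "bounded_trim_partition_for W (canon_index W) (canon_rel W) (canon_L W) (canon_f W) (canon_part W)"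
    using assms(2) by (simp add: bounded_stone_space_def)
  then have canon: "?\<phi> (T_canon W) = P_canon W"
    unfolding T_canon_def P_canon_def by (rule ext_po_class_eq[OF \<omega>])
  have "qo_maximal (P_sys W) (P_prec W) (P_canon W)"
    unfolding qo_maximal_def
  proof (intro conjI ballI impI)
    have TC: "T_canon W \<in> T_sys W"
      using maxT by (simp add: qo_maximal_def)
    then show "P_canon W \<in> P_sys W"
      using \<phi>P canon by metis
    fix E assume E: "E \<in> P_sys W" "(P_canon W, E) \<in> P_prec W"
    obtain \<Y> where \<Y>: "\<Y> \<in> T_sys W" "E = ?\<phi> \<Y>"
      using bij E(1) unfolding bij_betw_def by blast
    have "(T_canon W, \<Y>) \<in> T_prec W"
      using ord[OF TC \<Y>(1)] E(2) \<Y>(2) canon by simp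
    then have "(\<Y>, T_canon W) \<in> T_prec W"
      using maxT \<Y>(1) by (simp add: qo_maximal_def)
    then show "(E, P_canon W) \<in> P_prec W"
      using ord[OF \<Y>(1) TC] \<Y>(2) canon by simp
  qed
  moreover have "qo_isomorphic (T_sys W) (T_prec W) (P_sys W) (P_prec W)"
    unfolding qo_isomorphic_def using bij ord by blast
  ultimately show ?thesis
    using preT preP maxT by blast
qed

end
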